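(* Let $d\ge 1$, let $\mu$ be a strictly elliptic law on $\mathcal P_+$, and let $P_0$ be the annealed law of the associated random walk $(X_n)_{n\ge 0}$ in i.i.d. random environment on $\mathbb Z^d$ started at $0$. The following three statements are equivalent: (i) There exists a non-empty open set $\mathcal O\subset\mathbb R^d$ such that for all $\ell\in\mathcal O$, $P_0(A_\ell)=1$. (ii) There exists a (deterministic) $\nu\in S^{d-1}$ such that $P_0$-almost surely $\dfrac{X_n}{|X_n|}\xrightarrow[n\to\infty]{}\nu$. (iii) There exists $\nu\in\mathbb R^d\setminus\{0\}$ such that for all $\ell\in\mathbb R^d$, if $\ell\cdot\nu>0$ then $P_0(A_\ell)=1$.
   Context: Setting (random walk in i.i.d. random environment). $|\cdot|$ is the Euclidean norm, $\cdot$ the Euclidean inner product, $S^{d-1}$ the Euclidean unit sphere of $\mathbb R^d$. $\mathcal P_+$ is the set of probability vectors $(p(e))_{e}$ indexed by the $2d$ unit vectors $e\in\mathbb Z^d$, $|e|=1$ (i.e. $p(e)\in[0,1]$, $\sum_e p(e)=1$). An environment is an element $\omega=(\omega_z)_{z\in\mathbb Z^d}$ of $\Omega=\mathcal P_+^{\mathbb Z^d}$. For fixed $\omega$ and $x\in\mathbb Z^d$, $P_{x,\omega}$ (the quenched law) is the law of the Markov chain $(X_n)_{n\ge0}$ on $\mathbb Z^d$ with $P_{x,\omega}(X_0=x)=1$ and $P_{x,\omega}(X_{n+1}=z+e\mid X_n=z)=\omega_z(e)$ for $z,e\in\mathbb Z^d$, $|e|=1$. Given a probability law $\mu$ on $\mathcal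 P_+$, set $\mathbb P=\mu^{\otimes\mathbb Z^d}$ on $\Omega$; the annealed law $P_x$ on $\Omega\times(\mathbb Z^d)^{\mathbb N}$ is the semi-product $P_x=\mathbb P\times P_{x,\omega}$. Strict ellipticity of $\mu$: for every $e\in\mathbb Z^d$ with $|e|=1$, $\omega_0(e)>0$ $\mathbb P$-almost surely. For $\ell\in\mathbb R^d$, $A_\ell=\{\lim_{n\to\infty}X_n\cdot\ell=+\infty\}$. The value given to $X_n/|X_n|$ when $X_n=0$ is an arbitrary fixed convention (e.g. $0$). *)

theory Defs
  imports "HOL-Probability.Probability"
begin

definition real_vec :: "int ^ 'd \<Rightarrow> real ^ 'd" where
  "real_vec z = (\<chi> i. real_of_int (z $ i))"

definition unit_steps :: "(int ^ 'd::finite) set" where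
  "unit_steps = {e. norm (real_vec e) = 1}"

definition prob_vectors :: "(int ^ 'd::finite \<Rightarrow> real) set" where
  "prob_vectors = {p \<in> unit_steps \<rightarrow>\<^sub>E {0..1}. (\<Sum>e\<in>unit_steps. p e) = 1}"

text \<open>The Borel sigma-algebra of the simplex, as a subset of the product of real lines
  indexed by the unit steps.\<close>

definition prob_vector_space :: "(int ^ 'd::finite \<Rightarrow> real) measure" where
  "prob_vector_space = restrict_space (Pi\<^sub>M unit_steps (\<lambda>_. borel)) prob_vectors"

type_synonym 'd env = "int ^ 'd \<Rightarrow> int ^ 'd \<Rightarrow> real"

definition env_law :: "(int ^ 'd::finite \<Rightarrow> real) measure \<Rightarrow> 'd env measure" where
  "env_law \<mu> = Pi\<^sub>M UNIV (\<lambda>_. \<mu>)"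

definition strictly_elliptic :: "(int ^ 'd::finite \<Rightarrow> real) measure \<Rightarrow> bool" where
  "strictly_elliptic \<mu> \<longleftrightarrow> (\<forall>e\<in>unit_steps. AE \<omega> in env_law \<mu>. \<omega> 0 e > 0)"

abbreviation path_space :: "(nat \<Rightarrow> int ^ 'd::finite) measure" where
  "path_space \<equiv> Pi\<^sub>M UNIV (\<lambda>_. count_space UNIV)"

definition step_prob :: "'d::finite env \<Rightarrow> int ^ 'd \<Rightarrow> int ^ 'd \<Rightarrow> real" where
  "step_prob \<omega> z y = (if y - z \<in> unit_steps then \<omega> z (y - z) else 0)"

definition step_law :: "'d::finite env \<Rightarrow> int ^ 'd \<Rightarrow> (int ^ 'd) measure" where
  "step_law \<omega> z = density (count_space UNIV) (\<lambda>y. ennreal (step_prob \<omega> z y))"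

text \<open>The law of \<open>X\<^sub>n\<close> given the history \<open>X\<^sub>0, \<dots>, X\<^sub>n\<^sub>-\<^sub>1\<close>, in the format of the
  Ionescu-Tulcea theorem.\<close>

definition walk_kernel ::
    "'d::finite env \<Rightarrow> int ^ 'd \<Rightarrow> nat \<Rightarrow> (nat \<Rightarrow> int ^ 'd) \<Rightarrow> (int ^ 'd) measure" where
  "walk_kernel \<omega> x n X =
     (case n of 0 \<Rightarrow> return (count_space UNIV) x | Suc m \<Rightarrow> step_law \<omega> (X m))"

text \<open>The Ionescu-Tulcea limit is only meaningful for \<open>\<omega> z \<in> prob_vectors\<close>; see
  \<open>Ionescu_Tulcea_walk\<close>, \<open>quenched_start\<close> and \<open>quenched_markov\<close> below.\<close>

definition quenched :: "int ^ 'd::finite \<Rightarrow> 'd env \<Rightarrow> (nat \<Rightarrow> int ^ 'd) measure" where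
  "quenched x \<omega> = projective_family.lim UNIV
     (Ionescu_Tulcea.CI (walk_kernel \<omega> x) (\<lambda>_. count_space UNIV)) (\<lambda>_. count_space UNIV)"

definition annealed ::
    "(int ^ 'd::finite \<Rightarrow> real) measure \<Rightarrow> int ^ 'd \<Rightarrow> ('d env \<times> (nat \<Rightarrow> int ^ 'd)) measure" where
  "annealed \<mu> x = env_law \<mu> \<bind>
     (\<lambda>\<omega>. distr (quenched x \<omega>) (env_law \<mu> \<Otimes>\<^sub>M path_space) (\<lambda>X. (\<omega>, X)))"

definition transient_in :: "real ^ 'd \<Rightarrow> (nat \<Rightarrow> int ^ 'd::finite) \<Rightarrow> bool" where
  "transient_in l X \<longleftrightarrow> filterlim (\<lambda>n. real_vec (X n) \<bullet> l) at_top sequentially"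

lemma finite_unit_steps [simp]: "finite (unit_steps :: (int ^ 'd::finite) set)"
proof -
  have "(unit_steps :: (int ^ 'd) set) \<subseteq> vec_lambda ` (UNIV \<rightarrow>\<^sub>E {-1..1})"
  proof
    fix e :: "int ^ 'd" assume "e \<in> unit_steps"
    then have "\<bar>real_of_int (e $ i)\<bar> \<le> 1" for i
      using component_le_norm_cart[of "real_vec e" i] by (simp add: unit_steps_def real_vec_def)
    then have "\<bar>e $ i\<bar> \<le> 1" for i
      by (metis of_int_abs of_int_le_1_iff)
    then have "(\<lambda>i. e $ i) \<in> UNIV \<rightarrow>\<^sub>E {-1..1}"
      by (simp add: PiE_iff abs_le_iff)
    then show "e \<in> vec_lambda ` (UNIV \<rightarrow>\<^sub>E {-1..1})"
      by (metis imageI vec_nth_inverse eta_contract_eq)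
  qed
  then show ?thesis
    by (rule finite_subset) (auto intro!: finite_imageI finite_PiE)
qed

lemma emeasure_step_law: "emeasure (step_law \<omega> z) {y} = ennreal (step_prob \<omega> z y)"
  by (simp add: step_law_def emeasure_density nn_integral_count_space_indicator[symmetric]
      nn_integral_indicator_singleton)

lemma prob_space_step_law:
  assumes "\<omega> z \<in> prob_vectors"
  shows "prob_space (step_law \<omega> z)"
proof
  let ?S = "(\<lambda>e. z + e) ` unit_steps"
  have "emeasure (step_law \<omega> z) (space (step_law \<omega> z)) =
      (\<integral>\<^sup>+ y. ennreal (step_prob \<omega> z y) \<partial>count_space UNIV)"
    by (simp add: step_law_def emeasure_density)
  also have "\<dots> = (\<Sum>y\<in>?S. ennreal (step_prob \<omega> z y))"
  proof (rule nn_integral_count_space')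
    show "ennreal (step_prob \<omega> z y) = 0" if "y \<notin> ?S" for y
      using that by (auto simp: step_prob_def image_iff dest: bspec[of _ _ "y - z"])
  qed auto
  also have "\<dots> = (\<Sum>e\<in>unit_steps. ennreal (\<omega> z e))"
    by (subst sum.reindex) (auto simp: step_prob_def)
  also have "\<dots> = ennreal (\<Sum>e\<in>unit_steps. \<omega> z e)"
    using assms by (intro sum_ennreal) (auto simp: prob_vectors_def)
  also have "\<dots> = 1"
    using assms by (simp add: prob_vectors_def)
  finally show "emeasure (step_law \<omega> z) (space (step_law \<omega> z)) = 1" .
qed

lemma sets_step_law [simp]: "sets (step_law \<omega> z) = UNIV"
  by (simp add: step_law_def)

lemma Ionescu_Tulcea_walk:
  assumes "\<And>z. \<omega> z \<in> prob_vectors"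
  shows "Ionescu_Tulcea (walk_kernel \<omega> x) (\<lambda>_. count_space UNIV)"
proof (rule Ionescu_Tulcea.intro)
  fix i :: nat
  show "prob_space (walk_kernel \<omega> x i X)" for X
    by (auto simp: walk_kernel_def split: nat.split
        intro!: prob_space_return prob_space_step_law assms)
  have step: "step_law \<omega> \<in> measurable (count_space UNIV) (subprob_algebra (count_space UNIV))"
    by (auto simp: space_subprob_algebra
        intro!: prob_space_imp_subprob_space prob_space_step_law assms)
  show "walk_kernel \<omega> x i \<in>
      measurable (Pi\<^sub>M {0..<i} (\<lambda>_. count_space UNIV)) (subprob_algebra (count_space UNIV))"
  proof (cases i)
    case 0
    then show ?thesis
      by (simp add: walk_kernel_def[abs_def] space_subprob_algebra
          prob_space_imp_subprob_space prob_space_return)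
  next
    case (Suc m)
    then show ?thesis
      by (auto simp: walk_kernel_def[abs_def]
          intro!: measurable_compose[OF measurable_component_singleton[of m] step])
  qed
qed

lemma (in Ionescu_Tulcea) emeasure_C_singleton:
  assumes M: "\<And>i. M i = count_space UNIV" and countable: "countable (UNIV :: 'a set)"
  shows "emeasure (C 0 n (\<lambda>_. undefined)) {restrict a {0..<n}} =
    (\<Prod>k<n. emeasure (P k (restrict a {0..<k})) {a k})"
proof (induction n)
  case 0
  then show ?case
    by (simp add: restrict_def PiM_empty)
next
  case (Suc n)
  have sing: "{restrict a {0..<m}} \<in> sets (Pi\<^sub>M {0..<m} M)" for m
  proof -
    have "{restrict a {0..<m}} = Pi\<^sub>E {0..<m} (\<lambda>k. {a k})"
      by (auto simp: PiE_iff extensional_def fun_eq_iff)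
    then show ?thesis by (auto simp: M intro!: sets_PiM_I_finite)
  qed
  have space: "space (C 0 n (\<lambda>_. undefined)) = space (Pi\<^sub>M {0..<n} M)"
    by (simp add: space_C)
  have C: "C 0 n (\<lambda>_. undefined) \<in> space (subprob_algebra (Pi\<^sub>M {0..<n} M))"
    using measurable_space[OF measurable_C[of 0 n], of "\<lambda>_. undefined"] by simp
  have "emeasure (C 0 (Suc n) (\<lambda>_. undefined)) {restrict a {0..<Suc n}} =
      (\<integral>\<^sup>+ w. emeasure (eP n w) {restrict a {0..<Suc n}} \<partial>C 0 n (\<lambda>_. undefined))"
    using measurable_eP[of n] sing[of "Suc n"]
    by (simp, intro emeasure_bind[where N = "Pi\<^sub>M {0..<Suc n} M"])
       (auto simp: space measurable_cong_sets[OF sets_C])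
  also have "\<dots> = (\<integral>\<^sup>+ w. emeasure (P n (restrict a {0..<n})) {a n} *
      indicator {restrict a {0..<n}} w \<partial>C 0 n (\<lambda>_. undefined))"
  proof (rule nn_integral_cong)
    fix w assume "w \<in> space (C 0 n (\<lambda>_. undefined))"
    then have w: "w \<in> space (Pi\<^sub>M {0..<n} M)" by (simp add: space)
    then have ext: "w k = undefined" if "k \<ge> n" for k
      using that by (auto simp: space_PiM PiE_iff extensional_def)
    have "w(n := y) = restrict a {0..<Suc n} \<longleftrightarrow> w = restrict a {0..<n} \<and> y = a n" for y
      by (auto simp: fun_eq_iff restrict_def ext less_Suc_eq split: if_splits)
    then have "(\<lambda>y. w(n := y)) -` {restrict a {0..<Suc n}} \<inter> space (M n) =
        (if w = restrict a {0..<n} then {a n} else {})"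
      by (auto simp: M)
    then show "emeasure (eP n w) {restrict a {0..<Suc n}} =
        emeasure (P n (restrict a {0..<n})) {a n} * indicator {restrict a {0..<n}} w"
      using emeasure_eP[OF w sing[of "Suc n"]] by (simp add: indicator_def)
  qed
  also have "\<dots> = emeasure (P n (restrict a {0..<n})) {a n} *
      emeasure (C 0 n (\<lambda>_. undefined)) {restrict a {0..<n}}"
    using sing[of n] by (intro nn_integral_cmult_indicator) (simp add: sets_C)
  finally show ?case
    by (simp only: Suc.IH prod.lessThan_Suc mult.commute)
qed

context
  fixes \<omega> :: "'d::finite env" and x :: "int ^ 'd"
  assumes env: "\<And>z. \<omega> z \<in> prob_vectors"
begin

interpretation W: Ionescu_Tulcea "walk_kernel \<omega> x" "\<lambda>_. count_space UNIV"
  by (rule Ionescu_Tulcea_walk[OF env])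

lemma prob_space_quenched: "prob_space (quenched x \<omega>)"
proof
  let ?N = "Pi\<^sub>M {} (\<lambda>_. count_space UNIV) :: (nat \<Rightarrow> int ^ 'd) measure"
  interpret CI: prob_space "W.CI {}"
    by (rule W.PF.prob_space_P) auto
  have space: "space (W.CI {}) = space ?N"
    by (simp add: W.CI_def)
  have "prod_emb UNIV (\<lambda>_. count_space UNIV) {} (space ?N) = space (quenched x \<omega>)"
    by (auto simp: prod_emb_def quenched_def space_PiM restrict_def)
  then have "emeasure (quenched x \<omega>) (space (quenched x \<omega>)) = emeasure (W.CI {}) (space ?N)"
    using W.lim[of "{}" "space ?N"] by (simp add: quenched_def del: prod_emb_empty)
  then show "emeasure (quenched x \<omega>) (space (quenched x \<omega>)) = 1"
    using CI.emeasure_space_1 by (simp add: space)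
qed

lemma sets_quenched: "sets (quenched x \<omega>) = sets path_space"
  by (simp add: quenched_def)

lemma quenched_cylinder:
  "emeasure (quenched x \<omega>) {X. \<forall>k\<le>n. X k = a k} =
    (if a 0 = x then \<Prod>k<n. ennreal (step_prob \<omega> (a k) (a (Suc k))) else 0)"
proof -
  let ?M = "\<lambda>_::nat. count_space UNIV :: (int ^ 'd) measure"
  let ?s = "{restrict a {0..<Suc n}}"
  have "?s = Pi\<^sub>E {0..<Suc n} (\<lambda>k. {a k})"
    by (auto simp: PiE_iff extensional_def fun_eq_iff)
  then have s: "?s \<in> sets (Pi\<^sub>M {0..<Suc n} ?M)"
    by (auto intro!: sets_PiM_I_finite)
  have "{X. \<forall>k\<le>n. X k = a k} = prod_emb UNIV ?M {0..<Suc n} ?s"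
    by (auto simp: prod_emb_def space_PiM fun_eq_iff restrict_def less_Suc_eq_le) metis
  then have "emeasure (quenched x \<omega>) {X. \<forall>k\<le>n. X k = a k} =
      emeasure (W.C 0 (Suc n) (\<lambda>_. undefined)) ?s"
    using s by (simp add: quenched_def W.lim W.emeasure_CI[where n = "Suc n"] prod_emb_id
        sets.sets_into_space del: W.C.simps)
  also have "\<dots> = (\<Prod>k<Suc n. emeasure (walk_kernel \<omega> x k (restrict a {0..<k})) {a k})"
    by (rule W.emeasure_C_singleton) auto
  also have "\<dots> = emeasure (walk_kernel \<omega> x 0 (restrict a {0..<0})) {a 0} *
      (\<Prod>k<n. emeasure (walk_kernel \<omega> x (Suc k) (restrict a {0..<Suc k})) {a (Suc k)})"
    by (rule prod.lessThan_Suc_shift)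
  finally show ?thesis
    by (auto simp: walk_kernel_def emeasure_step_law indicator_def)
qed

lemma quenched_start: "emeasure (quenched x \<omega>) {X. X 0 = x} = 1"
  using quenched_cylinder[of 0 "\<lambda>_. x"] by simp

lemma quenched_markov:
  assumes "e \<in> unit_steps"
  shows "emeasure (quenched x \<omega>) {X. (\<forall>k\<le>n. X k = a k) \<and> X (Suc n) = a n + e} =
    emeasure (quenched x \<omega>) {X. \<forall>k\<le>n. X k = a k} * ennreal (\<omega> (a n) e)"
proof -
  have "{X. (\<forall>k\<le>n. X k = a k) \<and> X (Suc n) = a n + e} =
      {X. \<forall>k\<le>Suc n. X k = (a(Suc n := a n + e)) k}"
    by (auto simp: le_Suc_eq)
  then show ?thesis
    using assms by (simp only: quenched_cylinder)
      (auto simp: step_prob_def intro!: prod.cong arg_cong2[where f = "(*)"])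
qed

end

lemma space_env_law:
  assumes "sets \<mu> = sets prob_vector_space"
  shows "space (env_law \<mu>) = {\<omega>. \<forall>z. \<omega> z \<in> prob_vectors}"
  using sets_eq_imp_space_eq[OF assms]
  by (auto simp: env_law_def space_PiM prob_vector_space_def space_restrict_space
      prob_vectors_def PiE_iff extensional_def)

lemma sets_path_space:
  "sets (path_space :: (nat \<Rightarrow> int ^ 'd::finite) measure) =
    sigma_sets UNIV (insert {} (range (\<lambda>(n, a). {X. \<forall>k\<le>n. X k = a k})))"
    (is "_ = sigma_sets UNIV ?G")
proof (rule antisym)
  show "sets path_space \<subseteq> sigma_sets UNIV ?G"
    unfolding sets_PiM_single
  proof (simp, rule sigma_sets_mono, safe)
    fix i and A :: "(int ^ 'd) set"
    define cyl where "cyl l = {X :: nat \<Rightarrow> int ^ 'd. \<forall>k\<le>i. X k = l ! k}" for l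
    have "{X. X i \<in> A} = (\<Union>l\<in>{l. l ! i \<in> A}. cyl l)"
    proof safe
      fix X :: "nat \<Rightarrow> int ^ 'd" assume "X i \<in> A"
      then show "X \<in> (\<Union>l\<in>{l. l ! i \<in> A}. cyl l)"
        by (intro UN_I[of "map X [0..<Suc i]"]) (auto simp: cyl_def simp del: upt_Suc)
    qed (auto simp: cyl_def)
    also have "\<dots> \<in> sigma_sets UNIV ?G"
    proof (rule sigma_sets_UNION)
      show "B \<in> sigma_sets UNIV ?G" if "B \<in> cyl ` {l. l ! i \<in> A}" for B
        using that by (auto simp: cyl_def intro!: sigma_sets.Basic)
    qed simp
    finally show "{X. X i \<in> A} \<in> sigma_sets UNIV ?G" .
  qed
  have "{X. \<forall>k\<le>n. X k = a k} \<in> sets path_space" for n and a :: "nat \<Rightarrow> int ^ 'd"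
  proof -
    have "{X. \<forall>k\<le>n. X k = a k} = (\<Inter>k\<in>{..n}. (\<lambda>X. X k) -` {a k} \<inter> space path_space)"
      by (auto simp: space_PiM)
    also have "\<dots> \<in> sets path_space"
      by (intro sets.finite_INT measurable_sets[where A = "count_space UNIV"]
          measurable_component_singleton) auto
    finally show ?thesis .
  qed
  then show "sigma_sets UNIV ?G \<subseteq> sets path_space"
    using sets.sigma_sets_subset[of ?G path_space]
    by (simp add: space_PiM image_subset_iff split_beta)
qed

lemma measurable_quenched:
  assumes "sets \<mu> = sets prob_vector_space"
  shows "quenched x \<in> measurable (env_law \<mu>) (prob_algebra path_space)"
proof (rule measurable_prob_algebra_generated[OF sets_path_space])
  show "Int_stable (insert {} (range (\<lambda>(n, a). {X :: nat \<Rightarrow> int ^ 'a. \<forall>k\<le>n. X k = a k})))"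
    (is "Int_stable ?G")
  proof -
    have "{X. \<forall>k\<le>n. X k = a k} \<inter> {X. \<forall>k\<le>m. X k = b k} \<in> ?G"
      for n m and a b :: "nat \<Rightarrow> int ^ 'a"
    proof (cases "\<forall>k\<le>min n m. a k = b k")
      case True
      then have "{X. \<forall>k\<le>n. X k = a k} \<inter> {X. \<forall>k\<le>m. X k = b k} =
          {X. \<forall>k\<le>max n m. X k = (if n \<le> m then b else a) k}"
        by (auto simp: min_def max_def split: if_splits)
      then show ?thesis by (auto intro!: image_eqI[of _ _ "(max n m, if n \<le> m then b else a)"])
    next
      case False
      then have "{X. \<forall>k\<le>n. X k = a k} \<inter> {X. \<forall>k\<le>m. X k = b k} = {}"
        by auto
      then show ?thesis by simp
    qed
    then show ?thesis by (auto simp: Int_stable_def)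
  qed
next
  fix A :: "(nat \<Rightarrow> int ^ 'a) set"
  assume "A \<in> insert {} (range (\<lambda>(n, a). {X. \<forall>k\<le>n. X k = a k}))"
  then consider "A = {}" | n a where "A = {X. \<forall>k\<le>n. X k = a k}"
    by auto
  then show "(\<lambda>\<omega>. emeasure (quenched x \<omega>) A) \<in> borel_measurable (env_law \<mu>)"
  proof cases
    case 2
    have comp: "(\<lambda>\<omega>. \<omega> z e) \<in> borel_measurable (env_law \<mu>)" if "e \<in> unit_steps" for z e
    proof -
      have "(\<lambda>p. p e) \<in> borel_measurable \<mu>"
        unfolding measurable_cong_sets[OF assms refl] prob_vector_space_def
        using that by (intro measurable_restrict_space1) simp
      then show ?thesis
        unfolding env_law_def by (intro measurable_compose[OF measurable_component_singleton]) auto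
    qed
    have "(\<lambda>\<omega>. step_prob \<omega> z y) \<in> borel_measurable (env_law \<mu>)" for z y
      by (cases "y - z \<in> unit_steps") (auto simp: step_prob_def comp)
    then have "(\<lambda>\<omega>. if a 0 = x then \<Prod>k<n. ennreal (step_prob \<omega> (a k) (a (Suc k))) else 0)
        \<in> borel_measurable (env_law \<mu>)"
      by (cases "a 0 = x") auto
    then show ?thesis
      by (subst measurable_cong[where g = "\<lambda>\<omega>. if a 0 = x
            then \<Prod>k<n. ennreal (step_prob \<omega> (a k) (a (Suc k))) else 0"])
         (auto simp: space_env_law[OF assms] quenched_cylinder 2)
  qed simp
qed (auto simp: space_env_law[OF assms] prob_space_quenched sets_quenched)

lemma emeasure_annealed:
  assumes "prob_space \<mu>" "sets \<mu> = sets prob_vector_space"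
    and "A \<in> sets (env_law \<mu> \<Otimes>\<^sub>M path_space)"
  shows "emeasure (annealed \<mu> x) A = (\<integral>\<^sup>+ \<omega>. emeasure (quenched x \<omega>) {X. (\<omega>, X) \<in> A} \<partial>env_law \<mu>)"
    and "annealed \<mu> x \<in> space (prob_algebra (env_law \<mu> \<Otimes>\<^sub>M path_space))"
proof -
  have env: "env_law \<mu> \<in> space (prob_algebra (env_law \<mu>))"
    using assms(1) by (auto simp: space_prob_algebra env_law_def intro!: prob_space_PiM)
  have kernel: "(\<lambda>\<omega>. distr (quenched x \<omega>) (env_law \<mu> \<Otimes>\<^sub>M path_space) (\<lambda>X. (\<omega>, X)))
      \<in> measurable (env_law \<mu>) (prob_algebra (env_law \<mu> \<Otimes>\<^sub>M path_space))"
    by (intro measurable_distr_prob_space2[OF measurable_quenched[OF assms(2)]]) simp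
  show "annealed \<mu> x \<in> space (prob_algebra (env_law \<mu> \<Otimes>\<^sub>M path_space))"
    unfolding annealed_def
    using measurable_space[OF measurable_bind_prob_space[OF
        measurable_const[OF env, of "count_space {()}"] kernel], of "()"]
    by simp
  show "emeasure (annealed \<mu> x) A = (\<integral>\<^sup>+ \<omega>. emeasure (quenched x \<omega>) {X. (\<omega>, X) \<in> A} \<partial>env_law \<mu>)"
    unfolding annealed_def emeasure_bind_prob_algebra[OF env kernel assms(3)]
  proof (rule nn_integral_cong)
    fix \<omega> assume \<omega>: "\<omega> \<in> space (env_law \<mu>)"
    then have sets: "sets (quenched x \<omega>) = sets path_space"
      by (simp add: space_env_law[OF assms(2)] sets_quenched)
    then show "emeasure (distr (quenched x \<omega>) (env_law \<mu> \<Otimes>\<^sub>M path_space) (\<lambda>X. (\<omega>, X))) A =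
        emeasure (quenched x \<omega>) {X. (\<omega>, X) \<in> A}"
      using \<omega> assms(3) sets_eq_imp_space_eq[OF sets]
      by (subst emeasure_distr)
         (auto simp: measurable_cong_sets[OF sets refl] vimage_def space_PiM)
  qed
qed

end

theory Submission
  imports Defs
begin

text \<open>
  Transience in an open set of directions confines the walk, up to a finite shift, to a cone \<open>C\<close> on
  which \<open>norm x \<le> c * (x \<bullet> l)\<close>. By ellipticity the walk stays in \<open>C\<close> forever with positive
  probability. A time is a regeneration time if the walk attains a strict record of
  \<open>x \<bullet> l\<close> there and stays afterwards in the shifted cone. The environments seen before and after are
  then disjoint, so the path after a regeneration is independent of the past and has the law \<open>Q\<close>
  of the walk conditioned to stay in \<open>C\<close>; hence shifting to the next regeneration preserves \<open>Q\<close>.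

  The level gained between regenerations has finite mean: every strict record is a
  regeneration time with the same positive conditional probability, the records below level \<open>s\<close>
  number at least \<open>s / norm l\<close>, and the gaps between regenerations below level \<open>s\<close> add up to
  at most about \<open>s\<close>. A law of large numbers, obtained from the maximal ergodic inequality, gives
  the direction along regeneration times, and the cone controls the walk in between.

  Conversely, an asymptotic direction excludes infinitely many visits to \<open>0\<close>. By ellipticity a
  site visited infinitely often would make every site visited infinitely often, so the walk tends to
  infinity.
\<close>

section \<open>Birkhoff averages of a decoupled shift\<close>

text \<open>A regeneration is not a stopping time, since it looks at the whole future. Factorization
  is therefore proved at fixed times \<open>n\<close>, for events settled by time \<open>n\<close>,
  and only for continuations inside \<open>C\<close>: a walk that leaves the shifted cone may return
  to sites whose environment has already been used. To fit this form, every event about the next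
  regeneration is split into a part visible at that time and the event that the continuation stays
  in the cone. Additivity of \<open>C\<close> makes the split possible.

  In the law of large numbers, decoupling of the first gap from the shifted path takes the place of
  ergodicity: the set where the sums are unbounded is invariant, and over such a set the integral of
  the gap splits into a product.

  Ellipticity enters twice, each time through quenched estimates: a straight segment has positive
  probability in almost every environment, and a site visited infinitely often passes this property
  on to its neighbours.\<close>

locale decoupled_shift = prob_space Q for Q :: "'a measure" +
  fixes T :: "'a \<Rightarrow> 'a" and f :: "'a \<Rightarrow> real"
  assumes measurable_T [measurable]: "T \<in> measurable Q Q"
    and distr_T: "distr Q Q T = Q"
    and integrable_f: "integrable Q f"
    and decoupled: "\<And>E. E \<in> sets Q \<Longrightarrow> (\<integral>x. f x * indicator E (T x) \<partial>Q) = (\<integral>x. f x \<partial>Q) * prob E"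
begin

definition birkhoff :: "nat \<Rightarrow> 'a \<Rightarrow> real" where
  "birkhoff k x = (\<Sum>j<k. f ((T ^^ j) x))"

lemma measurable_f [measurable]: "f \<in> borel_measurable Q"
  using integrable_f by simp

lemma measurable_birkhoff [measurable]: "birkhoff k \<in> borel_measurable Q"
  unfolding birkhoff_def[abs_def] by measurable

lemma birkhoff_Suc: "birkhoff (Suc k) x = f x + birkhoff k (T x)"
  by (simp only: birkhoff_def sum.lessThan_Suc_shift) (simp add: funpow_swap1 funpow_Suc_right del: funpow.simps)

lemma integral_T:
  fixes h :: "'a \<Rightarrow> real"
  assumes "h \<in> borel_measurable Q"
  shows "(\<integral>x. h (T x) \<partial>Q) = (\<integral>x. h x \<partial>Q)"
  using integral_distr[of T Q Q h] assms by (simp add: distr_T)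

lemma integrable_T:
  fixes h :: "'a \<Rightarrow> real"
  assumes "integrable Q h"
  shows "integrable Q (\<lambda>x. h (T x))"
  using integrable_distr[of T Q Q h] assms by (simp add: distr_T)

lemma integrable_birkhoff: "integrable Q (birkhoff k)"
proof -
  have "integrable Q (\<lambda>x. f ((T ^^ j) x))" for j
  proof (induction j)
    case (Suc j)
    then show ?case using integrable_T by (simp only: funpow_Suc_right o_def)
  qed (simp add: integrable_f)
  then show ?thesis by (simp add: birkhoff_def[abs_def])
qed

text \<open>On an invariant set the maximal ergodic inequality makes the integral of
  \<open>f\<close> nonnegative. Over the set \<open>E\<close> of unbounded sums,
  \<open>decoupled\<close> turns this integral into the mean of \<open>f\<close> times
  \<open>prob E\<close>, so a negative mean leaves only \<open>prob E = 0\<close>.\<close>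

lemma AE_birkhoff_bounded_above:
  assumes neg: "(\<integral>x. f x \<partial>Q) < 0"
  shows "AE x in Q. \<exists>K. \<forall>k. birkhoff k x \<le> K"
proof -
  define E where "E = {x \<in> space Q. \<forall>K::nat. \<exists>k. birkhoff k x > real K}"
  have E [measurable]: "E \<in> sets Q"
    unfolding E_def by measurable
  have T_space: "T x \<in> space Q" if "x \<in> space Q" for x
    using measurable_space[OF measurable_T that] .
  have inv: "T x \<in> E \<longleftrightarrow> x \<in> E" if x: "x \<in> space Q" for x
  proof
    assume *: "T x \<in> E"
    have "\<exists>k. birkhoff k x > real K" for K
    proof -
      have ceil: "real (nat \<lceil>\<bar>f x\<bar>\<rceil>) \<ge> - f x" using real_nat_ceiling_ge[of "\<bar>f x\<bar>"] by linarith
      obtain k where "birkhoff k (T x) > real (K + nat \<lceil>\<bar>f x\<bar>\<rceil>)"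
        using * unfolding E_def by blast
      then have "birkhoff (Suc k) x > real K"
        unfolding birkhoff_Suc using ceil by simp
      then show ?thesis ..
    qed
    then show "x \<in> E" using x by (simp add: E_def)
  next
    assume *: "x \<in> E"
    have "\<exists>k. birkhoff k (T x) > real K" for K
    proof -
      have ceil: "real (nat \<lceil>\<bar>f x\<bar>\<rceil>) \<ge> f x" using real_nat_ceiling_ge[of "\<bar>f x\<bar>"] by linarith
      obtain k where k: "birkhoff k x > real (K + nat \<lceil>\<bar>f x\<bar>\<rceil>)"
        using * unfolding E_def by blast
      then have "birkhoff k x > 0" by linarith
      then have "k \<noteq> 0" by (auto simp: birkhoff_def intro!: Nat.gr0I)
      then obtain k' where "k = Suc k'" by (cases k) auto
      then have "birkhoff k' (T x) > real K"
        using k ceil by (simp add: birkhoff_Suc)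
      then show ?thesis ..
    qed
    then show "T x \<in> E" using T_space[OF x] by (simp add: E_def)
  qed
  \<comment> \<open>The index \<open>k = 0\<close> is included, hence \<open>M N \<ge> 0\<close>.
    Where \<open>M N x > 0\<close> the maximum is attained at some \<open>Suc k'\<close>, and
    \<open>birkhoff_Suc\<close> compares it with \<open>M N (T x)\<close>.\<close>
  define M where "M N x = Max ((\<lambda>k. birkhoff k x) ` {..N})" for N x
  have M_meas [measurable]: "M N \<in> borel_measurable Q" for N
    unfolding M_def[abs_def] by measurable
  have M_ge: "birkhoff k x \<le> M N x" if "k \<le> N" for k N x
    unfolding M_def using that by (intro Max_ge) auto
  have M_nonneg: "M N x \<ge> 0" for N x
    using M_ge[of 0 N x] by (simp add: birkhoff_def)
  have M_attained: "\<exists>k\<le>N. M N x = birkhoff k x" for N x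
  proof -
    have "M N x \<in> (\<lambda>k. birkhoff k x) ` {..N}"
      unfolding M_def by (intro Max_in) auto
    then show ?thesis by blast
  qed
  have M_int: "integrable Q (M N)" for N
  proof (rule Bochner_Integration.integrable_bound[where f="\<lambda>x. \<Sum>k\<le>N. \<bar>birkhoff k x\<bar>"])
    show "AE x in Q. norm (M N x) \<le> norm (\<Sum>k\<le>N. \<bar>birkhoff k x\<bar>)"
    proof (rule AE_I2)
      fix x
      obtain k where "k \<le> N" "M N x = birkhoff k x" using M_attained by blast
      then have "M N x \<le> (\<Sum>k\<le>N. \<bar>birkhoff k x\<bar>)"
        using member_le_sum[of k "{..N}" "\<lambda>k. \<bar>birkhoff k x\<bar>"] by auto
      then show "norm (M N x) \<le> norm (\<Sum>k\<le>N. \<bar>birkhoff k x\<bar>)" using M_nonneg[of N x] by auto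
    qed
  qed (auto intro!: integrable_birkhoff Bochner_Integration.integrable_sum integrable_abs)
  have max_ineq: "f x \<ge> M N x - M N (T x)" if "M N x > 0" for N x
  proof -
    obtain k where k: "k \<le> N" "M N x = birkhoff k x" using M_attained by blast
    with that have "k \<noteq> 0" by (auto simp: birkhoff_def intro!: Nat.gr0I)
    then obtain k' where k': "k = Suc k'" by (cases k) auto
    then show ?thesis using k M_ge[of k' N "T x"] by (simp add: birkhoff_Suc)
  qed
  have ge0: "(\<integral>x. f x * indicator (E \<inter> {x \<in> space Q. M N x > 0}) x \<partial>Q) \<ge> 0" for N
  proof -
    \<comment> \<open>Invariance of \<open>E\<close> and of \<open>Q\<close> makes the two integrals
      cancel. The difference is at most \<open>f x\<close> where \<open>M N x > 0\<close>, and at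
      most 0 elsewhere because there \<open>M N x = 0\<close>.\<close>
    have "(\<integral>x. M N x * indicator E x \<partial>Q) = (\<integral>x. M N (T x) * indicator E (T x) \<partial>Q)"
      by (rule integral_T[symmetric]) measurable
    also have "\<dots> = (\<integral>x. M N (T x) * indicator E x \<partial>Q)"
      by (intro Bochner_Integration.integral_cong) (auto simp: indicator_def inv)
    finally have "0 = (\<integral>x. M N x * indicator E x \<partial>Q) - (\<integral>x. M N (T x) * indicator E x \<partial>Q)" by simp
    also have "\<dots> = (\<integral>x. M N x * indicator E x - M N (T x) * indicator E x \<partial>Q)"
      by (intro Bochner_Integration.integral_diff[symmetric] integrable_real_mult_indicator
          M_int integrable_T E)
    also have "\<dots> \<le> (\<integral>x. f x * indicator (E \<inter> {x \<in> space Q. M N x > 0}) x \<partial>Q)"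
    proof (intro integral_mono Bochner_Integration.integrable_diff
        integrable_real_mult_indicator M_int integrable_T E integrable_f)
      fix x assume "x \<in> space Q"
      then show "M N x * indicator E x - M N (T x) * indicator E x
          \<le> f x * indicator (E \<inter> {x \<in> space Q. M N x > 0}) x"
        using max_ineq[of N x] M_nonneg[of N x] M_nonneg[of N "T x"]
        by (auto simp: indicator_def)
    qed measurable
    finally show ?thesis .
  qed
  \<comment> \<open>Every point of \<open>E\<close> has a positive sum, so the restriction
    \<open>M N x > 0\<close> disappears as \<open>N\<close> grows.\<close>
  have lim: "(\<lambda>N. \<integral>x. f x * indicator (E \<inter> {x \<in> space Q. M N x > 0}) x \<partial>Q)
      \<longlonglongrightarrow> (\<integral>x. f x * indicator E x \<partial>Q)"
  proof (rule integral_dominated_convergence[where w="\<lambda>x. \<bar>f x\<bar>"])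
    show "AE x in Q. (\<lambda>N. f x * indicator (E \<inter> {x \<in> space Q. M N x > 0}) x)
        \<longlonglongrightarrow> f x * indicator E x"
    proof (rule AE_I2)
      fix x assume x: "x \<in> space Q"
      have "eventually (\<lambda>N. f x * indicator (E \<inter> {x \<in> space Q. M N x > 0}) x = f x * indicator E x)
          sequentially"
      proof (cases "x \<in> E")
        case True
        then obtain k where "birkhoff k x > real 0" unfolding E_def by blast
        then have "M N x > 0" if "N \<ge> k" for N using M_ge[OF that, of x] by simp
        then show ?thesis using True x by (auto simp: eventually_sequentially indicator_def)
      qed (simp add: indicator_def)
      then show "(\<lambda>N. f x * indicator (E \<inter> {x \<in> space Q. M N x > 0}) x) \<longlonglongrightarrow> f x * indicator E x"
        by (rule tendsto_eventually)
    qed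
  qed (auto simp: indicator_def integrable_f intro!: integrable_abs)
  have "0 \<le> (\<integral>x. f x * indicator E x \<partial>Q)"
    using LIMSEQ_le_const[OF lim] ge0 by blast
  \<comment> \<open>By invariance \<open>E\<close> may be tested at \<open>T x\<close>, the form in
    which \<open>decoupled\<close> applies.\<close>
  also have "\<dots> = (\<integral>x. f x * indicator E (T x) \<partial>Q)"
    by (intro Bochner_Integration.integral_cong) (auto simp: indicator_def inv)
  also have "\<dots> = (\<integral>x. f x \<partial>Q) * prob E" by (rule decoupled[OF E])
  finally have "prob E = 0"
    using neg measure_nonneg[of Q E] by (smt (verit) mult_neg_pos)
  then have "AE x in Q. x \<notin> E"
    using E by (simp add: prob_eq_0)
  with AE_space show ?thesis
  proof eventually_elim
    case (elim x)
    then obtain K where "\<forall>k. \<not> birkhoff k x > real K" unfolding E_def by blast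
    then show ?case by (auto simp: not_less)
  qed
qed

text \<open>Both bounds come from one argument: for \<open>s = 1\<close> and \<open>s = -1\<close>,
  subtracting any \<open>c\<close> above the mean of \<open>s * f\<close> leaves a negative mean, so
  the corrected sums stay bounded above and \<open>s\<close> times the average cannot exceed
  \<open>c\<close> in the limit.\<close>

theorem AE_birkhoff_average_tendsto:
  "AE x in Q. (\<lambda>k. birkhoff k x / real k) \<longlonglongrightarrow> (\<integral>x. f x \<partial>Q)"
proof -
  have upper: "AE x in Q. \<exists>K. \<forall>k. s * birkhoff k x - real k * c \<le> K"
    if "s * (\<integral>x. f x \<partial>Q) < c" for s c
  proof -
    \<comment> \<open>\<open>s * f - c\<close> is again decoupled: the part with \<open>f\<close> by
      assumption, the constant because \<open>T\<close> preserves \<open>Q\<close>.\<close>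
    interpret D: decoupled_shift Q T "\<lambda>x. s * f x - c"
    proof
      fix E assume E: "E \<in> sets Q"
      then have ET: "{x \<in> space Q. T x \<in> E} \<in> sets Q" by measurable
      have "(\<integral>x. indicator E (T x) \<partial>Q) = (\<integral>x. indicator E x \<partial>Q :: real)"
        using E by (intro integral_T) auto
      then have ind: "(\<integral>x. indicator E (T x) \<partial>Q) = prob E"
        using E by simp
      have T_space: "T x \<in> space Q" if "x \<in> space Q" for x
        using measurable_space[OF measurable_T that] .
      have int: "integrable Q (\<lambda>x. indicator E (T x) :: real)"
        using E by (intro integrable_T) (simp add: emeasure_eq_measure)
      have int_f: "integrable Q (\<lambda>x. f x * indicator E (T x))"
        by (rule Bochner_Integration.integrable_bound[OF integrable_f])
           (use E in \<open>auto simp: indicator_def\<close>)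
      have "(\<integral>x. (s * f x - c) * indicator E (T x) \<partial>Q)
          = (\<integral>x. s * (f x * indicator E (T x)) - c * indicator E (T x) \<partial>Q)"
        by (intro Bochner_Integration.integral_cong) (auto simp: algebra_simps)
      also have "\<dots> = s * ((\<integral>x. f x \<partial>Q) * prob E) - c * prob E"
        using int int_f decoupled[OF E] ind by simp
      also have "\<dots> = (\<integral>x. s * f x - c \<partial>Q) * prob E"
        using integrable_f by (simp add: prob_space algebra_simps)
      finally show "(\<integral>x. (s * f x - c) * indicator E (T x) \<partial>Q) = (\<integral>x. s * f x - c \<partial>Q) * prob E" .
    qed (use integrable_f distr_T in auto)
    have "D.birkhoff k x = s * birkhoff k x - real k * c" for k x
      by (simp add: birkhoff_def D.birkhoff_def sum_subtractf sum_distrib_left)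
    moreover have "(\<integral>x. s * f x - c \<partial>Q) < 0"
      using that integrable_f by (simp add: prob_space)
    ultimately show ?thesis
      using D.AE_birkhoff_bounded_above by simp
  qed
  let ?m = "\<integral>x. f x \<partial>Q"
  have "AE x in Q. \<forall>i::nat. \<forall>s\<in>{-1, 1}. \<exists>K. \<forall>k. s * birkhoff k x - real k * (s * ?m + 1 / Suc i) \<le> K"
    unfolding AE_all_countable by (intro allI AE_ball_countable' upper) auto
  then show ?thesis
  proof eventually_elim
    case (elim x)
    have close: "\<forall>\<^sub>F k in sequentially. s * (birkhoff k x / real k - ?m) < e"
      if e: "e > 0" and s: "s \<in> {-1, 1}" for e s
    proof -
      obtain i where i: "1 / Suc i < e / 2" using nat_approx_posE[of "e / 2"] e half_gt_zero by blast
      obtain K where K: "s * birkhoff k x - real k * (s * ?m + 1 / Suc i) \<le> K" for k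
        using elim s by blast
      have alg: "s * (b / r - m) = (s * b - r * (s * m + d)) / r + d" if "r \<noteq> 0" for b r m d :: real
        using that by (simp add: field_simps)
      have "(\<lambda>k. K / real k) \<longlonglongrightarrow> 0" by (rule lim_const_over_n)
      then have "\<forall>\<^sub>F k in sequentially. K / real k < e / 2"
        using e by (intro order_tendstoD) auto
      then show ?thesis using eventually_gt_at_top[of 0]
      proof eventually_elim
        case (elim k)
        have "s * (birkhoff k x / real k - ?m) = (s * birkhoff k x - real k * (s * ?m + 1 / Suc i)) / real k + 1 / Suc i"
          using elim by (intro alg) simp
        also have "\<dots> \<le> K / real k + 1 / Suc i"
          using K[of k] elim by (intro add_right_mono divide_right_mono) auto
        also have "\<dots> < e" using elim i by linarith
        finally show ?case .
      qed
    qed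
    show ?case
    proof (rule tendstoI)
      fix e :: real assume e: "e > 0"
      show "\<forall>\<^sub>F k in sequentially. dist (birkhoff k x / real k) ?m < e"
        using close[of e 1, OF e insertI2[OF singletonI]] close[of e "-1", OF e insertI1]
        by eventually_elim (auto simp: dist_real_def)
    qed
  qed
qed

end

section \<open>Path space\<close>

definition cyl :: "nat \<Rightarrow> (nat \<Rightarrow> 'a) \<Rightarrow> (nat \<Rightarrow> 'a) set" where
  "cyl n a = {X. \<forall>k\<le>n. X k = a k}"

text \<open>Membership in the natural filtration at time \<open>n\<close>, stated purely in terms of
  sets. On a countable lattice measurability follows, see \<open>determined_sets\<close>.\<close>

definition determined :: "nat \<Rightarrow> (nat \<Rightarrow> 'a) set \<Rightarrow> bool" where
  "determined n G \<longleftrightarrow> (\<forall>X Y. (\<forall>k\<le>n. X k = Y k) \<longrightarrow> X \<in> G \<longrightarrow> Y \<in> G)"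

definition path_shift :: "nat \<Rightarrow> (nat \<Rightarrow> 'a::group_add) \<Rightarrow> nat \<Rightarrow> 'a" where
  "path_shift n X = (\<lambda>m. X (n + m) - X n)"

definition stay :: "'a set \<Rightarrow> (nat \<Rightarrow> 'a) set" where
  "stay C = {X. \<forall>m. X m \<in> C}"

lemma mem_cyl_self [simp]: "a \<in> cyl n a"
  by (simp add: cyl_def)

lemma determinedI: "(\<And>X Y. (\<And>k. k \<le> n \<Longrightarrow> X k = Y k) \<Longrightarrow> X \<in> G \<Longrightarrow> Y \<in> G) \<Longrightarrow> determined n G"
  unfolding determined_def by blast

lemma determined_iff:
  assumes "determined n G" "\<And>k. k \<le> n \<Longrightarrow> X k = Y k"
  shows "X \<in> G \<longleftrightarrow> Y \<in> G"
proof -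
  have "\<forall>k\<le>n. X k = Y k" "\<forall>k\<le>n. Y k = X k" using assms(2) by simp_all
  then show ?thesis using assms(1) unfolding determined_def by blast
qed

lemma determined_disjointed:
  assumes "\<And>k. determined k (R k)"
  shows "determined m (disjointed R m)"
proof (rule determinedI)
  fix X Y :: "nat \<Rightarrow> 'a" assume eq: "\<And>k. k \<le> m \<Longrightarrow> X k = Y k" and X: "X \<in> disjointed R m"
  have "X \<in> R k \<longleftrightarrow> Y \<in> R k" if "k \<le> m" for k
    using that eq by (intro determined_iff[OF assms]) simp
  then show "Y \<in> disjointed R m" using X by (auto simp: disjointed_def)
qed

lemma determined_mono: "determined n G \<Longrightarrow> n \<le> m \<Longrightarrow> determined m G"
  unfolding determined_def by (meson le_trans)

lemma determined_Int: "determined n G \<Longrightarrow> determined n H \<Longrightarrow> determined n (G \<inter> H)"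
  unfolding determined_def by blast

lemma determined_UNIV [simp]: "determined n UNIV"
  by (simp add: determined_def)

lemma determined_cyl: "determined n (cyl n a)"
  by (auto simp: determined_def cyl_def)

lemma determined_cyl_cases:
  assumes "determined n G"
  shows "G \<inter> cyl n a = (if a \<in> G then cyl n a else {})"
proof -
  have iff: "X \<in> G \<longleftrightarrow> a \<in> G" if "X \<in> cyl n a" for X
    using that by (intro determined_iff[OF assms]) (simp add: cyl_def)
  show ?thesis
  proof (cases "a \<in> G")
    case True
    then have "cyl n a \<subseteq> G" using iff by blast
    then show ?thesis using True by (simp add: inf_absorb2)
  next
    case False
    then have "G \<inter> cyl n a = {}" using iff by blast
    then show ?thesis using False by simp
  qed
qed

lemma space_path_space [simp]: "space (path_space :: (nat \<Rightarrow> int ^ 'd::finite) measure) = UNIV"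
  by (simp add: space_PiM)

lemma UNIV_path_space [simp]: "UNIV \<in> sets (path_space :: (nat \<Rightarrow> int ^ 'd::finite) measure)"
  using sets.top[of "path_space :: (nat \<Rightarrow> int ^ 'd) measure"] by simp

text \<open>Lists rather than functions name the prefixes, so that the cylinders of one length form
  a countably indexed partition; length \<open>Suc n\<close> corresponds to time
  \<open>n\<close>.\<close>

definition list_cyl :: "'a list \<Rightarrow> (nat \<Rightarrow> 'a) set" where
  "list_cyl l = cyl (length l - 1) (\<lambda>k. l ! k)"

lemma UN_list_cyl: "(\<Union>l\<in>{l. length l = Suc n}. list_cyl l) = UNIV"
proof safe
  fix X :: "nat \<Rightarrow> 'a"
  show "X \<in> (\<Union>l\<in>{l. length l = Suc n}. list_cyl l)"
    by (intro UN_I[of "map X [0..<Suc n]"]) (auto simp: list_cyl_def cyl_def simp del: upt_Suc)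
qed auto

lemma disjoint_list_cyl: "disjoint_family_on list_cyl {l. length l = Suc n}"
  unfolding disjoint_family_on_def list_cyl_def cyl_def
  by (auto simp: list_eq_iff_nth_eq less_Suc_eq_le)

lemma cyl_sets [measurable]: "cyl n a \<in> sets (path_space :: (nat \<Rightarrow> int ^ 'd::finite) measure)"
  unfolding sets_path_space cyl_def by (auto intro!: sigma_sets.Basic image_eqI[of _ _ "(n, a)"])

lemma determined_sets:
  fixes G :: "(nat \<Rightarrow> int ^ 'd::finite) set"
  assumes "determined n G"
  shows "G \<in> sets path_space"
proof -
  have "G = (\<Union>l\<in>{l. length l = Suc n}. G \<inter> list_cyl l)"
    using UN_list_cyl[of n, where ?'a = "int ^ 'd"] by blast
  also have "\<dots> \<in> sets path_space"
    using determined_cyl_cases[OF assms]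
    by (intro sets.countable_UN') (auto simp: list_cyl_def)
  finally show ?thesis .
qed

lemma measurable_determined:
  fixes f :: "(nat \<Rightarrow> int ^ 'd::finite) \<Rightarrow> 'b"
  assumes "\<And>X Y. (\<And>k. k \<le> n \<Longrightarrow> X k = Y k) \<Longrightarrow> f X = f Y"
  shows "f \<in> measurable path_space (count_space UNIV)"
proof (rule measurableI)
  fix A
  have "Y \<in> f -` A" if "\<And>k. k \<le> n \<Longrightarrow> X k = Y k" "X \<in> f -` A" for X Y
    using assms[OF that(1)] that(2) by simp
  then have "determined n (f -` A)"
    unfolding determined_def by blast
  then show "f -` A \<inter> space path_space \<in> sets path_space"
    by (simp add: determined_sets)
qed simp

lemma measurable_path_shift [measurable]:
  "path_shift n \<in> measurable path_space (path_space :: (nat \<Rightarrow> int ^ 'd::finite) measure)"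
proof (rule measurable_PiM_single')
  fix m
  show "(\<lambda>X. path_shift n X m) \<in> measurable path_space (count_space UNIV :: (int ^ 'd) measure)"
    by (rule measurable_determined[of "n + m"]) (simp add: path_shift_def)
qed simp

lemma stay_sets [measurable]: "stay C \<in> sets (path_space :: (nat \<Rightarrow> int ^ 'd::finite) measure)"
proof -
  have "stay C = (\<Inter>m. {X. X m \<in> C})" by (auto simp: stay_def)
  also have "\<dots> \<in> sets path_space"
  proof (intro sets.countable_INT')
    have "determined m {X. X m \<in> C}" for m by (simp add: determined_def)
    then show "range (\<lambda>m. {X :: nat \<Rightarrow> int ^ 'd. X m \<in> C}) \<subseteq> sets path_space"
      using determined_sets by auto
  qed auto
  finally show ?thesis .
qed

text \<open>The event is a countable disjoint union of cylinders with prefixes in \<open>G\<close>.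
  Asking for agreement only when \<open>a \<in> G\<close> lets properties of the event enter the
  computation on cylinders.\<close>

lemma emeasure_eq_determined:
  fixes M N :: "(nat \<Rightarrow> int ^ 'd::finite) measure"
  assumes [measurable_cong]: "sets M = sets path_space" "sets N = sets path_space"
    and G: "determined n G"
    and eq: "\<And>a. a \<in> G \<Longrightarrow> emeasure M (cyl n a) = emeasure N (cyl n a)"
  shows "emeasure M G = emeasure N G"
proof -
  have *: "emeasure K G = (\<integral>\<^sup>+ l. emeasure K (G \<inter> list_cyl l) \<partial>count_space {l. length l = Suc n})"
    if "sets K = sets path_space" for K :: "(nat \<Rightarrow> int ^ 'd::finite) measure"
  proof -
    have "G = (\<Union>l\<in>{l. length l = Suc n}. G \<inter> list_cyl l)"
      using UN_list_cyl[of n, where ?'a = "int ^ 'd"] by blast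
    moreover have "emeasure K (\<Union>l\<in>{l. length l = Suc n}. G \<inter> list_cyl l) =
        (\<integral>\<^sup>+ l. emeasure K (G \<inter> list_cyl l) \<partial>count_space {l. length l = Suc n})"
    proof (rule emeasure_UN_countable)
      show "disjoint_family_on (\<lambda>l. G \<inter> list_cyl l) {l. length l = Suc n}"
        using disjoint_list_cyl[of n] unfolding disjoint_family_on_def by blast
      show "G \<inter> list_cyl l \<in> sets K" for l
        using determined_sets[OF G] by (simp add: that list_cyl_def sets.Int)
    qed simp
    ultimately show ?thesis by simp
  qed
  show ?thesis
    unfolding *[OF assms(1)] *[OF assms(2)]
    by (intro nn_integral_cong) (auto simp: list_cyl_def determined_cyl_cases[OF G] eq)
qed

lemma path_measure_eqI:
  fixes M N :: "(nat \<Rightarrow> int ^ 'd::finite) measure"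
  assumes "finite_measure M"
    and sets: "sets M = sets path_space" "sets N = sets path_space"
    and eq: "\<And>n G. determined n G \<Longrightarrow> emeasure M G = emeasure N G"
  shows "M = N"
proof (rule measure_eqI_generator_eq)
  let ?E = "{G. \<exists>n. determined n (G :: (nat \<Rightarrow> int ^ 'd) set)}"
  show "Int_stable ?E"
  proof (rule Int_stableI)
    fix A B :: "(nat \<Rightarrow> int ^ 'd) set" assume "A \<in> ?E" "B \<in> ?E"
    then obtain n m where "determined n A" "determined m B" by auto
    then have "determined (max n m) (A \<inter> B)"
      by (intro determined_Int) (auto elim: determined_mono)
    then show "A \<inter> B \<in> ?E" by auto
  qed
  have gen: "sets (path_space :: (nat \<Rightarrow> int ^ 'd) measure) = sigma_sets UNIV ?E"
  proof (rule antisym)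
    show "sets path_space \<subseteq> sigma_sets UNIV ?E"
      unfolding sets_path_space
    proof (rule sigma_sets_mono', safe)
      fix n and a :: "nat \<Rightarrow> int ^ 'd"
      have "determined n {X. \<forall>k\<le>n. X k = a k}" using determined_cyl[of n a] by (simp add: cyl_def)
      then show "\<exists>n'. determined n' {X. \<forall>k\<le>n. X k = a k}" ..
    qed (simp add: determined_def)
    show "sigma_sets UNIV ?E \<subseteq> sets path_space"
      using sets.sigma_sets_subset[of ?E path_space] determined_sets by auto
  qed
  then show "sets M = sigma_sets UNIV ?E" "sets N = sigma_sets UNIV ?E"
    using sets by auto
  show "range (\<lambda>_. UNIV) \<subseteq> ?E" by auto
  interpret finite_measure M by fact
  show "emeasure M UNIV \<noteq> \<infinity>" for i :: nat by simp
  show "emeasure M X = emeasure N X" if "X \<in> ?E" for X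
  proof -
    obtain n where "determined n X" using \<open>X \<in> ?E\<close> by auto
    then show ?thesis by (rule eq)
  qed
qed auto

text \<open>Meant for measures that are known to agree only along paths inside \<open>C\<close>.
  Both are restricted to \<open>stay C\<close>, and the finite-time events \<open>R n\<close>
  decreasing to it carry the agreement over from cylinders.\<close>

lemma emeasure_stay_cong:
  fixes M N :: "(nat \<Rightarrow> int ^ 'd::finite) measure"
  assumes "finite_measure M" "finite_measure N"
    and sets: "sets M = sets path_space" "sets N = sets path_space"
    and eq: "\<And>n a. (\<And>k. k \<le> n \<Longrightarrow> a k \<in> C) \<Longrightarrow> emeasure M (cyl n a) = emeasure N (cyl n a)"
    and F: "F \<in> sets path_space"
  shows "emeasure M (F \<inter> stay C) = emeasure N (F \<inter> stay C)"
proof -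
  interpret M: finite_measure M by fact
  interpret N: finite_measure N by fact
  define R where "R n = {X :: nat \<Rightarrow> int ^ 'd. \<forall>k\<le>n. X k \<in> C}" for n
  have R: "determined n (R n)" for n by (auto simp: R_def determined_def)
  \<comment> \<open>Starting the index at \<open>m\<close> keeps the intersection with an event
    known at time \<open>m\<close> an event known at time \<open>m + n\<close>.\<close>
  have stay_R: "stay C = (\<Inter>n. R (m + n))" for m
  proof
    show "(\<Inter>n. R (m + n)) \<subseteq> stay C"
      unfolding stay_def R_def using le_add2 by blast
  qed (auto simp: stay_def R_def)
  have dec: "decseq (\<lambda>n. G \<inter> R (m + n))" for G m
    unfolding decseq_def R_def by auto
  have "density M (indicator (stay C)) = density N (indicator (stay C))"
  proof (rule path_measure_eqI)
    fix m and G :: "(nat \<Rightarrow> int ^ 'd) set" assume G: "determined m G"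
    have GR: "determined (m + n) (G \<inter> R (m + n))" for n
      using G R by (intro determined_Int) (auto elim: determined_mono)
    have lim: "(\<lambda>n. emeasure K (G \<inter> R (m + n))) \<longlonglongrightarrow> emeasure K (G \<inter> stay C)"
      if "finite_measure K" "sets K = sets path_space" for K
    proof -
      interpret finite_measure K by fact
      have "G \<inter> stay C = (\<Inter>n. G \<inter> R (m + n))" unfolding stay_R[of m] by auto
      then show ?thesis
        using Lim_emeasure_decseq[of "\<lambda>n. G \<inter> R (m + n)" K] dec[of G m] determined_sets[OF GR] that(2)
        by (auto simp: image_subset_iff)
    qed
    have "emeasure M (G \<inter> R (m + n)) = emeasure N (G \<inter> R (m + n))" for n
      by (rule emeasure_eq_determined[OF sets GR], rule eq) (auto simp: R_def)
    then have "emeasure M (G \<inter> stay C) = emeasure N (G \<inter> stay C)"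
      using lim[of M] lim[of N] sets \<open>finite_measure M\<close> \<open>finite_measure N\<close>
      by (auto intro: LIMSEQ_unique)
    then show "emeasure (density M (indicator (stay C))) G = emeasure (density N (indicator (stay C))) G"
      using determined_sets[OF G] by (simp add: emeasure_restricted sets Int_commute)
  qed (auto simp: sets intro!: M.finite_measure_restricted)
  then have "emeasure (density M (indicator (stay C))) F = emeasure (density N (indicator (stay C))) F"
    by simp
  then show ?thesis
    using F by (simp add: emeasure_restricted sets Int_commute)
qed

text \<open>Each trial, started at a time \<open>n\<close> with \<open>X \<in> B n\<close>, gives rise to a new trial with conditional
  probability at most \<open>\<rho> < 1\<close>; on \<open>H\<close> there are infinitely many trials.\<close>

lemma geometric_trials:
  fixes P :: "(nat \<Rightarrow> int ^ 'd::finite) measure"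
  assumes "finite_measure P" and sets: "sets P = sets path_space" and H: "H \<in> sets path_space"
    and K: "\<And>n m. determined m (K n m)" "\<And>n. disjoint_family (K n)"
      "\<And>n m. K n m \<subseteq> B m" "\<And>n m. m < n \<Longrightarrow> K n m = {}"
    and B: "\<And>n. determined n (B n)"
    and retry: "\<And>n. AE X in P. X \<in> H \<longrightarrow> X \<in> B n \<longrightarrow> X \<in> (\<Union>m. K n m)"
    and ratio: "\<And>n G. determined n G \<Longrightarrow> G \<subseteq> B n \<Longrightarrow>
      emeasure P (G \<inter> (\<Union>m. K n m)) \<le> ennreal \<rho> * emeasure P G"
    and \<rho>: "0 \<le> \<rho>" "\<rho> < 1"
  shows "emeasure P (H \<inter> B n) = 0"
proof -
  interpret finite_measure P by fact
  have det_P: "G \<in> sets P" if "determined n G" for n G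
    using determined_sets[OF that] by (simp add: sets)
  have H_P: "H \<in> sets P" using H by (simp add: sets)
  have K_sets: "K n m \<in> sets P" for n m using det_P[OF K(1)] .
  \<comment> \<open>The bound is proved for all times and all events known there, because after a
    retry the accumulated history \<open>G \<inter> K n m\<close> takes the place of
    \<open>G\<close> at time \<open>m\<close>.\<close>
  have iter: "emeasure P (H \<inter> G) \<le> ennreal (\<rho> ^ k) * emeasure P G"
    if "determined n G" "G \<subseteq> B n" for k n G
    using that
  proof (induction k arbitrary: n G)
    case 0
    then show ?case using det_P by (auto intro!: emeasure_mono)
  next
    case (Suc k)
    have G: "G \<in> sets P" using det_P[OF Suc.prems(1)] .
    have "emeasure P (H \<inter> G) \<le> emeasure P (\<Union>m. H \<inter> G \<inter> K n m)"
    proof (rule emeasure_mono_AE)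
      show "AE X in P. X \<in> H \<inter> G \<longrightarrow> X \<in> (\<Union>m. H \<inter> G \<inter> K n m)"
        using retry[of n] by eventually_elim (use Suc.prems in auto)
    qed (use H_P K_sets G in auto)
    also have "\<dots> = (\<Sum>m. emeasure P (H \<inter> G \<inter> K n m))"
      using K(2)[of n] H_P K_sets G
      by (intro suminf_emeasure[symmetric]) (auto simp: disjoint_family_on_def)
    also have "\<dots> \<le> (\<Sum>m. ennreal (\<rho> ^ k) * emeasure P (G \<inter> K n m))"
    proof (intro suminf_le allI)
      fix m
      show "emeasure P (H \<inter> G \<inter> K n m) \<le> ennreal (\<rho> ^ k) * emeasure P (G \<inter> K n m)"
      proof (cases "m < n")
        case False
        then have "determined m (G \<inter> K n m)"
          using Suc.prems(1) K(1) by (intro determined_Int) (auto elim: determined_mono)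
        then show ?thesis using Suc.IH[of m "G \<inter> K n m"] K(3)[of n m] by (auto simp: Int_assoc)
      qed (simp add: K(4))
    qed auto
    also have "\<dots> = ennreal (\<rho> ^ k) * (\<Sum>m. emeasure P (G \<inter> K n m))" by simp
    also have "(\<Sum>m. emeasure P (G \<inter> K n m)) = emeasure P (\<Union>m. G \<inter> K n m)"
      using K(2)[of n] K_sets G
      by (intro suminf_emeasure) (auto simp: disjoint_family_on_def)
    also have "(\<Union>m. G \<inter> K n m) = G \<inter> (\<Union>m. K n m)" by auto
    also have "ennreal (\<rho> ^ k) * emeasure P (G \<inter> (\<Union>m. K n m)) \<le> ennreal (\<rho> ^ k) * (ennreal \<rho> * emeasure P G)"
      by (intro mult_left_mono ratio Suc.prems) simp
    also have "\<dots> = ennreal (\<rho> ^ Suc k) * emeasure P G"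
      using \<rho>(1) by (simp add: ennreal_mult ac_simps)
    finally show ?case .
  qed
  have "measure P (H \<inter> B n) \<le> \<rho> ^ k * measure P (B n)" for k
    using iter[OF B[of n], of k] \<rho>(1)
    by (simp add: emeasure_eq_measure ennreal_mult[symmetric])
  moreover have "(\<lambda>k. \<rho> ^ k * measure P (B n)) \<longlonglongrightarrow> 0"
    using \<rho> by (intro tendsto_mult_left_zero LIMSEQ_power_zero) auto
  ultimately have "measure P (H \<inter> B n) \<le> 0"
    by (intro LIMSEQ_le_const[where X="\<lambda>k. \<rho> ^ k * measure P (B n)"]) auto
  then show ?thesis by (simp add: emeasure_eq_measure measure_le_0_iff)
qed

section \<open>The annealed law of the path\<close>

definition translate :: "int ^ 'd \<Rightarrow> 'd env \<Rightarrow> 'd env" where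
  "translate x \<omega> = (\<lambda>z. \<omega> (x + z))"

definition path_weight :: "'d::finite env \<Rightarrow> nat \<Rightarrow> (nat \<Rightarrow> int ^ 'd) \<Rightarrow> real" where
  "path_weight \<omega> n a = (\<Prod>k<n. step_prob \<omega> (a k) (a (Suc k)))"

definition glue :: "nat \<Rightarrow> (nat \<Rightarrow> 'a::plus) \<Rightarrow> (nat \<Rightarrow> 'a) \<Rightarrow> nat \<Rightarrow> 'a" where
  "glue n a b k = (if k \<le> n then a k else a n + b (k - n))"

lemma glue_simps [simp]: "k \<le> n \<Longrightarrow> glue n a b k = a k"
  by (simp add: glue_def)

lemma glue_add: "b 0 = 0 \<Longrightarrow> glue n a b (n + k) = a n + (b k :: 'a::monoid_add)"
  by (simp add: glue_def)

text \<open>A shifted path always starts at 0, whence the empty case; otherwise prefix and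
  continuation merge into one cylinder.\<close>

lemma cyl_Int_path_shift:
  fixes b :: "nat \<Rightarrow> int ^ 'd::finite"
  shows "cyl n a \<inter> path_shift n -` cyl m b = (if b 0 = 0 then cyl (n + m) (glue n a b) else {})"
proof (cases "b 0 = 0")
  case True
  have "X \<in> cyl n a \<inter> path_shift n -` cyl m b" if X: "X \<in> cyl (n + m) (glue n a b)" for X
  proof -
    have "X k = a k" if "k \<le> n" for k using X that by (simp add: cyl_def)
    moreover have "X (n + k) = a n + b k" if "k \<le> m" for k
      using X that glue_add[of b n a k] True by (simp add: cyl_def)
    ultimately show ?thesis by (simp add: cyl_def path_shift_def)
  qed
  moreover have "X \<in> cyl (n + m) (glue n a b)" if X: "X \<in> cyl n a \<inter> path_shift n -` cyl m b" for X
  proof -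
    have "X k = glue n a b k" if "k \<le> n + m" for k
    proof (cases "k \<le> n")
      case True
      then show ?thesis using X by (simp add: cyl_def)
    next
      case False
      then have "path_shift n X (k - n) = b (k - n)" "X n = a n" using X that by (auto simp: cyl_def)
      then show ?thesis using False by (simp add: path_shift_def glue_def algebra_simps)
    qed
    then show ?thesis by (simp add: cyl_def)
  qed
  ultimately show ?thesis using True by auto
next
  case False
  then have "path_shift n X 0 \<noteq> b 0" for X by (simp add: path_shift_def)
  then have "cyl n a \<inter> path_shift n -` cyl m b = {}" by (auto simp: cyl_def)
  then show ?thesis using False by simp
qed

lemma step_prob_translate: "step_prob (translate x \<omega>) z y = step_prob \<omega> (x + z) (x + y)"
  by (simp add: step_prob_def translate_def)

lemma path_weight_glue:
  fixes b :: "nat \<Rightarrow> int ^ 'd::finite"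
  assumes "b 0 = 0"
  shows "path_weight \<omega> (n + m) (glue n a b) = path_weight \<omega> n a * path_weight (translate (a n) \<omega>) m b"
proof -
  have "path_weight \<omega> (n + m) (glue n a b) = (\<Prod>k<n. step_prob \<omega> (glue n a b k) (glue n a b (Suc k))) *
      (\<Prod>k\<in>{n..<n + m}. step_prob \<omega> (glue n a b k) (glue n a b (Suc k)))"
    unfolding path_weight_def lessThan_atLeast0
    by (rule prod.atLeastLessThan_concat[symmetric]) auto
  also have "(\<Prod>k\<in>{n..<n + m}. step_prob \<omega> (glue n a b k) (glue n a b (Suc k))) =
      (\<Prod>j<m. step_prob \<omega> (glue n a b (n + j)) (glue n a b (n + Suc j)))"
    using prod.shift_bounds_nat_ivl[of "\<lambda>k. step_prob \<omega> (glue n a b k) (glue n a b (Suc k))" 0 n m]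
    by (simp add: lessThan_atLeast0 add.commute)
  finally show ?thesis
    using assms by (simp only: glue_add) (simp add: path_weight_def step_prob_translate)
qed

lemma step_prob_bounds:
  assumes "\<omega> z \<in> prob_vectors"
  shows "0 \<le> step_prob \<omega> z y" "step_prob \<omega> z y \<le> 1"
  using assms by (auto simp: step_prob_def prob_vectors_def)

lemma path_weight_bounds:
  assumes "\<And>z. \<omega> z \<in> prob_vectors"
  shows "0 \<le> path_weight \<omega> n a" "path_weight \<omega> n a \<le> 1"
  using step_prob_bounds[OF assms] unfolding path_weight_def
  by (auto intro: prod_nonneg prod_le_1)

lemma emeasure_quenched_cyl:
  assumes "\<And>z. \<omega> z \<in> prob_vectors"
  shows "emeasure (quenched x \<omega>) (cyl n a) = (if a 0 = x then ennreal (path_weight \<omega> n a) else 0)"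
  using quenched_cylinder[OF assms, where a=a and n=n] step_prob_bounds[OF assms]
  by (simp add: cyl_def path_weight_def prod_ennreal)

text \<open>As functions of \<open>F\<close> both sides are finite measures, so cylinders suffice,
  and there the claim is multiplicativity of \<open>path_weight\<close> under \<open>glue\<close>.
  Scaling instead of conditioning covers prefixes of probability zero.\<close>

lemma quenched_markov_shift:
  fixes \<omega> :: "'d::finite env"
  assumes env: "\<And>z. \<omega> z \<in> prob_vectors" and F: "F \<in> sets (path_space :: (nat \<Rightarrow> int ^ 'd) measure)"
  shows "emeasure (quenched 0 \<omega>) (cyl n a \<inter> path_shift n -` F) =
    emeasure (quenched 0 \<omega>) (cyl n a) * emeasure (quenched 0 (translate (a n) \<omega>)) F"
proof -
  let ?Q = "quenched 0 \<omega>" and ?T = "translate (a n) \<omega>"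
  have envT: "\<And>z. ?T z \<in> prob_vectors" using env by (simp add: translate_def)
  interpret Q: prob_space ?Q by (rule prob_space_quenched[OF env])
  interpret T: prob_space "quenched 0 ?T" by (rule prob_space_quenched[OF envT])
  note sets_Q [measurable_cong, simp] = sets_quenched[OF env, of 0] sets_quenched[OF envT, of 0]
  define M1 where "M1 = distr (density ?Q (indicator (cyl n a))) path_space (path_shift n)"
  have M1: "emeasure M1 A = emeasure ?Q (cyl n a \<inter> path_shift n -` A)"
    if "A \<in> sets path_space" for A :: "(nat \<Rightarrow> int ^ 'd) set"
  proof -
    have "path_shift n -` A \<in> sets path_space"
      using measurable_sets[OF measurable_path_shift that] by simp
    then show ?thesis using that sets_eq_imp_space_eq[OF sets_Q(1)] unfolding M1_def
      by (subst emeasure_distr) (auto simp: emeasure_restricted)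
  qed
  have "M1 = scale_measure (emeasure ?Q (cyl n a)) (quenched 0 ?T)"
  proof (rule path_measure_eqI)
    have "space M1 = UNIV" by (simp add: M1_def)
    then show "finite_measure M1"
      by (intro finite_measureI) (simp add: M1)
    fix m and G :: "(nat \<Rightarrow> int ^ 'd) set" assume "determined m G"
    then show "emeasure M1 G = emeasure (scale_measure (emeasure ?Q (cyl n a)) (quenched 0 ?T)) G"
    proof (rule emeasure_eq_determined[rotated 2])
      fix b :: "nat \<Rightarrow> int ^ 'd"
      show "emeasure M1 (cyl m b) = emeasure (scale_measure (emeasure ?Q (cyl n a)) (quenched 0 ?T)) (cyl m b)"
        using path_weight_bounds[OF env] path_weight_bounds[OF envT]
        by (simp add: M1 cyl_Int_path_shift emeasure_quenched_cyl[OF env] emeasure_quenched_cyl[OF envT]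
            path_weight_glue ennreal_mult)
    qed (auto simp: M1_def)
  qed (auto simp: M1_def)
  then show ?thesis using M1[OF F] by simp
qed

text \<open>Fixing the site \<open>z\<close> makes the transition factor constant over the event, so
  the one-step formula passes from cylinders to all events known at time \<open>n\<close>.\<close>

lemma emeasure_quenched_step:
  fixes \<omega> :: "'d::finite env"
  assumes env: "\<And>z. \<omega> z \<in> prob_vectors" and G: "determined n G" "G \<subseteq> {X :: nat \<Rightarrow> int ^ 'd. X n = z}"
    and e: "(e :: int ^ 'd) \<in> unit_steps"
  shows "emeasure (quenched x \<omega>) (G \<inter> {X. X (Suc n) = z + e}) = emeasure (quenched x \<omega>) G * ennreal (\<omega> z e)"
proof -
  let ?Q = "quenched x \<omega>" and ?A = "{X. X (Suc n) = z + e}"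
  note sets_Q [measurable_cong, simp] = sets_quenched[OF env, of x]
  have "determined (Suc n) ?A" by (simp add: determined_def)
  note A = determined_sets[OF this]
  have "emeasure (density ?Q (indicator ?A)) G = emeasure (scale_measure (ennreal (\<omega> z e)) ?Q) G"
  proof (rule emeasure_eq_determined[OF _ _ G(1)])
    fix a assume "a \<in> G"
    then have "z = a n" using G(2) by auto
    then have "?A \<inter> cyl n a = {X. (\<forall>k\<le>n. X k = a k) \<and> X (Suc n) = a n + e}"
      by (auto simp: cyl_def)
    then have "emeasure ?Q (?A \<inter> cyl n a) = emeasure ?Q (cyl n a) * ennreal (\<omega> z e)"
      using quenched_markov[where \<omega>=\<omega> and x=x and n=n and a=a, OF env e] \<open>z = a n\<close>
      by (simp add: cyl_def)
    then show "emeasure (density ?Q (indicator ?A)) (cyl n a) = emeasure (scale_measure (ennreal (\<omega> z e)) ?Q) (cyl n a)"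
      using A by (simp add: emeasure_restricted mult.commute)
  qed auto
  then show ?thesis using A determined_sets[OF G(1)]
    by (simp add: emeasure_restricted Int_commute mult.commute)
qed

section \<open>Annealed path law and independence over disjoint sites\<close>

locale random_environment =
  fixes \<mu> :: "(int ^ 'd::finite \<Rightarrow> real) measure"
  assumes prob_space_law: "prob_space \<mu>" and sets_law: "sets \<mu> = sets prob_vector_space"
begin

sublocale env: prob_space "env_law \<mu>"
  unfolding env_law_def by (intro prob_space_PiM prob_space_law)

definition path_law :: "(nat \<Rightarrow> int ^ 'd) measure" where
  "path_law = distr (annealed \<mu> 0) path_space snd"

lemma env_prob_vectors: "\<omega> \<in> space (env_law \<mu>) \<Longrightarrow> \<omega> z \<in> prob_vectors"
  by (simp add: space_env_law[OF sets_law])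

lemma sets_annealed [measurable_cong]: "sets (annealed \<mu> x) = sets (env_law \<mu> \<Otimes>\<^sub>M path_space)"
  using emeasure_annealed(2)[OF prob_space_law sets_law, of "{}" x] by (simp add: space_prob_algebra)

lemma prob_space_annealed: "prob_space (annealed \<mu> x)"
  using emeasure_annealed(2)[OF prob_space_law sets_law, of "{}" x] by (simp add: space_prob_algebra)

lemma space_annealed: "space (annealed \<mu> x) = space (env_law \<mu>) \<times> UNIV"
  using sets_eq_imp_space_eq[OF sets_annealed] by (simp add: space_pair_measure)

lemma sets_path_law [measurable_cong, simp]: "sets path_law = sets path_space"
  by (simp add: path_law_def)

lemma space_path_law [simp]: "space path_law = UNIV"
  by (simp add: path_law_def)

sublocale path: prob_space path_law
proof -
  interpret prob_space "annealed \<mu> 0" by (rule prob_space_annealed)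
  show "prob_space path_law"
    unfolding path_law_def by (rule prob_space_distr) measurable
qed

lemma emeasure_path_law:
  assumes F: "F \<in> sets path_space"
  shows "emeasure path_law F = (\<integral>\<^sup>+ \<omega>. emeasure (quenched 0 \<omega>) F \<partial>env_law \<mu>)"
proof -
  have S: "space (env_law \<mu>) \<times> F \<in> sets (env_law \<mu> \<Otimes>\<^sub>M path_space)" using F by auto
  have "emeasure path_law F = emeasure (annealed \<mu> 0) (space (env_law \<mu>) \<times> F)"
    unfolding path_law_def using F
    by (subst emeasure_distr) (auto simp: space_annealed intro!: arg_cong2[where f=emeasure])
  also have "\<dots> = (\<integral>\<^sup>+ \<omega>. emeasure (quenched 0 \<omega>) F \<partial>env_law \<mu>)"
    unfolding emeasure_annealed(1)[OF prob_space_law sets_law S]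
    by (intro nn_integral_cong) simp
  finally show ?thesis .
qed

lemma measurable_emeasure_quenched [measurable]:
  assumes "F \<in> sets path_space"
  shows "(\<lambda>\<omega>. emeasure (quenched x \<omega>) F) \<in> borel_measurable (env_law \<mu>)"
  using measurable_emeasure_kernel[OF measurable_prob_algebraD[OF measurable_quenched[OF sets_law, of x]] assms] .

lemma AE_path_law_iff:
  assumes "Measurable.pred path_space P"
  shows "(AE X in path_law. P X) \<longleftrightarrow> (AE (\<omega>, X) in annealed \<mu> 0. P X)"
  unfolding path_law_def using assms
  by (subst AE_distr_iff) (auto simp: pred_def split_beta)

lemma AE_path_law_quenched:
  assumes P: "Measurable.pred path_space P"
    and ae: "AE \<omega> in env_law \<mu>. AE X in quenched 0 \<omega>. P X"
  shows "AE X in path_law. P X"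
proof -
  have N: "{X. \<not> P X} \<in> sets path_space" 
    using pred_intros_logic(2)[OF P] by (simp add: pred_def)
  have "AE \<omega> in env_law \<mu>. emeasure (quenched 0 \<omega>) {X. \<not> P X} = 0"
    using ae AE_space
  proof eventually_elim
    case (elim \<omega>)
    then show ?case
      using sets_quenched[OF env_prob_vectors[OF elim(2)], of 0] N
        sets_eq_imp_space_eq[OF sets_quenched[OF env_prob_vectors[OF elim(2)], of 0]]
      by (simp add: AE_iff_measurable[of "{X. \<not> P X}"])
  qed
  then have "emeasure path_law {X. \<not> P X} = 0"
    by (simp add: emeasure_path_law[OF N] nn_integral_0_iff_AE N measurable_emeasure_quenched)
  then show ?thesis using N by (subst AE_iff_measurable[of "{X. \<not> P X}"]) auto
qed

lemma measurable_step_prob: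
  "z \<in> I \<Longrightarrow> (\<lambda>\<omega>. step_prob \<omega> z y) \<in> borel_measurable (Pi\<^sub>M I (\<lambda>_. \<mu>))"
proof -
  assume z: "z \<in> I"
  have "(\<lambda>\<omega>. \<omega> z e) \<in> borel_measurable (Pi\<^sub>M I (\<lambda>_. \<mu>))" if "e \<in> unit_steps" for e
  proof -
    have "(\<lambda>p. p e) \<in> borel_measurable \<mu>"
      unfolding measurable_cong_sets[OF sets_law refl] prob_vector_space_def
      using that by (intro measurable_restrict_space1) simp
    then show ?thesis
      by (rule measurable_compose[OF measurable_component_singleton[OF z]])
  qed
  then show ?thesis by (cases "y - z \<in> unit_steps") (auto simp: step_prob_def)
qed

lemma measurable_path_weight:
  "(\<And>k. k < n \<Longrightarrow> a k \<in> I) \<Longrightarrow> (\<lambda>\<omega>. path_weight \<omega> n a) \<in> borel_measurable (Pi\<^sub>M I (\<lambda>_. \<mu>))"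
  unfolding path_weight_def by (intro borel_measurable_prod measurable_step_prob) auto

lemma measurable_path_weight_env [measurable]:
  "(\<lambda>\<omega>. path_weight \<omega> n a) \<in> borel_measurable (env_law \<mu>)"
  unfolding env_law_def by (rule measurable_path_weight) simp

lemma distr_translate: "distr (env_law \<mu>) (env_law \<mu>) (translate x) = env_law \<mu>"
  using distr_PiM_reindex[of UNIV "\<lambda>_. \<mu>" "\<lambda>z. x + z" UNIV] prob_space_law
  by (simp add: env_law_def translate_def[abs_def] restrict_UNIV)

lemma path_weight_env_bounds:
  assumes "\<omega> \<in> space (env_law \<mu>)"
  shows "0 \<le> path_weight \<omega> n a" "path_weight \<omega> n a \<le> 1"
  using path_weight_bounds[OF env_prob_vectors[OF assms]] .

lemma measurable_translate [measurable]: "translate x \<in> measurable (env_law \<mu>) (env_law \<mu>)"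
  unfolding env_law_def translate_def[abs_def]
  by (rule measurable_PiM_single') (auto simp: space_PiM intro: measurable_component_singleton)

lemma path_weight_translate: "path_weight (translate x \<omega>) m b = path_weight \<omega> m (\<lambda>k. x + b k)"
  by (simp add: path_weight_def step_prob_translate)

lemma integrable_path_weight: "integrable (env_law \<mu>) (\<lambda>\<omega>. path_weight \<omega> n a)"
proof (rule env.integrable_const_bound[where B=1])
  show "AE \<omega> in env_law \<mu>. norm (path_weight \<omega> n a) \<le> 1"
    using path_weight_env_bounds by (intro AE_I2) simp
qed simp

lemma indep_vars_sites: "env.indep_vars (\<lambda>_. \<mu>) (\<lambda>z \<omega>. \<omega> z) UNIV"
proof (subst env.indep_vars_iff_distr_eq_PiM)
  have "distr (env_law \<mu>) \<mu> (\<lambda>\<omega>. \<omega> z) = \<mu>" for z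
    unfolding env_law_def by (rule distr_PiM_component) (auto simp: prob_space_law)
  then show "distr (env_law \<mu>) (Pi\<^sub>M UNIV (\<lambda>_. \<mu>)) (\<lambda>\<omega>. \<lambda>z\<in>UNIV. \<omega> z) =
      Pi\<^sub>M UNIV (\<lambda>z. distr (env_law \<mu>) \<mu> (\<lambda>\<omega>. \<omega> z))"
    by (simp add: env_law_def distr_id restrict_UNIV)
qed (auto simp: env_law_def)

text \<open>A path weight reads the environment only at the sites from which a step departs, so the
  endpoints \<open>a n\<close> and \<open>b m\<close> do not enter \<open>disj\<close>. Disjoint
  sets of sites give independent factors, and translation invariance of the environment removes the
  shift by \<open>x\<close>.\<close>

lemma integral_path_weight_mult:
  assumes disj: "\<And>k j. k < n \<Longrightarrow> j < m \<Longrightarrow> a k \<noteq> x + b j"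
  shows "(\<integral>\<omega>. path_weight \<omega> n a * path_weight (translate x \<omega>) m b \<partial>env_law \<mu>) =
    (\<integral>\<omega>. path_weight \<omega> n a \<partial>env_law \<mu>) * (\<integral>\<omega>. path_weight \<omega> m b \<partial>env_law \<mu>)"
proof -
  define A where "A = a ` {..<n}"
  have restr: "path_weight (restrict \<omega> I) n a = path_weight \<omega> n a"
    if "\<And>k. k < n \<Longrightarrow> a k \<in> I" for \<omega> I n a
    using that unfolding path_weight_def by (intro prod.cong) (auto simp: step_prob_def)
  have A: "a k \<in> A" if "k < n" for k using that by (auto simp: A_def)
  have B: "x + b k \<in> - A" if "k < m" for k using disj[OF _ that] by (force simp: A_def)
  have "env.indep_var borel ((\<lambda>\<omega>. path_weight \<omega> n a) \<circ> (\<lambda>\<omega>. restrict (\<lambda>z. \<omega> z) A))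
      borel ((\<lambda>\<omega>. path_weight \<omega> m (\<lambda>k. x + b k)) \<circ> (\<lambda>\<omega>. restrict (\<lambda>z. \<omega> z) (- A)))"
    by (rule env.indep_var_compose[OF env.indep_var_restrict[OF indep_vars_sites]])
      (auto intro!: measurable_path_weight A B)
  then have "env.indep_var borel (\<lambda>\<omega>. path_weight \<omega> n a) borel (\<lambda>\<omega>. path_weight (translate x \<omega>) m b)"
    using restr[of n a A, OF A] restr[of m "\<lambda>k. x + b k" "- A", OF B]
    by (simp add: comp_def path_weight_translate)
  then have "(\<integral>\<omega>. path_weight \<omega> n a * path_weight (translate x \<omega>) m b \<partial>env_law \<mu>) =
    (\<integral>\<omega>. path_weight \<omega> n a \<partial>env_law \<mu>) * (\<integral>\<omega>. path_weight (translate x \<omega>) m b \<partial>env_law \<mu>)"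
    by (rule env.indep_var_lebesgue_integral)
      (auto simp: integrable_path_weight path_weight_translate)
  also have "(\<integral>\<omega>. path_weight (translate x \<omega>) m b \<partial>env_law \<mu>) = (\<integral>\<omega>. path_weight \<omega> m b \<partial>env_law \<mu>)"
    using integral_distr[of "translate x" "env_law \<mu>" "env_law \<mu>" "\<lambda>\<omega>. path_weight \<omega> m b"]
    by (simp add: distr_translate)
  finally show ?thesis .
qed

lemma emeasure_path_law_cyl:
  "emeasure path_law (cyl n a) = (if a 0 = 0 then ennreal (\<integral>\<omega>. path_weight \<omega> n a \<partial>env_law \<mu>) else 0)"
proof -
  have "emeasure path_law (cyl n a) = (\<integral>\<^sup>+ \<omega>. (if a 0 = 0 then ennreal (path_weight \<omega> n a) else 0) \<partial>env_law \<mu>)"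
    unfolding emeasure_path_law[OF cyl_sets]
    by (intro nn_integral_cong emeasure_quenched_cyl env_prob_vectors)
  also have "\<dots> = (if a 0 = 0 then ennreal (\<integral>\<omega>. path_weight \<omega> n a \<partial>env_law \<mu>) else 0)"
    by (auto intro!: nn_integral_eq_integral integrable_path_weight path_weight_env_bounds)
  finally show ?thesis .
qed

text \<open>A continuation inside the cone departs only from sites in \<open>X n + C\<close>, and by
  \<open>avoid\<close> none of them was left before time \<open>n\<close>. The strict
  \<open>k < n\<close> assigns the environment at \<open>X n\<close> itself to the future.\<close>

lemma emeasure_path_law_shift_stay:
  assumes G: "determined n G" and avoid: "\<And>X k. X \<in> G \<Longrightarrow> k < n \<Longrightarrow> X k - X n \<notin> C"
    and F: "F \<in> sets path_space"
  shows "emeasure path_law (G \<inter> path_shift n -` (F \<inter> stay C)) =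
    emeasure path_law G * emeasure path_law (F \<inter> stay C)"
proof -
  have FS: "F \<inter> stay C \<in> sets path_space" using F by simp
  have shift_sets: "path_shift n -` A \<in> sets path_space" if "A \<in> sets path_space" for A :: "(nat \<Rightarrow> int ^ 'd) set"
    using measurable_sets[OF measurable_path_shift that] by simp
  have cyl: "emeasure path_law (cyl n a \<inter> path_shift n -` (F \<inter> stay C)) =
      emeasure path_law (cyl n a) * emeasure path_law (F \<inter> stay C)" if "a \<in> G" for a
  proof -
    define M1 where "M1 = distr (density path_law (indicator (cyl n a))) path_space (path_shift n)"
    have M1: "emeasure M1 A = emeasure path_law (cyl n a \<inter> path_shift n -` A)" if "A \<in> sets path_space" for A
      using that shift_sets[OF that] unfolding M1_def
      by (subst emeasure_distr) (auto simp: emeasure_restricted)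
    let ?M2 = "scale_measure (emeasure path_law (cyl n a)) path_law"
    \<comment> \<open>The law of the continuation after the prefix \<open>a\<close> is compared with
      the scaled path law on cylinders inside \<open>C\<close> only, since disjointness of the sites
      is available just there.\<close>
    have "emeasure M1 (F \<inter> stay C) = emeasure ?M2 (F \<inter> stay C)"
    proof (rule emeasure_stay_cong[OF _ _ _ _ _ F])
      have "space M1 = UNIV" by (simp add: M1_def)
      then show "finite_measure M1"
        by (intro finite_measureI) (simp add: M1)
      show "finite_measure ?M2"
        by (rule finite_measureI) (simp add: ennreal_mult_eq_top_iff)
      fix m and b :: "nat \<Rightarrow> int ^ 'd" assume b: "\<And>k. k \<le> m \<Longrightarrow> b k \<in> C"
      have disj: "a k \<noteq> a n + b j" if "k < n" "j < m" for k j
        using avoid[OF \<open>a \<in> G\<close> that(1)] b[of j] that(2) by auto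
      have "(\<integral>\<omega>. path_weight \<omega> k a \<partial>env_law \<mu>) \<ge> 0" for k a
        by (intro Bochner_Integration.integral_nonneg path_weight_env_bounds)
      then show "emeasure M1 (cyl m b) = emeasure ?M2 (cyl m b)"
        by (simp add: M1 cyl_Int_path_shift emeasure_path_law_cyl path_weight_glue
            integral_path_weight_mult[OF disj] ennreal_mult)
    qed (auto simp: M1_def)
    then show ?thesis using M1[OF FS] by simp
  qed
  have "emeasure (density path_law (indicator (path_shift n -` (F \<inter> stay C)))) G =
      emeasure (scale_measure (emeasure path_law (F \<inter> stay C)) path_law) G"
    by (rule emeasure_eq_determined[OF _ _ G])
      (use cyl shift_sets[OF FS] in \<open>auto simp: emeasure_restricted Int_commute mult.commute\<close>)
  then show ?thesis using shift_sets[OF FS] determined_sets[OF G]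
    by (simp add: emeasure_restricted Int_commute mult.commute)
qed

lemma AE_path_law_steps: "AE X in path_law. X 0 = 0 \<and> (\<forall>n. X (Suc n) - X n \<in> unit_steps)"
proof -
  have "AE X in path_law. X 0 = 0"
  proof -
    have det: "determined 0 {X :: nat \<Rightarrow> int ^ 'd. X 0 \<noteq> 0}" by (simp add: determined_def)
    \<comment> \<open>Every cylinder in the event has mass zero; comparison with
      \<open>null_measure\<close> adds them up.\<close>
    have "emeasure path_law {X. X 0 \<noteq> 0} = emeasure (null_measure path_space) {X :: nat \<Rightarrow> int ^ 'd. X 0 \<noteq> 0}"
      by (rule emeasure_eq_determined[OF _ _ det]) (auto simp: emeasure_path_law_cyl)
    then show ?thesis using determined_sets[OF det]
      by (subst AE_iff_measurable[of "{X. X 0 \<noteq> 0}"]) auto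
  qed
  moreover have "AE X in path_law. X (Suc n) - X n \<in> unit_steps" for n
  proof -
    let ?N = "{X :: nat \<Rightarrow> int ^ 'd. X (Suc n) - X n \<notin> unit_steps}"
    have det: "determined (Suc n) ?N" by (simp add: determined_def)
    have "emeasure path_law ?N = emeasure (null_measure path_space) ?N"
    proof (rule emeasure_eq_determined[OF _ _ det])
      fix a :: "nat \<Rightarrow> int ^ 'd" assume "a \<in> ?N"
      then have "path_weight \<omega> (Suc n) a = 0" for \<omega> by (simp add: path_weight_def step_prob_def)
      then show "emeasure path_law (cyl (Suc n) a) = emeasure (null_measure path_space) (cyl (Suc n) a)"
        by (simp add: emeasure_path_law_cyl)
    qed auto
    then show ?thesis using determined_sets[OF det]
      by (subst AE_iff_measurable[of ?N]) auto
  qed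
  ultimately show ?thesis by (simp add: AE_all_countable)
qed

end

section \<open>Ellipticity\<close>

lemma real_vec_add: "real_vec (x + y) = real_vec x + real_vec y"
  by (simp add: real_vec_def vec_eq_iff)

lemma real_vec_0 [simp]: "real_vec 0 = 0"
  by (simp add: real_vec_def vec_eq_iff)

lemma real_vec_diff: "real_vec (x - y) = real_vec x - real_vec y"
  by (simp add: real_vec_def vec_eq_iff)

lemma real_vec_axis: "real_vec (axis i a) = axis i (real_of_int a)"
  by (simp add: real_vec_def vec_eq_iff axis_def)

lemma axis_unit_step: "\<bar>a\<bar> = 1 \<Longrightarrow> axis i a \<in> (unit_steps :: (int ^ 'd::finite) set)"
proof -
  assume a: "\<bar>a\<bar> = 1"
  have "axis i (real_of_int a) = real_of_int a *\<^sub>R (axis i 1 :: real ^ 'd)"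
    by (simp add: vec_eq_iff axis_def)
  then show ?thesis using a by (simp add: unit_steps_def real_vec_axis flip: of_int_abs)
qed

text \<open>Induction on the l1 norm, which a step towards the origin in a nonzero coordinate
  lowers. To be applied to the set of sites visited infinitely often.\<close>

lemma zero_mem_if_step_closed:
  fixes S :: "(int ^ 'd::finite) set"
  assumes closed: "\<And>x e. x \<in> S \<Longrightarrow> e \<in> unit_steps \<Longrightarrow> x + e \<in> S" and x: "x \<in> S"
  shows "0 \<in> S"
  using x
proof (induction "\<Sum>i\<in>UNIV. nat \<bar>x $ i\<bar>" arbitrary: x rule: less_induct)
  case less
  show ?case
  proof (cases "x = 0")
    case False
    then obtain i where i: "x $ i \<noteq> 0" by (auto simp: vec_eq_iff)
    let ?y = "x + axis i (- sgn (x $ i))"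
    have "?y \<in> S" using i by (intro closed less.prems axis_unit_step) simp
    moreover have "(\<Sum>j\<in>UNIV. nat \<bar>?y $ j\<bar>) < (\<Sum>j\<in>UNIV. nat \<bar>x $ j\<bar>)"
    proof (rule sum_strict_mono_ex1)
      show "\<forall>j\<in>UNIV. nat \<bar>?y $ j\<bar> \<le> nat \<bar>x $ j\<bar>" using i by (auto simp: axis_def sgn_if)
      show "\<exists>j\<in>UNIV. nat \<bar>?y $ j\<bar> < nat \<bar>x $ j\<bar>" using i by (auto simp: axis_def sgn_if intro!: exI[of _ i])
    qed simp
    ultimately show ?thesis using less.hyps by blast
  qed (use less.prems in simp)
qed

lemma finite_lattice_ball: "finite {x :: int ^ 'd::finite. norm (real_vec x) \<le> b}"
proof -
  have "{x :: int ^ 'd. norm (real_vec x) \<le> b} \<subseteq> vec_lambda ` (UNIV \<rightarrow>\<^sub>E {- \<lceil>b\<rceil>..\<lceil>b\<rceil>})"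
  proof safe
    fix x :: "int ^ 'd" assume "norm (real_vec x) \<le> b"
    then have "\<bar>real_of_int (x $ i)\<bar> \<le> b" for i
      using component_le_norm_cart[of "real_vec x" i] by (simp add: real_vec_def)
    then have "\<bar>x $ i\<bar> \<le> \<lceil>b\<rceil>" for i
      by (metis ceiling_mono ceiling_of_int of_int_abs)
    then have "(\<lambda>i. x $ i) \<in> UNIV \<rightarrow>\<^sub>E {- \<lceil>b\<rceil>..\<lceil>b\<rceil>}"
      by (simp add: PiE_iff abs_le_iff minus_le_iff)
    then show "x \<in> vec_lambda ` (UNIV \<rightarrow>\<^sub>E {- \<lceil>b\<rceil>..\<lceil>b\<rceil>})"
      by (metis imageI vec_nth_inverse eta_contract_eq)
  qed
  then show ?thesis by (rule finite_subset) (auto intro!: finite_imageI finite_PiE)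
qed

section \<open>Sites visited infinitely often\<close>

definition visits_io :: "'a \<Rightarrow> (nat \<Rightarrow> 'a) \<Rightarrow> bool" where
  "visits_io x X \<longleftrightarrow> (\<forall>N. \<exists>n\<ge>N. X n = x)"

lemma measurable_coordinate [measurable]:
  "(\<lambda>X. X n) \<in> measurable path_space (count_space (UNIV :: (int ^ 'd::finite) set))"
  by (rule measurable_determined[of n]) simp

lemma measurable_visits_io [measurable]:
  "Measurable.pred path_space (visits_io (x :: int ^ 'd::finite))"
  unfolding visits_io_def[abs_def] by measurable

text \<open>Integer thresholds express the limit by countably many coordinate events.\<close>

lemma measurable_transient_in [measurable]:
  "Measurable.pred path_space (transient_in (l :: real ^ 'd::finite))"
proof -
  have "transient_in l X \<longleftrightarrow> (\<forall>K::nat. \<exists>N. \<forall>n\<in>{N..}. real K \<le> real_vec (X n) \<bullet> l)" for X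
  proof
    assume *: "\<forall>K::nat. \<exists>N. \<forall>n\<in>{N..}. real K \<le> real_vec (X n) \<bullet> l"
    show "transient_in l X"
      unfolding transient_in_def filterlim_at_top eventually_sequentially
    proof
      fix Z :: real
      obtain K :: nat where K: "Z \<le> real K" using real_arch_simple by blast
      obtain N where "\<forall>n\<in>{N..}. real K \<le> real_vec (X n) \<bullet> l" using * by blast
      then show "\<exists>N. \<forall>n\<ge>N. Z \<le> real_vec (X n) \<bullet> l" using K by (intro exI[of _ N]) force
    qed
  next
    assume "transient_in l X"
    then show "\<forall>K::nat. \<exists>N. \<forall>n\<in>{N..}. real K \<le> real_vec (X n) \<bullet> l"
      unfolding transient_in_def filterlim_at_top eventually_sequentially Ball_def atLeast_iff by blast
  qed
  then have "transient_in l = (\<lambda>X. \<forall>K::nat. \<exists>N. \<forall>n\<in>{N..}. real K \<le> real_vec (X n) \<bullet> l)" by (rule ext)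
  moreover have "Measurable.pred path_space (\<lambda>X :: nat \<Rightarrow> int ^ 'd. \<forall>K::nat. \<exists>N. \<forall>n\<in>{N..}. real K \<le> real_vec (X n) \<bullet> l)"
    by measurable
  ultimately show ?thesis by simp
qed

lemma not_transient_in_0: "\<not> transient_in 0 X"
proof
  assume "transient_in 0 X"
  then have "\<forall>\<^sub>F n in sequentially. (1 :: real) \<le> 0"
    unfolding transient_in_def filterlim_at_top inner_zero_right by blast
  then show False by simp
qed

text \<open>Each visit to \<open>x\<close> is an attempt to step to \<open>x + e\<close> that fails
  with probability \<open>1 - \<omega> x e < 1\<close> given the past, so infinitely many attempts
  cannot all fail. \<open>geometric_trials\<close> acts as a conditional Borel-Cantelli
  lemma.\<close>

lemma AE_quenched_visits_io_step:
  fixes \<omega> :: "'d::finite env"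
  assumes env: "\<And>z. \<omega> z \<in> prob_vectors" and e: "e \<in> unit_steps" and pos: "\<omega> x e > 0"
  shows "AE X in quenched 0 \<omega>. visits_io x X \<longrightarrow> visits_io (x + e) X"
proof -
  let ?Q = "quenched 0 \<omega>" and ?q = "\<omega> x e"
  interpret Q: prob_space ?Q by (rule prob_space_quenched[OF env])
  note sets_Q [measurable_cong, simp] = sets_quenched[OF env, of 0]
  have q: "?q \<le> 1" using step_prob_bounds[where \<omega>=\<omega> and z=x and y="x + e", OF env] e by (simp add: step_prob_def)
  have "AE X in ?Q. visits_io x X \<longrightarrow> (\<exists>n\<ge>n0. X n = x + e)" for n0
  proof -
    define H where "H = {X. visits_io x X \<and> (\<forall>n\<in>{n0..}. X n \<noteq> x + e)}"
    have H: "H \<in> sets path_space"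
    proof -
      have "Measurable.pred path_space (\<lambda>X. visits_io x X \<and> (\<forall>n\<in>{n0..}. X n \<noteq> x + e))" by measurable
      then show ?thesis by (simp add: pred_def H_def)
    qed
    \<comment> \<open>A retry at \<open>m\<close> records that the attempt at \<open>n\<close>
      failed and that the walk is back at \<open>x\<close>. With \<open>n < m\<close> the failed
      step belongs to the history at \<open>m\<close>; \<open>disjointed\<close> then picks the
      first return.\<close>
    define R where "R n m = {X :: nat \<Rightarrow> int ^ 'd. n0 \<le> n \<and> n < m \<and> X m = x \<and> X (Suc n) \<noteq> x + e}" for n m
    define B where "B n = {X :: nat \<Rightarrow> int ^ 'd. n0 \<le> n \<and> X n = x}" for n
    have "emeasure ?Q (H \<inter> B n) = 0" for n
    proof (rule geometric_trials[where \<rho>="1 - ?q" and K="\<lambda>n. disjointed (R n)"])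
      show "determined m (disjointed (R n) m)" for n m
      proof (rule determined_disjointed)
        show "determined k (R n k)" for k
          by (auto simp: R_def determined_def Suc_le_eq)
      qed
      show "disjointed (R n) m \<subseteq> B m" for n m
        using disjointed_subset[of "R n" m] by (auto simp: R_def B_def)
      show "disjointed (R n) m = {}" if "m < n" for n m
        using that disjointed_subset[of "R n" m] by (auto simp: R_def)
      show "determined n (B n)" for n by (simp add: B_def determined_def)
      show "AE X in ?Q. X \<in> H \<longrightarrow> X \<in> B n \<longrightarrow> X \<in> (\<Union>m. disjointed (R n) m)" for n
      proof (intro AE_I2 impI)
        fix X assume X: "X \<in> H" "X \<in> B n"
        then obtain m where "Suc n \<le> m" "X m = x" unfolding H_def visits_io_def by blast
        then have "X \<in> R n m" using X by (auto simp: R_def H_def B_def)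
        then show "X \<in> (\<Union>m. disjointed (R n) m)" unfolding UN_disjointed_eq by blast
      qed
      fix n and G :: "(nat \<Rightarrow> int ^ 'd) set" assume G: "determined n G" "G \<subseteq> B n"
      let ?E = "{X :: nat \<Rightarrow> int ^ 'd. X (Suc n) = x + e}"
      have Gs: "G \<in> sets path_space" by (rule determined_sets[OF G(1)])
      have Es: "?E \<in> sets path_space" by (rule determined_sets[of "Suc n"]) (simp add: determined_def)
      have "G \<inter> (\<Union>m. disjointed (R n) m) \<subseteq> G - G \<inter> ?E"
        unfolding UN_disjointed_eq by (auto simp: R_def)
      then have "emeasure ?Q (G \<inter> (\<Union>m. disjointed (R n) m)) \<le> emeasure ?Q (G - G \<inter> ?E)"
        using Gs Es by (intro emeasure_mono) auto
      also have "\<dots> = ennreal (Q.prob G - Q.prob G * ?q)"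
      proof -
        have "emeasure ?Q (G \<inter> ?E) = emeasure ?Q G * ennreal ?q"
          using G(2) by (intro emeasure_quenched_step[OF env G(1) _ e]) (auto simp: B_def)
        then have "Q.prob (G \<inter> ?E) = Q.prob G * ?q"
          using pos by (simp add: Q.emeasure_eq_measure ennreal_mult[symmetric])
        then show ?thesis
          using Gs Es by (subst Q.emeasure_eq_measure, subst Q.finite_measure_Diff) auto
      qed
      also have "\<dots> = ennreal (1 - ?q) * emeasure ?Q G"
        using q by (simp add: Q.emeasure_eq_measure ennreal_mult[symmetric] algebra_simps)
      finally show "emeasure ?Q (G \<inter> (\<Union>m. disjointed (R n) m)) \<le> ennreal (1 - ?q) * emeasure ?Q G" .
    qed (use pos q H in \<open>auto simp: Q.finite_measure_axioms disjoint_family_disjointed\<close>)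
    moreover have "B n \<in> sets path_space" for n
      by (rule determined_sets[of n]) (simp add: B_def determined_def)
    ultimately have "AE X in ?Q. X \<notin> H \<inter> B n" for n
      using H by (intro AE_not_in) (auto simp: null_sets_def)
    then have "AE X in ?Q. \<forall>n. X \<notin> H \<inter> B n" by (simp only: AE_all_countable) simp
    then show ?thesis
    proof eventually_elim
      case (elim X)
      show ?case
      proof (intro impI, rule ccontr)
        assume X: "visits_io x X" "\<not> (\<exists>n\<ge>n0. X n = x + e)"
        then obtain n where "n0 \<le> n" "X n = x" unfolding visits_io_def by blast
        then have "X \<in> H \<inter> B n" using X by (auto simp: H_def B_def)
        then show False using elim by blast
      qed
    qed
  qed
  then have "AE X in ?Q. \<forall>n0. visits_io x X \<longrightarrow> (\<exists>n\<ge>n0. X n = x + e)"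
    by (simp only: AE_all_countable) simp
  then show ?thesis by eventually_elim (simp add: visits_io_def)
qed

locale elliptic_environment = random_environment \<mu> for \<mu> :: "(int ^ 'd::finite \<Rightarrow> real) measure" +
  assumes elliptic: "strictly_elliptic \<mu>"
begin

lemma AE_env_pos: "AE \<omega> in env_law \<mu>. \<forall>z. \<forall>e\<in>unit_steps. \<omega> z e > 0"
proof -
  have "AE \<omega> in env_law \<mu>. \<omega> z e > 0" if "e \<in> unit_steps" for z e
  proof -
    have "AE \<omega> in distr (env_law \<mu>) (env_law \<mu>) (translate z). \<omega> 0 e > 0"
      unfolding distr_translate using elliptic that unfolding strictly_elliptic_def by blast
    from AE_distrD[OF measurable_translate this] show ?thesis by (simp add: translate_def)
  qed
  then show ?thesis
    by (simp add: AE_all_countable AE_ball_countable countable_finite)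
qed

lemma AE_visits_io_0: "AE X in path_law. \<forall>x. visits_io x X \<longrightarrow> visits_io 0 X"
proof -
  have "AE X in path_law. \<forall>x. \<forall>e\<in>unit_steps. visits_io x X \<longrightarrow> visits_io (x + e) X"
  proof -
    have "AE X in path_law. visits_io x X \<longrightarrow> visits_io (x + e) X" if e: "e \<in> unit_steps" for x e
    proof (rule AE_path_law_quenched)
      show "AE \<omega> in env_law \<mu>. AE X in quenched 0 \<omega>. visits_io x X \<longrightarrow> visits_io (x + e) X"
        using AE_env_pos AE_space
      proof eventually_elim
        case (elim \<omega>)
        then show ?case using env_prob_vectors e by (intro AE_quenched_visits_io_step) auto
      qed
    qed measurable
    then show ?thesis
      unfolding AE_all_countable by (intro allI AE_ball_countable') (auto intro: countable_finite)
  qed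
  then show ?thesis
  proof eventually_elim
    case (elim X)
    then show ?case using zero_mem_if_step_closed[of "{x. visits_io x X}"] by auto
  qed
qed

lemma AE_transient_if_direction:
  assumes \<nu>: "norm \<nu> = 1" and "l \<bullet> \<nu> > 0"
    and conv: "AE X in path_law. (\<lambda>n. real_vec (X n) /\<^sub>R norm (real_vec (X n))) \<longlonglongrightarrow> \<nu>"
  shows "AE X in path_law. transient_in l X"
  using conv AE_visits_io_0
proof eventually_elim
  case (elim X)
  have "\<not> visits_io 0 X"
  proof
    assume io: "visits_io 0 X"
    have "eventually (\<lambda>n. dist (real_vec (X n) /\<^sub>R norm (real_vec (X n))) \<nu> < 1) sequentially"
      using elim(1) by (rule tendstoD) simp
    then obtain N where N: "\<And>n. n \<ge> N \<Longrightarrow> dist (real_vec (X n) /\<^sub>R norm (real_vec (X n))) \<nu> < 1"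
      unfolding eventually_sequentially by blast
    obtain n where "n \<ge> N" "X n = 0" using io unfolding visits_io_def by blast
    \<comment> \<open>At 0 the quotient is 0 because \<open>inverse 0 = 0\<close>; its distance from
      the unit vector is exactly 1, against the strict bound.\<close>
    then show False using N[of n] \<nu> by simp
  qed
  then have "\<not> visits_io x X" for x using elim(2) by blast
  then have away: "eventually (\<lambda>n. X n \<noteq> x) sequentially" for x
    unfolding visits_io_def eventually_sequentially by blast
  have norm: "filterlim (\<lambda>n. norm (real_vec (X n))) at_top sequentially"
    unfolding filterlim_at_top
  proof
    fix b :: real
    have "eventually (\<lambda>n. \<forall>x\<in>{x. norm (real_vec x) \<le> b}. X n \<noteq> x) sequentially"
      using away by (intro eventually_ball_finite finite_lattice_ball) auto
    then show "\<forall>\<^sub>F n in sequentially. b \<le> norm (real_vec (X n))"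
      by eventually_elim force
  qed
  have "(\<lambda>n. (real_vec (X n) /\<^sub>R norm (real_vec (X n))) \<bullet> l) \<longlonglongrightarrow> \<nu> \<bullet> l"
    by (intro tendsto_intros elim)
  then have "filterlim (\<lambda>n. ((real_vec (X n) /\<^sub>R norm (real_vec (X n))) \<bullet> l) * norm (real_vec (X n))) at_top sequentially"
    using norm assms(2) by (intro filterlim_tendsto_pos_mult_at_top[where c="\<nu> \<bullet> l"]) (auto simp: inner_commute)
  moreover have "((real_vec (X n) /\<^sub>R norm (real_vec (X n))) \<bullet> l) * norm (real_vec (X n)) = real_vec (X n) \<bullet> l" for n
    by (cases "real_vec (X n) = 0") auto
  ultimately show ?case unfolding transient_in_def by (simp only:)
qed

text \<open>No independence is needed here: the quenched probability of the initial straight segment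
  is almost surely positive, and that of the continuation is positive on a set of environments
  of positive measure.\<close>

lemma stay_pos_if_tail_pos:
  fixes a :: "nat \<Rightarrow> int ^ 'd"
  assumes a: "a 0 = 0" "\<And>k. a (Suc k) - a k \<in> unit_steps" "\<And>k. a k \<in> C"
    and tail: "emeasure path_law (stay {y. a n + y \<in> C}) \<noteq> 0"
  shows "emeasure path_law (stay C) \<noteq> 0"
proof
  let ?F = "stay {y. a n + y \<in> C} :: (nat \<Rightarrow> int ^ 'd) set"
  assume "emeasure path_law (stay C) = 0"
  moreover have "cyl n a \<inter> path_shift n -` ?F \<subseteq> stay C"
  proof
    fix X assume X: "X \<in> cyl n a \<inter> path_shift n -` ?F"
    have "X m \<in> C" for m
    proof (cases "m \<le> n")
      case True
      then show ?thesis using X a(3) by (simp add: cyl_def)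
    next
      case False
      have "a n + (X (n + (m - n)) - X n) \<in> C" "X n = a n"
        using X by (auto simp: stay_def path_shift_def cyl_def)
      then show ?thesis using False by simp
    qed
    then show "X \<in> stay C" by (simp add: stay_def)
  qed
  moreover have meas: "cyl n a \<inter> path_shift n -` ?F \<in> sets path_space"
    using measurable_sets[OF measurable_path_shift stay_sets] by auto
  ultimately have "emeasure path_law (cyl n a \<inter> path_shift n -` ?F) = 0"
    using emeasure_mono[of "cyl n a \<inter> path_shift n -` ?F" "stay C" path_law] by simp
  then have "AE \<omega> in env_law \<mu>. emeasure (quenched 0 \<omega>) (cyl n a \<inter> path_shift n -` ?F) = 0"
    unfolding emeasure_path_law[OF meas] using meas by (simp add: nn_integral_0_iff_AE measurable_emeasure_quenched)
  \<comment> \<open>The Markov property writes the vanishing probability as a product whose first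
    factor, the weight of the prefix, is almost surely positive.\<close>
  then have "AE \<omega> in env_law \<mu>. emeasure (quenched 0 (translate (a n) \<omega>)) ?F = 0"
    using AE_env_pos AE_space
  proof eventually_elim
    case (elim \<omega>)
    note env = env_prob_vectors[OF elim(3)]
    have "path_weight \<omega> n a > 0"
      unfolding path_weight_def using elim(2) a(2) by (intro prod_pos) (simp add: step_prob_def)
    then have "emeasure (quenched 0 \<omega>) (cyl n a) \<noteq> 0"
      using emeasure_quenched_cyl[of \<omega>, OF env] a(1) by simp
    then show ?case using elim(1) quenched_markov_shift[of \<omega>, OF env stay_sets] by simp
  qed
  then have "(\<integral>\<^sup>+ \<omega>. emeasure (quenched 0 (translate (a n) \<omega>)) ?F \<partial>env_law \<mu>) = 0"
    by (simp add: nn_integral_cong_AE)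
  \<comment> \<open>The environment seen from \<open>a n\<close> has the same law, so averaging
    undoes the translation.\<close>
  also have "(\<integral>\<^sup>+ \<omega>. emeasure (quenched 0 (translate (a n) \<omega>)) ?F \<partial>env_law \<mu>) =
      (\<integral>\<^sup>+ \<omega>. emeasure (quenched 0 \<omega>) ?F \<partial>distr (env_law \<mu>) (env_law \<mu>) (translate (a n)))"
    by (subst nn_integral_distr) (auto simp: measurable_emeasure_quenched)
  also have "\<dots> = emeasure path_law ?F"
    by (simp add: distr_translate emeasure_path_law)
  finally show False using tail by simp
qed

text \<open>Transience bounds each projection on \<open>w\<close> from below along the whole path,
  so a translation far enough in direction \<open>e\<close> moves the path into the cone. The
  distance is random, but some fixed \<open>n\<close> works with positive probability, and the
  straight walk \<open>a\<close> covers that distance inside the cone.\<close>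

lemma stay_pos_if_transient:
  fixes e :: "int ^ 'd"
  assumes W: "finite W" "\<And>w. w \<in> W \<Longrightarrow> AE X in path_law. transient_in w X"
    and e: "e \<in> unit_steps" "\<And>w. w \<in> W \<Longrightarrow> real_vec e \<bullet> w > 0"
  shows "emeasure path_law (stay {y. \<forall>w\<in>W. 0 \<le> real_vec y \<bullet> w}) \<noteq> 0"
proof -
  let ?C = "{y. \<forall>w\<in>W. 0 \<le> real_vec y \<bullet> w} :: (int ^ 'd) set"
  define a :: "nat \<Rightarrow> int ^ 'd" where "a k = (\<chi> i. int k * e $ i)" for k
  have a_vec: "real_vec (a k) = real k *\<^sub>R real_vec e" for k
    by (simp add: a_def real_vec_def vec_eq_iff)
  have "AE X in path_law. \<forall>w\<in>W. transient_in w X"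
    using W by (simp add: AE_ball_countable countable_finite)
  then have "AE X in path_law. \<exists>n. X \<in> stay {y. a n + y \<in> ?C}"
  proof eventually_elim
    case (elim X)
    have "\<forall>\<^sub>F n in sequentially. \<forall>w\<in>W. \<forall>m. 0 \<le> real_vec (a n + X m) \<bullet> w"
    proof (rule eventually_ball_finite[OF W(1)], intro ballI)
      fix w assume w: "w \<in> W"
      have "\<forall>\<^sub>F m in sequentially. 0 \<le> real_vec (X m) \<bullet> w"
        using elim w unfolding transient_in_def filterlim_at_top by blast
      then obtain N where N: "\<And>m. m \<ge> N \<Longrightarrow> 0 \<le> real_vec (X m) \<bullet> w"
        unfolding eventually_sequentially by blast
      define b where "b = Max ((\<lambda>m. \<bar>real_vec (X m) \<bullet> w\<bar>) ` {..N})"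
      have "\<bar>real_vec (X m) \<bullet> w\<bar> \<le> b" if "m \<le> N" for m
        using that by (simp add: b_def)
      moreover from this[of 0] have "0 \<le> b" by simp
      ultimately have lower: "- b \<le> real_vec (X m) \<bullet> w" for m
        using N[of m] by (cases "m \<le> N") (force simp: abs_le_iff)+
      have "\<forall>\<^sub>F n in sequentially. b / (real_vec e \<bullet> w) \<le> real n"
        using filterlim_real_sequentially unfolding filterlim_at_top by blast
      then show "\<forall>\<^sub>F n in sequentially. \<forall>m. 0 \<le> real_vec (a n + X m) \<bullet> w"
      proof eventually_elim
        case (elim n)
        then have "b \<le> real n * (real_vec e \<bullet> w)"
          using e(2)[OF w] by (simp add: divide_le_eq)
        then show ?case
          using lower by (auto simp: real_vec_add a_vec inner_add_left) (smt (verit))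
      qed
    qed
    then obtain n where "\<forall>w\<in>W. \<forall>m. 0 \<le> real_vec (a n + X m) \<bullet> w"
      using eventually_happens' trivial_limit_sequentially by blast
    then show ?case by (auto simp: stay_def)
  qed
  have "\<exists>n. emeasure path_law (stay {y. a n + y \<in> ?C}) \<noteq> 0"
  proof (rule ccontr)
    assume "\<not> ?thesis"
    then have "AE X in path_law. X \<notin> stay {y. a n + y \<in> ?C}" for n
      by (intro AE_not_in) (simp add: null_sets_def)
    then have "AE X in path_law. \<forall>n. X \<notin> stay {y. a n + y \<in> ?C}" by (simp only: AE_all_countable) simp
    with \<open>AE X in path_law. \<exists>n. X \<in> stay {y. a n + y \<in> ?C}\<close> have "AE X in path_law. False"
      by eventually_elim blast
    then show False by (simp add: path.AE_False)
  qed
  then obtain n where n: "emeasure path_law (stay {y. a n + y \<in> ?C}) \<noteq> 0" ..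
  show ?thesis
  proof (rule stay_pos_if_tail_pos[where a=a and n=n])
    show "a 0 = 0" by (simp add: a_def vec_eq_iff)
    have "a (Suc k) - a k = e" for k by (simp add: a_def vec_eq_iff algebra_simps)
    then show "a (Suc k) - a k \<in> unit_steps" for k using e by simp
    show "a k \<in> ?C" for k using e(2) by (auto simp: a_vec less_imp_le)
    show "emeasure path_law (stay {y. a n + y \<in> ?C}) \<noteq> 0" by (rule n)
  qed
qed

end

section \<open>Regeneration times\<close>

text \<open>The first passage above the maximum over \<open>{..N}\<close> is such a time.\<close>

lemma ex_strict_record:
  fixes h :: "nat \<Rightarrow> real"
  assumes "filterlim h at_top sequentially"
  shows "\<exists>m\<ge>N. \<forall>k<m. h k < h m"
proof -
  define b where "b = Max (h ` {..N})"
  have b: "h k \<le> b" if "k \<le> N" for k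
    using that by (simp add: b_def)
  have "\<exists>m. h m > b"
    using assms unfolding filterlim_at_top_dense by (metis eventually_sequentially order_refl)
  then have m: "h (LEAST m. h m > b) > b" by (rule LeastI_ex)
  define m where "m = (LEAST m. h m > b)"
  have "m > N" using m b by (metis linorder_not_less m_def)
  moreover have "h k < h m" if "k < m" for k
    using not_less_Least[OF that[unfolded m_def]] m by (simp add: m_def)
  ultimately show ?thesis by (intro exI[of _ m]) auto
qed

definition record_at :: "('a \<Rightarrow> real) \<Rightarrow> nat \<Rightarrow> (nat \<Rightarrow> 'a) set" where
  "record_at h n = {X. \<forall>m<n. h (X m) < h (X n)}"

lemma determined_record_at: "determined n (record_at h n)"
  by (auto simp: determined_def record_at_def)

text \<open>\<open>norm_C\<close> puts all of \<open>C\<close> except 0 at strictly positive height;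
  it separates the sites before a record from the cone at the record, and it bounds displacements by
  gains in height. \<open>add_C\<close> lets the cones at successive regenerations nest.\<close>

locale cone_renewal = random_environment \<mu> for \<mu> :: "(int ^ 'd::finite \<Rightarrow> real) measure" +
  fixes C :: "(int ^ 'd) set" and l :: "real ^ 'd" and c :: real
  assumes zero_C: "0 \<in> C" and add_C: "\<And>x y. x \<in> C \<Longrightarrow> y \<in> C \<Longrightarrow> x + y \<in> C"
    and norm_C: "\<And>x. x \<in> C \<Longrightarrow> norm (real_vec x) \<le> c * (real_vec x \<bullet> l)" and c_pos: "c > 0"
    and transient: "AE X in path_law. transient_in l X"
    and stay_pos: "path.prob (stay C) > 0"
begin

definition height :: "int ^ 'd \<Rightarrow> real" where
  "height x = real_vec x \<bullet> l"

definition regen :: "nat \<Rightarrow> (nat \<Rightarrow> int ^ 'd) \<Rightarrow> bool" where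
  "regen n X \<longleftrightarrow> X \<in> record_at height n \<and> path_shift n X \<in> stay C"

lemma height_diff: "height (x - y) = height x - height y"
  and height_0 [simp]: "height 0 = 0"
  by (simp_all add: height_def real_vec_def inner_vec_def sum_subtractf algebra_simps)

lemma height_C: "x \<in> C \<Longrightarrow> 0 \<le> height x"
  using norm_C[of x] c_pos unfolding height_def
  by (meson norm_ge_zero order_trans zero_le_mult_iff linorder_not_less)

text \<open>Earlier sites lie strictly below the record while the cone has nonnegative height, so a
  record supplies the avoidance condition.\<close>

lemma emeasure_record_shift:
  assumes "determined n G" "G \<subseteq> record_at height n" "F \<in> sets path_space"
  shows "emeasure path_law (G \<inter> path_shift n -` (F \<inter> stay C)) =
    emeasure path_law G * emeasure path_law (F \<inter> stay C)"
proof (rule emeasure_path_law_shift_stay[OF assms(1) _ assms(3)])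
  fix X k assume "X \<in> G" "k < n"
  then have "height (X k - X n) < 0" using assms(2) by (auto simp: record_at_def height_diff)
  then show "X k - X n \<notin> C" using height_C by fastforce
qed

lemma path_shift_vimage_sets:
  "A \<in> sets path_space \<Longrightarrow> path_shift n -` A \<in> sets (path_space :: (nat \<Rightarrow> int ^ 'd) measure)"
  using measurable_sets[OF measurable_path_shift, of A n] by simp

lemma regen_sets [measurable]: "Measurable.pred path_space (regen n)"
  using path_shift_vimage_sets[OF stay_sets, of n C] determined_sets[OF determined_record_at[of n height]]
  by (auto simp: pred_def regen_def vimage_def Collect_conj_eq)

text \<open>For fixed \<open>n\<close> the exceptional continuations inside \<open>stay C\<close>
  are null, and by factorization so are the paths having a record at \<open>n\<close> followed by
  one of them; there are only countably many \<open>n\<close>.\<close>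

lemma AE_path_law_regen:
  assumes "AE X in path_law. X \<in> stay C \<longrightarrow> \<phi> X"
  shows "AE X in path_law. \<forall>n. regen n X \<longrightarrow> \<phi> (path_shift n X)"
  unfolding AE_all_countable
proof
  fix n
  obtain N where N: "{X \<in> space path_law. \<not> (X \<in> stay C \<longrightarrow> \<phi> X)} \<subseteq> N"
      "emeasure path_law N = 0" "N \<in> sets path_law"
    using AE_E[OF assms] by blast
  have sets_N: "N \<in> sets path_space" using N(3) by simp
  have "emeasure path_law (N \<inter> stay C) \<le> emeasure path_law N"
    using N by (intro emeasure_mono) auto
  then have "emeasure path_law (record_at height n \<inter> path_shift n -` (N \<inter> stay C)) = 0"
    using emeasure_record_shift[OF determined_record_at order_refl sets_N, of n] N(2) by simp
  moreover have "record_at height n \<inter> path_shift n -` (N \<inter> stay C) \<in> sets path_space"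
    using path_shift_vimage_sets[of "N \<inter> stay C" n] sets_N determined_sets[OF determined_record_at[of n height]]
    by (simp del: vimage_Int)
  ultimately show "AE X in path_law. regen n X \<longrightarrow> \<phi> (path_shift n X)"
    by (intro AE_I[where N="record_at height n \<inter> path_shift n -` (N \<inter> stay C)"])
      (use N(1) in \<open>auto simp: regen_def\<close>)
qed

definition good :: "(nat \<Rightarrow> int ^ 'd) \<Rightarrow> bool" where
  "good X \<longleftrightarrow> X 0 = 0 \<and> (\<forall>n. \<exists>m\<ge>n. regen m X)"

text \<open>Strict records are the trials, each a regeneration with probability \<open>?p\<close>
  given the past. A failure shows itself at a finite exit time, and transience supplies a later
  record for the next trial.\<close>

lemma AE_good: "AE X in path_law. good X"
proof -
  let ?p = "path.prob (stay C)"
  have later: "AE X in path_law. \<exists>m\<ge>n0. regen m X" for n0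
  proof -
    define H where "H = {X. \<forall>m\<ge>n0. \<not> regen m X}"
    have H [measurable]: "H \<in> sets path_space"
    proof -
      have "Measurable.pred path_space (\<lambda>X. \<forall>m\<in>{n0..}. \<not> regen m X)" by measurable
      then show ?thesis by (simp add: pred_def H_def Ball_def)
    qed
    \<comment> \<open>Failure of the trial at \<open>n\<close> as visible by time \<open>m\<close>;
      the complement of \<open>stay C\<close> would refer to the infinite future and would not be
      \<open>determined\<close>.\<close>
    define exited where "exited n m = {X :: nat \<Rightarrow> int ^ 'd. \<exists>j. n \<le> j \<and> j \<le> m \<and> X j - X n \<notin> C}" for n m
    define R where "R n m = (if n0 \<le> n \<and> n < m then record_at height m \<inter> exited n m else {})" for n m
    define K where "K n = disjointed (R n)" for n
    define B where "B n = (if n0 \<le> n then record_at height n else {})" for n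
    have R: "determined m (R n m)" for n m
    proof (cases "n < m")
      case True
      then have "determined m (exited n m)" by (auto simp: exited_def determined_def)
      then show ?thesis by (simp add: R_def determined_Int determined_record_at determined_def[of _ "{}"])
    qed (simp add: R_def determined_def)
    have "emeasure path_law (H \<inter> B n) = 0" for n
    proof (rule geometric_trials[where \<rho>="1 - ?p" and K=K])
      show "determined m (K n m)" for n m
        unfolding K_def by (rule determined_disjointed) (rule R)
      show "disjoint_family (K n)" for n
        unfolding K_def by (rule disjoint_family_disjointed)
      show "K n m \<subseteq> B m" for n m
        using disjointed_subset[of "R n" m] by (auto simp: K_def R_def B_def split: if_splits)
      show "K n m = {}" if "m < n" for n m 
        using that disjointed_subset[of "R n" m] by (auto simp: K_def R_def split: if_splits)
      show "determined n (B n)" for n by (simp add: B_def determined_record_at determined_def[of _ "{}"])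
      show "AE X in path_law. X \<in> H \<longrightarrow> X \<in> B n \<longrightarrow> X \<in> (\<Union>m. K n m)" for n
        using transient
      proof eventually_elim
        case (elim X)
        show ?case
        proof (intro impI)
          assume X: "X \<in> H" "X \<in> B n"
          then have n: "n0 \<le> n" "X \<in> record_at height n" by (auto simp: B_def split: if_splits)
          then have "path_shift n X \<notin> stay C" using X(1) by (auto simp: H_def regen_def)
          then obtain j where j: "X (n + j) - X n \<notin> C" by (auto simp: stay_def path_shift_def)
          have "filterlim (\<lambda>n. height (X n)) at_top sequentially"
            using elim by (simp add: transient_in_def height_def)
          from ex_strict_record[OF this, of "Suc (n + j)"] obtain m where m: "Suc (n + j) \<le> m" "X \<in> record_at height m"
            by (auto simp: record_at_def)
          have "X \<in> R n m" using m j n by (auto simp: R_def exited_def intro!: exI[of _ "n + j"])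
          then show "X \<in> (\<Union>m. K n m)" unfolding K_def UN_disjointed_eq by blast
        qed
      qed
      fix n and G :: "(nat \<Rightarrow> int ^ 'd) set" assume G: "determined n G" "G \<subseteq> B n"
      have rec: "G \<subseteq> record_at height n" using G(2) by (auto simp: B_def split: if_splits)
      have Gs: "G \<in> sets path_space" by (rule determined_sets[OF G(1)])
      have Ss: "path_shift n -` stay C \<in> sets path_space" by (rule path_shift_vimage_sets) simp
      have "G \<inter> (\<Union>m. K n m) \<subseteq> G - G \<inter> path_shift n -` (UNIV \<inter> stay C)"
        unfolding K_def UN_disjointed_eq
        by (auto simp: R_def exited_def stay_def path_shift_def split: if_splits)
          (metis le_add_diff_inverse)
      then have "emeasure path_law (G \<inter> (\<Union>m. K n m)) \<le> emeasure path_law (G - G \<inter> path_shift n -` (UNIV \<inter> stay C))"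
        using Gs Ss by (intro emeasure_mono) auto
      also have "\<dots> = ennreal (path.prob G - path.prob G * ?p)"
        using emeasure_record_shift[OF G(1) rec, of UNIV] Gs Ss
        by (subst path.emeasure_eq_measure, subst path.finite_measure_Diff)
          (auto simp: path.emeasure_eq_measure ennreal_mult[symmetric])
      also have "\<dots> = ennreal (1 - ?p) * emeasure path_law G"
        by (simp add: path.emeasure_eq_measure ennreal_mult[symmetric] algebra_simps)
      finally show "emeasure path_law (G \<inter> (\<Union>m. K n m)) \<le> ennreal (1 - ?p) * emeasure path_law G" .
    qed (use stay_pos in \<open>auto simp: path.finite_measure_axioms\<close>)
    then have "AE X in path_law. X \<notin> H \<inter> B n" for n
      using determined_sets[OF determined_record_at[of n height]]
      by (intro AE_not_in) (auto simp: null_sets_def B_def)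
    then have "AE X in path_law. \<forall>n. X \<notin> H \<inter> B n" by (simp only: AE_all_countable) simp
    then show ?thesis using transient
    proof eventually_elim
      case (elim X)
      have "filterlim (\<lambda>n. height (X n)) at_top sequentially"
        using elim by (simp add: transient_in_def height_def)
      from ex_strict_record[OF this, of n0] obtain m where "n0 \<le> m" "X \<in> record_at height m"
        by (auto simp: record_at_def)
      moreover have "X \<notin> H \<inter> B m" using elim(1) by blast
      ultimately show ?case by (auto simp: H_def B_def)
    qed
  qed
  have "AE X in path_law. \<forall>n. \<exists>m\<ge>n. regen m X"
    unfolding AE_all_countable using later by blast
  with AE_path_law_steps show ?thesis by eventually_elim (simp add: good_def)
qed

section \<open>The path up to its next regeneration\<close>

definition next_regen :: "(nat \<Rightarrow> int ^ 'd) \<Rightarrow> nat" where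
  "next_regen X = (LEAST n. 0 < n \<and> regen n X)"

definition gap :: "(nat \<Rightarrow> int ^ 'd) \<Rightarrow> int ^ 'd" where
  "gap X = X (next_regen X)"

definition renew :: "(nat \<Rightarrow> int ^ 'd) \<Rightarrow> nat \<Rightarrow> int ^ 'd" where
  "renew X = path_shift (next_regen X) X"

lemma next_regen:
  assumes "good X"
  shows "0 < next_regen X" "regen (next_regen X) X"
proof -
  obtain n where "Suc 0 \<le> n" "regen n X" using assms unfolding good_def by blast
  then have "0 < n \<and> regen n X" by simp
  then have "0 < next_regen X \<and> regen (next_regen X) X" unfolding next_regen_def by (rule LeastI)
  then show "0 < next_regen X" "regen (next_regen X) X" by auto
qed

lemma next_regen_le: "0 < n \<Longrightarrow> regen n X \<Longrightarrow> next_regen X \<le> n"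
  unfolding next_regen_def by (rule Least_le) simp

lemma path_shift_path_shift: "path_shift m (path_shift n X) = path_shift (n + m) (X :: nat \<Rightarrow> int ^ 'd)"
  by (simp add: path_shift_def add.assoc)

lemma path_shift_0: "X 0 = 0 \<Longrightarrow> path_shift 0 X = (X :: nat \<Rightarrow> int ^ 'd)"
  by (simp add: path_shift_def)

lemma regen_C: "regen n X \<Longrightarrow> n \<le> m \<Longrightarrow> X m - X n \<in> C"
proof -
  assume "regen n X" "n \<le> m"
  then have "path_shift n X (m - n) \<in> C" "n + (m - n) = m" by (auto simp: regen_def stay_def)
  then show ?thesis by (simp add: path_shift_def)
qed

lemma regen_height_less: "regen n X \<Longrightarrow> m < n \<Longrightarrow> height (X m) < height (X n)"
  by (auto simp: regen_def record_at_def)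

lemma regen_height_le: "regen n X \<Longrightarrow> n \<le> m \<Longrightarrow> height (X n) \<le> height (X m)"
  using height_C[OF regen_C[of n X m]] by (simp add: height_diff)

lemma regen_0: "X 0 = 0 \<Longrightarrow> regen 0 X \<longleftrightarrow> X \<in> stay C"
  by (simp add: regen_def record_at_def path_shift_0)

text \<open>At a regeneration all earlier heights lie below \<open>height (X n)\<close> and all
  later ones at or above it, so a record of the shifted path is a record of the whole path.\<close>

lemma regen_path_shift:
  assumes "regen n X"
  shows "regen k (path_shift n X) \<longleftrightarrow> regen (n + k) X"
proof -
  have "path_shift n X \<in> record_at height k \<longleftrightarrow> X \<in> record_at height (n + k)"
  proof
    assume *: "path_shift n X \<in> record_at height k"
    have "height (X m) < height (X (n + k))" if "m < n + k" for m
    proof (cases "m < n")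
      case True
      then show ?thesis using regen_height_less[OF assms True] regen_height_le[OF assms, of "n + k"] by simp
    next
      case False
      then have "height (path_shift n X (m - n)) < height (path_shift n X k)"
        using * that by (auto simp: record_at_def)
      then show ?thesis using False by (simp add: path_shift_def height_diff)
    qed
    then show "X \<in> record_at height (n + k)" by (simp add: record_at_def)
  qed (auto simp: record_at_def path_shift_def height_diff)
  then show ?thesis by (simp add: regen_def path_shift_path_shift)
qed

lemma good_path_shift:
  assumes "good X" "regen n X"
  shows "good (path_shift n X)" "path_shift n X \<in> stay C"
proof -
  show "path_shift n X \<in> stay C" using assms(2) by (simp add: regen_def)
  have "\<exists>m\<ge>k. regen m (path_shift n X)" for k
  proof -
    obtain m where "n + k \<le> m" "regen m X" using assms(1) unfolding good_def by blast
    then show ?thesis using regen_path_shift[OF assms(2), of "m - n"] by (intro exI[of _ "m - n"]) auto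
  qed
  then show "good (path_shift n X)" by (simp add: good_def path_shift_def)
qed

lemma good_renew: "good X \<Longrightarrow> good (renew X)" "good X \<Longrightarrow> renew X \<in> stay C"
  unfolding renew_def using good_path_shift next_regen by blast+

lemma measurable_next_regen [measurable]: "next_regen \<in> measurable path_space (count_space UNIV)"
  unfolding next_regen_def[abs_def] by measurable

lemma measurable_gap [measurable]: "gap \<in> measurable path_space (count_space UNIV)"
  unfolding gap_def[abs_def]
  by (rule measurable_compose_countable[OF measurable_coordinate measurable_next_regen])

lemma measurable_renew [measurable]: "renew \<in> measurable path_space path_space"
  unfolding renew_def[abs_def]
  by (rule measurable_compose_countable[OF measurable_path_shift measurable_next_regen])

text \<open>The part of \<open>next_regen X = n\<close> that is visible at time \<open>n\<close>: an
  intermediate record must be spoilt by an exit no later than \<open>n\<close>, and the path must be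
  in \<open>C\<close> only so far.\<close>

definition first_block :: "nat \<Rightarrow> (nat \<Rightarrow> int ^ 'd) set" where
  "first_block n = {X. 0 < n \<and> X \<in> record_at height n \<and> (\<forall>m\<le>n. X m \<in> C) \<and>
     (\<forall>m. 0 < m \<longrightarrow> m < n \<longrightarrow> X \<in> record_at height m \<longrightarrow> (\<exists>j. m \<le> j \<and> j \<le> n \<and> X j - X m \<notin> C))}"

lemma determined_first_block: "determined n (first_block n)"
proof (rule determinedI)
  fix X Y :: "nat \<Rightarrow> int ^ 'd" assume eq: "\<And>k. k \<le> n \<Longrightarrow> X k = Y k" and X: "X \<in> first_block n"
  have "X \<in> record_at height m \<longleftrightarrow> Y \<in> record_at height m" if "m \<le> n" for m
    using that eq by (intro determined_iff[OF determined_record_at]) simp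
  then show "Y \<in> first_block n" using X eq by (auto simp: first_block_def) (metis less_imp_le)
qed

text \<open>\<open>add_C\<close> works in both directions. Forwards, a position after
  \<open>n\<close> is \<open>X n\<close> plus an element of \<open>C\<close>. Backwards, suppose the
  cone at \<open>m\<close> is left only after \<open>n\<close>: since the walk stays in the cone at
  \<open>n\<close>, already \<open>X n - X m\<close> must lie outside \<open>C\<close>.\<close>

lemma first_block_iff:
  assumes "X 0 = 0"
  shows "X \<in> first_block n \<and> path_shift n X \<in> stay C \<longleftrightarrow>
    X \<in> stay C \<and> 0 < n \<and> regen n X \<and> next_regen X = n"
proof
  assume *: "X \<in> first_block n \<and> path_shift n X \<in> stay C"
  then have n: "0 < n" "regen n X" by (auto simp: first_block_def regen_def)
  have "X m \<in> C" for m
  proof (cases "m \<le> n")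
    case False
    have "X n + (X m - X n) \<in> C"
      using * False regen_C[OF n(2), of m] by (intro add_C) (auto simp: first_block_def)
    then show ?thesis by simp
  qed (use * in \<open>auto simp: first_block_def\<close>)
  moreover have "next_regen X = n"
  proof (rule antisym)
    show "next_regen X \<le> n" using next_regen_le n by blast
    show "n \<le> next_regen X"
      unfolding next_regen_def
    proof (rule LeastI2[of _ n])
      fix m assume m: "0 < m \<and> regen m X"
      show "n \<le> m"
      proof (rule ccontr)
        assume "\<not> n \<le> m"
        then have "m < n" "X \<in> record_at height m" using m by (auto simp: regen_def)
        then obtain j where "m \<le> j" "X j - X m \<notin> C" using * m by (auto simp: first_block_def)
        then show False using regen_C[of m X j] m by auto
      qed
    qed (use n in auto)
  qed
  ultimately show "X \<in> stay C \<and> 0 < n \<and> regen n X \<and> next_regen X = n"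
    using n by (simp add: stay_def)
next
  assume *: "X \<in> stay C \<and> 0 < n \<and> regen n X \<and> next_regen X = n"
  have "\<exists>j. m \<le> j \<and> j \<le> n \<and> X j - X m \<notin> C"
    if m: "0 < m" "m < n" "X \<in> record_at height m" for m
  proof -
    have "\<not> regen m X" using next_regen_le[of m X] m * by auto
    then obtain i where i: "X (m + i) - X m \<notin> C" using m(3) by (auto simp: regen_def stay_def path_shift_def)
    show ?thesis
    proof (cases "m + i \<le> n")
      case True
      then show ?thesis using i by (intro exI[of _ "m + i"]) auto
    next
      case False
      then have "X (m + i) - X n \<in> C" using * regen_C[of n X "m + i"] by auto
      then have "X n - X m \<notin> C" using i add_C[of "X (m + i) - X n" "X n - X m"] by auto
      then show ?thesis using m by (intro exI[of _ n]) auto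
    qed
  qed
  then show "X \<in> first_block n \<and> path_shift n X \<in> stay C"
    using * by (auto simp: first_block_def regen_def stay_def)
qed

section \<open>The law conditioned on staying in the cone\<close>

definition Q :: "(nat \<Rightarrow> int ^ 'd) measure" where
  "Q = uniform_measure path_law (stay C)"

lemma sets_Q [measurable_cong, simp]: "sets Q = sets path_space"
  and space_Q [simp]: "space Q = UNIV"
  by (simp_all add: Q_def)

lemma emeasure_stay_pos: "emeasure path_law (stay C) \<noteq> 0"
  using stay_pos by (simp add: path.emeasure_eq_measure)

sublocale Q: prob_space Q
  unfolding Q_def by (rule prob_space_uniform_measure) (use emeasure_stay_pos in auto)

lemma AE_Q_iff: "(AE X in Q. \<phi> X) \<longleftrightarrow> (AE X in path_law. X \<in> stay C \<longrightarrow> \<phi> X)"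
  unfolding Q_def using emeasure_stay_pos by (intro AE_uniform_measure) (auto simp: less_top[symmetric] zero_less_iff_neq_zero)

lemma AE_Q_good: "AE X in Q. good X \<and> X \<in> stay C"
  unfolding AE_Q_iff using AE_good by eventually_elim simp

lemma Q_prob: "F \<in> sets path_space \<Longrightarrow> Q.prob F = path.prob (F \<inter> stay C) / path.prob (stay C)"
  unfolding Q_def by (subst measure_uniform_measure) (use emeasure_stay_pos in \<open>auto simp: Int_commute\<close>)

text \<open>Splitting by the value of \<open>next_regen\<close> and factorizing at each record gives
  a joint mass \<open>\<kappa> A\<close> times that of \<open>F \<inter> stay C\<close>. Taking
  \<open>F = UNIV\<close> identifies the first factor as the law of the gap under
  \<open>Q\<close>.\<close>

lemma Q_gap_renew:
  assumes F: "F \<in> sets path_space"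
  shows "Q.prob (gap -` A \<inter> renew -` F) = Q.prob (gap -` A) * Q.prob F"
proof -
  have gap_sets: "gap -` A \<in> sets path_space" for A
    using measurable_sets[OF measurable_gap, of A] by simp
  have renew_sets: "renew -` F \<in> sets path_space" if "F \<in> sets path_space" for F
    using measurable_sets[OF measurable_renew that] by simp
  define \<kappa> where "\<kappa> A = (\<Sum>n. emeasure path_law (first_block n \<inter> {X. X n \<in> A}))" for A
  have joint: "emeasure path_law (gap -` A \<inter> renew -` F \<inter> stay C) = \<kappa> A * emeasure path_law (F \<inter> stay C)"
    if F: "F \<in> sets path_space" for A F
  proof -
    define D where "D n = first_block n \<inter> {X. X n \<in> A} \<inter> path_shift n -` (F \<inter> stay C)" for n
    have det: "determined n (first_block n \<inter> {X. X n \<in> A})" for n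
      by (intro determined_Int determined_first_block) (simp add: determined_def)
    have D_sets: "D n \<in> sets path_space" for n
      unfolding D_def using path_shift_vimage_sets[of "F \<inter> stay C" n] determined_sets[OF det] F by (simp del: vimage_Int)
    \<comment> \<open>\<open>first_block_iff\<close> needs a path started at 0. This almost sure
      condition is inserted to identify and separate the pieces, and dropped again before
      factorizing.\<close>
    have "emeasure path_law (gap -` A \<inter> renew -` F \<inter> stay C) = emeasure path_law (\<Union>n. D n \<inter> {X. X 0 = 0})"
    proof (rule emeasure_eq_AE)
      show "AE X in path_law. X \<in> gap -` A \<inter> renew -` F \<inter> stay C \<longleftrightarrow> X \<in> (\<Union>n. D n \<inter> {X. X 0 = 0})"
        using AE_good
      proof eventually_elim
        case (elim X)
        then have "X 0 = 0" by (simp add: good_def)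
        then have "X \<in> D n \<longleftrightarrow> X \<in> stay C \<and> 0 < n \<and> regen n X \<and> next_regen X = n \<and> X n \<in> A \<and> path_shift n X \<in> F" for n
          using first_block_iff[of X n] by (auto simp: D_def)
        then show ?case
          using next_regen[OF elim] good_renew[OF elim] \<open>X 0 = 0\<close> by (auto simp: gap_def renew_def)
      qed
      have "{X :: nat \<Rightarrow> int ^ 'd. X 0 = 0} \<in> sets path_space"
        by (rule determined_sets[of 0]) (simp add: determined_def)
      then show "(\<Union>n. D n \<inter> {X. X 0 = 0}) \<in> sets path_law" using D_sets by auto
    qed (use gap_sets renew_sets[OF F] in auto)
    also have "\<dots> = (\<Sum>n. emeasure path_law (D n \<inter> {X. X 0 = 0}))"
    proof (rule suminf_emeasure[symmetric])
      have "{X :: nat \<Rightarrow> int ^ 'd. X 0 = 0} \<in> sets path_space"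
        by (rule determined_sets[of 0]) (simp add: determined_def)
      then show "range (\<lambda>n. D n \<inter> {X. X 0 = 0}) \<subseteq> sets path_law" using D_sets by auto
      show "disjoint_family (\<lambda>n. D n \<inter> {X. X 0 = 0})"
      proof -
        have "next_regen X = n" if "X \<in> D n \<inter> {X. X 0 = 0}" for n X
          using that first_block_iff[of X n] by (auto simp: D_def)
        then show ?thesis unfolding disjoint_family_on_def by blast
      qed
    qed
    also have "\<dots> = (\<Sum>n. emeasure path_law (D n))"
    proof (intro suminf_cong emeasure_eq_AE)
      show "AE X in path_law. X \<in> D n \<inter> {X. X 0 = 0} \<longleftrightarrow> X \<in> D n" for n
        using AE_good by eventually_elim (simp add: good_def)
      have "{X :: nat \<Rightarrow> int ^ 'd. X 0 = 0} \<in> sets path_space"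
        by (rule determined_sets[of 0]) (simp add: determined_def)
      then show "D n \<inter> {X. X 0 = 0} \<in> sets path_law" for n using D_sets by auto
    qed (use D_sets in auto)
    also have "\<dots> = (\<Sum>n. emeasure path_law (first_block n \<inter> {X. X n \<in> A}) * emeasure path_law (F \<inter> stay C))"
      unfolding D_def using emeasure_record_shift[OF det _ F]
      by (intro suminf_cong) (auto simp: first_block_def simp del: vimage_Int)
    also have "\<dots> = \<kappa> A * emeasure path_law (F \<inter> stay C)" by (simp add: \<kappa>_def)
    finally show ?thesis .
  qed
  define p where "p = path.prob (stay C)"
  have p: "p > 0" using stay_pos by (simp add: p_def)
  \<comment> \<open>Since \<open>p > 0\<close>, this identity also excludes an infinite value of
    \<open>\<kappa> B\<close>.\<close>
  have k: "\<kappa> B * ennreal p = ennreal (path.prob (gap -` B \<inter> stay C))" for B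
    using joint[of UNIV B] by (simp add: path.emeasure_eq_measure p_def)
  have k_fin: "\<kappa> B \<noteq> \<top>" for B
  proof
    assume "\<kappa> B = \<top>"
    then show False using k[of B] p by (simp add: ennreal_top_mult)
  qed
  define r where "r B = enn2real (\<kappa> B)" for B
  have kr: "\<kappa> B = ennreal (r B)" "r B \<ge> 0" for B using k_fin[of B] by (auto simp: r_def less_top)
  have joint': "path.prob (gap -` B \<inter> renew -` E \<inter> stay C) = r B * path.prob (E \<inter> stay C)"
    if "E \<in> sets path_space" for B E
    using joint[OF that, of B] kr by (simp add: path.emeasure_eq_measure ennreal_mult[symmetric])
  have "r UNIV = 1" using joint'[of UNIV UNIV] p by (simp add: p_def)
  have "Q.prob (gap -` A) = r A"
    using joint'[of UNIV A] gap_sets[of A] p by (simp add: Q_prob p_def)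
  then show ?thesis
    using joint'[OF F, of A] gap_sets[of A] renew_sets[OF F] F by (simp add: Q_prob)
qed

lemma distr_renew: "distr Q Q renew = Q"
proof (rule measure_eqI)
  fix F assume "F \<in> sets (distr Q Q renew)"
  then have F: "F \<in> sets path_space" by simp
  have "Q.prob (gap -` UNIV) = 1" using Q.prob_space by simp
  then have "Q.prob (renew -` F) = Q.prob F" using Q_gap_renew[OF F, of UNIV] by simp
  then show "emeasure (distr Q Q renew) F = emeasure Q F"
    using F by (subst emeasure_distr) (auto simp: Q.emeasure_eq_measure)
qed simp

lemma indep_gap_renew:
  fixes \<phi> :: "int ^ 'd \<Rightarrow> real" and \<psi> :: "(nat \<Rightarrow> int ^ 'd) \<Rightarrow> real"
  assumes \<psi> [measurable]: "\<psi> \<in> borel_measurable path_space"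
  shows "Q.indep_var borel (\<lambda>X. \<phi> (gap X)) borel (\<lambda>X. \<psi> (renew X))"
proof (subst Q.indep_var_distribution_eq, intro conjI)
  have meas [measurable]: "(\<lambda>X. \<phi> (gap X)) \<in> borel_measurable path_space"
    "(\<lambda>X. \<psi> (renew X)) \<in> borel_measurable path_space"
    by measurable
  show "distr Q borel (\<lambda>X. \<phi> (gap X)) \<Otimes>\<^sub>M distr Q borel (\<lambda>X. \<psi> (renew X)) =
      distr Q (borel \<Otimes>\<^sub>M borel) (\<lambda>X. (\<phi> (gap X), \<psi> (renew X)))"
  proof (rule pair_measure_eqI)
    show "sigma_finite_measure (distr Q borel (\<lambda>X. \<phi> (gap X)))"
      "sigma_finite_measure (distr Q borel (\<lambda>X. \<psi> (renew X)))"
      by (intro prob_space_imp_sigma_finite Q.prob_space_distr; measurable)+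
    fix A B :: "real set"
    assume "A \<in> sets (distr Q borel (\<lambda>X. \<phi> (gap X)))" "B \<in> sets (distr Q borel (\<lambda>X. \<psi> (renew X)))"
    then have AB: "A \<in> sets borel" "B \<in> sets borel" by auto
    have B: "\<psi> -` B \<in> sets path_space"
      using measurable_sets[OF \<psi> AB(2)] by simp
    have "emeasure (distr Q (borel \<Otimes>\<^sub>M borel) (\<lambda>X. (\<phi> (gap X), \<psi> (renew X)))) (A \<times> B) =
        emeasure Q (gap -` (\<phi> -` A) \<inter> renew -` (\<psi> -` B))"
      using AB by (subst emeasure_distr) (auto intro!: arg_cong2[where f=emeasure])
    moreover have "emeasure (distr Q borel (\<lambda>X. \<phi> (gap X))) A = emeasure Q (gap -` (\<phi> -` A))"
      using AB by (subst emeasure_distr) (auto intro!: arg_cong2[where f=emeasure])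
    moreover have "emeasure (distr Q borel (\<lambda>X. \<psi> (renew X))) B = emeasure (distr Q Q renew) (\<psi> -` B)"
      using AB B by (simp add: emeasure_distr vimage_def)
    ultimately show "emeasure (distr Q borel (\<lambda>X. \<phi> (gap X))) A * emeasure (distr Q borel (\<lambda>X. \<psi> (renew X))) B =
        emeasure (distr Q (borel \<Otimes>\<^sub>M borel) (\<lambda>X. (\<phi> (gap X), \<psi> (renew X)))) (A \<times> B)"
      unfolding distr_renew using Q_gap_renew[OF B, of "\<phi> -` A"]
      by (simp add: Q.emeasure_eq_measure ennreal_mult[symmetric])
  qed simp
qed measurable

lemma decoupled_shift_gap:
  fixes \<phi> :: "int ^ 'd \<Rightarrow> real"
  assumes int: "integrable Q (\<lambda>X. \<phi> (gap X))"
  shows "decoupled_shift Q renew (\<lambda>X. \<phi> (gap X))"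
proof
  fix E assume E: "E \<in> sets Q"
  have "Q.indep_var borel (\<lambda>X. \<phi> (gap X)) borel (\<lambda>X. indicator E (renew X) :: real)"
    by (rule indep_gap_renew) (use E in auto)
  moreover have ind: "integrable Q (\<lambda>X. indicator E (renew X) :: real)"
    using E by (intro Q.integrable_const_bound[where B=1]) auto
  ultimately have "(\<integral>X. \<phi> (gap X) * indicator E (renew X) \<partial>Q) =
      (\<integral>X. \<phi> (gap X) \<partial>Q) * (\<integral>X. indicator E (renew X) \<partial>Q)"
    using int by (intro Q.indep_var_lebesgue_integral)
  also have "(\<integral>X. indicator E (renew X) \<partial>Q) = (\<integral>X. indicator E X \<partial>distr Q Q renew :: real)"
    using E by (intro integral_distr[symmetric]) auto
  finally show "(\<integral>X. \<phi> (gap X) * indicator E (renew X) \<partial>Q) = (\<integral>X. \<phi> (gap X) \<partial>Q) * Q.prob E"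
    using E by (simp add: distr_renew)
qed (use int distr_renew in \<open>auto\<close>)

end

section \<open>Integrability of the gaps\<close>

lemma unit_step_inner_le:
  fixes l :: "real ^ 'd::finite"
  assumes "y - x \<in> unit_steps"
  shows "real_vec y \<bullet> l \<le> real_vec x \<bullet> l + norm l"
proof -
  have "norm (real_vec (y - x)) = 1" using assms by (simp add: unit_steps_def)
  then have "real_vec (y - x) \<bullet> l \<le> norm l"
    using norm_cauchy_schwarz[of "real_vec (y - x)" l] by simp
  then show ?thesis by (simp add: real_vec_diff inner_diff_left)
qed

context cone_renewal
begin

text \<open>Integral form of \<open>emeasure_record_shift\<close>, for averaging truncated gaps over
  the continuation.\<close>

lemma nn_integral_record_shift:
  assumes G: "determined n G" "G \<subseteq> record_at height n" and f: "f \<in> borel_measurable path_space"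
  shows "(\<integral>\<^sup>+ X. indicator G X * (indicator (stay C) (path_shift n X) * f (path_shift n X)) \<partial>path_law) =
    emeasure path_law G * (\<integral>\<^sup>+ X. indicator (stay C) X * f X \<partial>path_law)"
proof -
  have Gs: "G \<in> sets path_space" by (rule determined_sets[OF G(1)])
  note [measurable] = Gs f
  have "distr (density path_law (indicator (G \<inter> path_shift n -` stay C))) path_space (path_shift n) =
      scale_measure (emeasure path_law G) (density path_law (indicator (stay C)))"
  proof (rule measure_eqI)
    fix F assume "F \<in> sets (distr (density path_law (indicator (G \<inter> path_shift n -` stay C))) path_space (path_shift n))"
    then have F: "F \<in> sets path_space" by simp
    have S: "path_shift n -` stay C \<in> sets path_space" "path_shift n -` F \<in> sets path_space"
      by (auto intro!: path_shift_vimage_sets F)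
    have "emeasure (distr (density path_law (indicator (G \<inter> path_shift n -` stay C))) path_space (path_shift n)) F
        = emeasure path_law (G \<inter> path_shift n -` (F \<inter> stay C))"
      using F Gs S by (subst emeasure_distr) (auto simp: emeasure_restricted intro!: arg_cong2[where f=emeasure])
    then show "emeasure (distr (density path_law (indicator (G \<inter> path_shift n -` stay C))) path_space (path_shift n)) F
        = emeasure (scale_measure (emeasure path_law G) (density path_law (indicator (stay C)))) F"
      using emeasure_record_shift[OF G F] F by (simp add: emeasure_restricted Int_commute)
  qed simp
  then have "(\<integral>\<^sup>+ X. f X \<partial>distr (density path_law (indicator (G \<inter> path_shift n -` stay C))) path_space (path_shift n)) =
    (\<integral>\<^sup>+ X. f X \<partial>scale_measure (emeasure path_law G) (density path_law (indicator (stay C))))" by simp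
  moreover have "G \<inter> path_shift n -` stay C \<in> sets path_law"
    using Gs path_shift_vimage_sets[of "stay C" n] by simp
  ultimately have "(\<integral>\<^sup>+ X. indicator (G \<inter> path_shift n -` stay C) X * f (path_shift n X) \<partial>path_law) =
      emeasure path_law G * (\<integral>\<^sup>+ X. indicator (stay C) X * f X \<partial>path_law)"
    by (simp add: nn_integral_distr nn_integral_density nn_integral_scale_measure)
  then show ?thesis
    by (simp add: indicator_inter_arith indicator_vimage mult.assoc)
qed

lemma height_gap_shift:
  assumes "regen n X"
  shows "height (gap (path_shift n X)) = height (X (n + next_regen (path_shift n X))) - height (X n)"
  by (simp add: gap_def path_shift_def height_diff)

text \<open>Gaps between successive regenerations telescope up to the last regeneration at height at
  most \<open>s\<close>. Only the gap that starts there can pass \<open>s\<close>, and truncation at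
  \<open>b\<close> bounds it.\<close>

lemma sum_truncated_gaps_le:
  assumes X: "good X" and s: "0 \<le> s" "0 \<le> b"
  shows "(\<Sum>n<N. if regen n X \<and> height (X n) \<le> s then min b (height (gap (path_shift n X))) else 0) \<le> s + b"
proof -
  define r where "r N = (LEAST m. N \<le> m \<and> regen m X)" for N
  define S where "S N = (\<Sum>n<N. if regen n X \<and> height (X n) \<le> s then min b (height (gap (path_shift n X))) else 0)" for N
  have r: "N \<le> r N" "regen (r N) X" for N
  proof -
    have "\<exists>m. N \<le> m \<and> regen m X" using X by (auto simp: good_def)
    then have "N \<le> r N \<and> regen (r N) X" unfolding r_def by (rule LeastI_ex)
    then show "N \<le> r N" "regen (r N) X" by auto
  qed
  have r_le: "r N \<le> m" if "N \<le> m" "regen m X" for N m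
    unfolding r_def using that by (intro Least_le) simp
  \<comment> \<open>The first bound feeds the second: if \<open>N\<close> is a regeneration at
    height at most \<open>s\<close>, then \<open>r N = N\<close>, so the sum so far is at most
    \<open>s\<close> and the new summand adds at most \<open>b\<close>.\<close>
  have "S N \<le> height (X (r N)) \<and> S N \<le> s + b" for N
  proof (induction N)
    case 0
    have "height (X 0) \<le> height (X (r 0))"
      using regen_height_less[OF r(2)[of 0], of 0] by (cases "r 0 = 0") auto
    then show ?case using X s by (simp add: S_def good_def)
  next
    case (Suc N)
    show ?case
    proof (cases "regen N X")
      case True
      then have rN: "r N = N" using r_le[of N N] r(1)[of N] by simp
      let ?m = "N + next_regen (path_shift N X)"
      note good' = good_path_shift(1)[OF X True]
      have m: "regen ?m X" "Suc N \<le> ?m"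
        using next_regen[OF good'] regen_path_shift[OF True] by auto
      have "next_regen (path_shift N X) \<le> r (Suc N) - N"
        using r[of "Suc N"] regen_path_shift[OF True, of "r (Suc N) - N"] by (intro next_regen_le) auto
      then have "?m \<le> r (Suc N)" using r(1)[of "Suc N"] by linarith
      then have rS: "r (Suc N) = ?m" using r_le[OF m(2,1)] by simp
      have g: "height (gap (path_shift N X)) = height (X (r (Suc N))) - height (X N)"
        using height_gap_shift[OF True] by (simp add: rS)
      have inc: "height (X N) \<le> height (X (r (Suc N)))"
        using regen_height_le[OF True, of "r (Suc N)"] r(1)[of "Suc N"] by simp
      show ?thesis
        using Suc.IH True inc by (auto simp: S_def rN g)
    next
      case False
      then have "N \<noteq> r N" using r(2)[of N] by metis
      then have "Suc N \<le> r N" using r(1)[of N] by simp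
      then have "r (Suc N) = r N"
        using r_le[of "Suc N" "r N"] r_le[of N "r (Suc N)"] r[of N] r[of "Suc N"] by simp
      then show ?thesis using Suc.IH False by (simp add: S_def)
    qed
  qed
  then show ?thesis by (simp add: S_def)
qed

text \<open>Every record raises the running maximum by at most \<open>norm l\<close>.\<close>

lemma card_records_ge:
  assumes X: "X 0 = 0" "\<And>n. X (Suc n) - X n \<in> unit_steps" "transient_in l X" and s: "0 \<le> s"
  shows "\<exists>N. s \<le> norm l * (\<Sum>n<N. indicator (record_at height n \<inter> {X. height (X n) \<le> s}) X)"
proof -
  define K where "K N = (\<Sum>n<N. indicator (record_at height n) X :: real)" for N
  have K_mono: "K N \<le> K (Suc N)" for N by (simp add: K_def)
  have step: "height (X (Suc n)) \<le> height (X n) + norm l" for n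
    using unit_step_inner_le[OF X(2)[of n]] by (simp add: height_def)
  \<comment> \<open>\<open>K (Suc N)\<close> counts the records up to time \<open>N\<close>. Time 0
    is a vacuous record and accounts for the extra \<open>norm l\<close>.\<close>
  have max: "height (X k) + norm l \<le> norm l * K (Suc N)" if "k \<le> N" for k N
    using that
  proof (induction N arbitrary: k)
    case 0
    then show ?case using X(1) by (simp add: K_def record_at_def)
  next
    case (Suc N)
    show ?case
    proof (cases "k \<le> N")
      case True
      then show ?thesis using Suc.IH[of k] K_mono[of "Suc N"]
        by (meson mult_left_mono norm_ge_zero order_trans)
    next
      case False
      then have k: "k = Suc N" using Suc.prems by simp
      show ?thesis
      proof (cases "X \<in> record_at height (Suc N)")
        case True
        then have "K (Suc (Suc N)) = K (Suc N) + 1" by (simp add: K_def)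
        then show ?thesis using Suc.IH[of N] step[of N] k by (simp add: algebra_simps)
      next
        case False
        then obtain j where "j \<le> N" "height (X (Suc N)) \<le> height (X j)"
          by (auto simp: record_at_def not_less less_Suc_eq_le)
        then show ?thesis using Suc.IH[of j] k K_mono[of "Suc N"]
          by (smt (verit, best) mult_left_mono norm_ge_zero)
      qed
    qed
  qed
  have ex: "\<exists>n. height (X n) > s"
  proof -
    have "\<forall>\<^sub>F n in sequentially. s < height (X n)"
      using X(3) unfolding transient_in_def height_def filterlim_at_top_dense by blast
    then show ?thesis using eventually_happens' trivial_limit_sequentially by blast
  qed
  \<comment> \<open>Before the first passage above \<open>s\<close> every record has height at most
    \<open>s\<close>, so the restricted count is the full one; the position just before the passage
    misses \<open>s\<close> by at most \<open>norm l\<close>.\<close>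
  define N where "N = (LEAST n. height (X n) > s)"
  have N: "height (X N) > s" "\<And>n. n < N \<Longrightarrow> height (X n) \<le> s"
  proof -
    show "height (X N) > s" unfolding N_def using LeastI_ex[where P="\<lambda>n. height (X n) > s"] ex by simp
    show "height (X n) \<le> s" if "n < N" for n
      using not_less_Least[OF that[unfolded N_def]] by simp
  qed
  then have "N \<noteq> 0" using X(1) s by (auto intro!: Nat.gr0I)
  then obtain M where M: "N = Suc M" by (cases N) auto
  have "s \<le> height (X M) + norm l" using N(1) step[of M] M by simp
  also have "\<dots> \<le> norm l * K N" using max[of M M] M by simp
  also have "K N = (\<Sum>n<N. indicator (record_at height n \<inter> {X. height (X n) \<le> s}) X)"
    unfolding K_def using N(2) by (intro sum.cong) (auto simp: indicator_def)
  finally show ?thesis by blast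
qed

lemma l_nonzero: "l \<noteq> 0"
proof
  assume "l = 0"
  have "AE X in path_law. False"
    using transient
  proof eventually_elim
    case (elim X)
    then have "filterlim (\<lambda>n. 0 :: real) at_top sequentially" by (simp add: transient_in_def \<open>l = 0\<close>)
    then have "eventually (\<lambda>n. (1 :: real) \<le> 0) sequentially" unfolding filterlim_at_top by blast
    then show False by simp
  qed
  then show False by (simp add: path.AE_False)
qed

text \<open>The expected number of records at height at most \<open>b\<close> is at least
  \<open>b / norm l\<close>, each contributes \<open>?J\<close> on average, and almost surely the
  contributions add up to at most \<open>2 * b\<close>. Because the level equals the truncation,
  \<open>b\<close> cancels and the bound is uniform.\<close>

lemma truncated_gap_bound:
  assumes b: "0 < b"
  shows "(\<integral>\<^sup>+ X. indicator (stay C) X * ennreal (min b (height (gap X))) \<partial>path_law) \<le> ennreal (2 * norm l)"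
    (is "?J \<le> _")
proof -
  define G where "G n = record_at height n \<inter> {X. height (X n) \<le> b}" for n
  have G: "determined n (G n)" for n
    unfolding G_def by (intro determined_Int determined_record_at) (simp add: determined_def)
  note [measurable] = determined_sets[OF G]
  define \<psi> where "\<psi> X = indicator (stay C) X * ennreal (min b (height (gap X)))" for X
  have [measurable]: "\<psi> \<in> borel_measurable path_space" unfolding \<psi>_def[abs_def] by measurable
  have nl: "norm l > 0" using l_nonzero by simp
  have "ennreal b * ?J \<le> ennreal (norm l) * (\<integral>\<^sup>+ X. (\<Sum>n. indicator (G n) X) \<partial>path_law) * ?J"
  proof (rule mult_right_mono)
    have "ennreal b = (\<integral>\<^sup>+ X. ennreal b \<partial>path_law)" using path.emeasure_space_1 by simp
    also have "\<dots> \<le> (\<integral>\<^sup>+ X. ennreal (norm l) * (\<Sum>n. indicator (G n) X) \<partial>path_law)"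
    proof (rule nn_integral_mono_AE)
      show "AE X in path_law. ennreal b \<le> ennreal (norm l) * (\<Sum>n. indicator (G n) X)"
        using AE_path_law_steps transient
      proof eventually_elim
        case (elim X)
        then obtain N where N: "b \<le> norm l * (\<Sum>n<N. indicator (G n) X)"
          unfolding G_def using card_records_ge[of X b] b by auto
        then have "ennreal b \<le> ennreal (norm l * (\<Sum>n<N. indicator (G n) X))"
          by (rule ennreal_leI)
        also have "\<dots> = ennreal (norm l) * (\<Sum>n<N. indicator (G n) X)"
          by (simp add: ennreal_mult sum_nonneg flip: sum_ennreal)
            (simp add: ennreal_indicator)
        also have "\<dots> \<le> ennreal (norm l) * (\<Sum>n. indicator (G n) X)"
          by (intro mult_left_mono sum_le_suminf) auto
        finally show ?case .
      qed
    qed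
    also have "\<dots> = ennreal (norm l) * (\<integral>\<^sup>+ X. (\<Sum>n. indicator (G n) X) \<partial>path_law)"
      by (rule nn_integral_cmult) measurable
    finally show "ennreal b \<le> ennreal (norm l) * (\<integral>\<^sup>+ X. (\<Sum>n. indicator (G n) X) \<partial>path_law)" .
  qed simp
  also have "\<dots> = ennreal (norm l) * ((\<Sum>n. emeasure path_law (G n)) * ?J)"
    by (subst nn_integral_suminf) (auto simp: mult.assoc)
  also have "(\<Sum>n. emeasure path_law (G n)) * ?J = (\<Sum>n. emeasure path_law (G n) * ?J)" by simp
  \<comment> \<open>The indicator of \<open>stay C\<close> inside \<open>\<psi>\<close> keeps just
    those records that are regenerations; factorization makes the average contribution of every
    record the same.\<close>
  also have "\<dots> = (\<Sum>n. \<integral>\<^sup>+ X. indicator (G n) X * \<psi> (path_shift n X) \<partial>path_law)"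
    unfolding \<psi>_def by (intro suminf_cong nn_integral_record_shift[symmetric] G) (auto simp: G_def)
  also have "\<dots> = (\<integral>\<^sup>+ X. (\<Sum>n. indicator (G n) X * \<psi> (path_shift n X)) \<partial>path_law)"
    by (rule nn_integral_suminf[symmetric]) measurable
  also have "\<dots> \<le> (\<integral>\<^sup>+ X. ennreal (b + b) \<partial>path_law)"
  proof (rule nn_integral_mono_AE)
    show "AE X in path_law. (\<Sum>n. indicator (G n) X * \<psi> (path_shift n X)) \<le> ennreal (b + b)"
      using AE_good
    proof eventually_elim
      case (elim X)
      have "(\<Sum>n<N. indicator (G n) X * \<psi> (path_shift n X)) \<le> ennreal (b + b)" for N
      proof -
        have "indicator (G n) X * \<psi> (path_shift n X) =
          ennreal (if regen n X \<and> height (X n) \<le> b then min b (height (gap (path_shift n X))) else 0)" for n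
          by (auto simp: G_def \<psi>_def regen_def indicator_def)
        moreover have "0 \<le> (if regen n X \<and> height (X n) \<le> b then min b (height (gap (path_shift n X))) else 0)" for n
          using regen_height_le[of n X "n + next_regen (path_shift n X)"] height_gap_shift[of n X] b by auto
        ultimately show ?thesis
          using sum_truncated_gaps_le[OF elim, of b b N] b by (simp add: sum_ennreal ennreal_leI)
      qed
      then show ?case by (intro suminf_le_const) auto
    qed
  qed
  also have "\<dots> = ennreal (b + b)" using path.emeasure_space_1 by simp
  finally have "ennreal b * ?J \<le> ennreal (norm l) * ennreal (b + b)" by (simp add: mult_left_mono)
  also have "\<dots> = ennreal b * ennreal (2 * norm l)"
    using b by (simp add: ennreal_mult[symmetric] algebra_simps)
  finally show ?thesis
    using b by (simp add: ennreal_mult_le_mult_iff)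
qed

text \<open>The truncated bound does not involve the truncation level, so monotone convergence
  removes it.\<close>

lemma gap_bound: "(\<integral>\<^sup>+ X. indicator (stay C) X * ennreal (height (gap X)) \<partial>path_law) \<le> ennreal (2 * norm l)"
proof -
  define f where "f n X = indicator (stay C) X * ennreal (min (real (Suc n)) (height (gap X)))" for n X
  have [measurable]: "f n \<in> borel_measurable path_space" for n
    unfolding f_def[abs_def] by measurable
  have inc: "incseq f"
    unfolding f_def by (auto simp: incseq_def le_fun_def intro!: mult_left_mono ennreal_leI)
  have "indicator (stay C) X * ennreal (height (gap X)) \<le> (SUP n. f n X)" for X
  proof -
    obtain n :: nat where "height (gap X) \<le> real n" using real_arch_simple by blast
    then have "indicator (stay C) X * ennreal (height (gap X)) = f n X" by (simp add: f_def min_def)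
    then show ?thesis by (metis SUP_upper UNIV_I)
  qed
  then have "(\<integral>\<^sup>+ X. indicator (stay C) X * ennreal (height (gap X)) \<partial>path_law) \<le> (\<integral>\<^sup>+ X. (SUP n. f n X) \<partial>path_law)"
    by (intro nn_integral_mono)
  also have "\<dots> = (SUP n. integral\<^sup>N path_law (f n))"
    using inc by (intro nn_integral_monotone_convergence_SUP) auto
  also have "\<dots> \<le> ennreal (2 * norm l)"
    unfolding f_def using truncated_gap_bound by (intro SUP_least) simp
  finally show ?thesis .
qed

lemma integrable_height_gap: "integrable Q (\<lambda>X. height (gap X))"
proof (rule integrableI_nonneg)
  show "AE X in Q. 0 \<le> height (gap X)"
    using AE_Q_good
  proof eventually_elim
    case (elim X)
    then show ?case using height_C by (auto simp: gap_def stay_def)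
  qed
  have "(\<integral>\<^sup>+ X. ennreal (height (gap X)) \<partial>Q) =
      (\<integral>\<^sup>+ X. ennreal (height (gap X)) * indicator (stay C) X \<partial>path_law) / emeasure path_law (stay C)"
    unfolding Q_def by (rule nn_integral_uniform_measure) auto
  also have "\<dots> \<le> ennreal (2 * norm l) / emeasure path_law (stay C)"
    using gap_bound by (intro divide_right_mono_ennreal) (simp add: mult.commute)
  also have "\<dots> < \<infinity>"
    using emeasure_stay_pos by (simp add: ennreal_divide_eq_top_iff less_top[symmetric])
  finally show "(\<integral>\<^sup>+ X. ennreal (height (gap X)) \<partial>Q) < \<infinity>" .
qed measurable

end

section \<open>The asymptotic direction\<close>

text \<open>\<open>\<kappa> n\<close> counts the renewals up to \<open>n\<close>. Inside a block the
  displacement is at most \<open>c\<close> times the increment along \<open>l\<close> over the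
  block, and this increment divided by the count tends to 0, as a difference of sequences with the
  common limit \<open>v\<close>.\<close>

lemma renewal_interpolation:
  fixes x :: "nat \<Rightarrow> 'a::real_inner" and t :: "nat \<Rightarrow> nat"
  assumes t: "strict_mono t" "t 0 = 0"
    and lim: "(\<lambda>k. x (t k) /\<^sub>R real k) \<longlonglongrightarrow> v"
    and block: "\<And>k n. t k \<le> n \<Longrightarrow> n \<le> t (Suc k) \<Longrightarrow> norm (x n - x (t k)) \<le> c * ((x (t (Suc k)) - x (t k)) \<bullet> l)"
  shows "\<exists>\<kappa>::nat \<Rightarrow> real. filterlim \<kappa> at_top sequentially \<and> (\<lambda>n. x n /\<^sub>R \<kappa> n) \<longlonglongrightarrow> v"
proof -
  define k where "k n = Max {j. t j \<le> n}" for n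
  have fin: "finite {j. t j \<le> n}" for n
    by (rule finite_subset[of _ "{..n}"]) (use strict_mono_imp_increasing[OF t(1)] in \<open>auto intro: order_trans\<close>)
  have "k n \<in> {j. t j \<le> n}" for n
    unfolding k_def by (rule Max_in) (use fin t(2) in \<open>auto intro: exI[of _ 0]\<close>)
  then have k1: "t (k n) \<le> n" for n by simp
  have k_ge: "m \<le> k n" if "t m \<le> n" for m n
    unfolding k_def using fin that by (intro Max_ge) auto
  have k2: "n < t (Suc (k n))" for n
    using k_ge[of "Suc (k n)" n] by (metis Suc_n_not_le_n not_less)
  have k_lim: "filterlim k sequentially sequentially"
    unfolding filterlim_at_top eventually_sequentially using k_ge by blast
  have inv: "(\<lambda>k. inverse (real k)) \<longlonglongrightarrow> 0" by (rule lim_inverse_n)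
  \<comment> \<open>Replacing the divisor \<open>Suc k\<close> by \<open>k\<close> costs the factor
    \<open>1 + 1 / k\<close>.\<close>
  have "(\<lambda>k. x (t (Suc k)) /\<^sub>R real (Suc k) + inverse (real k) *\<^sub>R (x (t (Suc k)) /\<^sub>R real (Suc k))) \<longlonglongrightarrow> v + 0 *\<^sub>R v"
    using LIMSEQ_Suc[OF lim] inv by (intro tendsto_intros)
  moreover have "eventually (\<lambda>k. x (t (Suc k)) /\<^sub>R real (Suc k) + inverse (real k) *\<^sub>R (x (t (Suc k)) /\<^sub>R real (Suc k))
      = x (t (Suc k)) /\<^sub>R real k) sequentially"
    using eventually_gt_at_top[of 0]
  proof eventually_elim
    case (elim k)
    have "inverse (real (Suc k)) + inverse (real k) * inverse (real (Suc k)) = inverse (real k)"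
    proof -
      have "1 + inverse (real k) = real (Suc k) * inverse (real k)" using elim by (simp add: field_simps)
      then have "inverse (real (Suc k)) * (1 + inverse (real k)) = inverse (real k)" by simp
      then show ?thesis by (simp only: distrib_left mult_1_right mult.commute)
    qed
    then show ?case by (simp flip: scaleR_add_left)
  qed
  ultimately have lim': "(\<lambda>k. x (t (Suc k)) /\<^sub>R real k) \<longlonglongrightarrow> v"
    using Lim_transform_eventually by fastforce
  have "(\<lambda>k. c * ((x (t (Suc k)) /\<^sub>R real k - x (t k) /\<^sub>R real k) \<bullet> l)) \<longlonglongrightarrow> c * ((v - v) \<bullet> l)"
    by (intro tendsto_intros lim lim')
  then have G: "(\<lambda>n. c * ((x (t (Suc (k n))) /\<^sub>R real (k n) - x (t (k n)) /\<^sub>R real (k n)) \<bullet> l)) \<longlonglongrightarrow> 0"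
    by (auto dest: filterlim_compose[OF _ k_lim])
  have B: "norm (x n /\<^sub>R real (k n) - x (t (k n)) /\<^sub>R real (k n))
      \<le> c * ((x (t (Suc (k n))) /\<^sub>R real (k n) - x (t (k n)) /\<^sub>R real (k n)) \<bullet> l)" for n
  proof -
    have "norm (x n - x (t (k n))) / real (k n) \<le> c * ((x (t (Suc (k n))) - x (t (k n))) \<bullet> l) / real (k n)"
      using block[OF k1 less_imp_le[OF k2], of n] by (intro divide_right_mono) auto
    then show ?thesis
      by (simp add: scaleR_diff_right[symmetric] divide_inverse mult.commute mult.left_commute)
  qed
  have "(\<lambda>n. x n /\<^sub>R real (k n) - x (t (k n)) /\<^sub>R real (k n)) \<longlonglongrightarrow> 0"
    by (rule Lim_null_comparison[OF eventuallyI[OF B] G])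
  moreover have "(\<lambda>n. x (t (k n)) /\<^sub>R real (k n)) \<longlonglongrightarrow> v"
    using filterlim_compose[OF lim k_lim] .
  ultimately have "(\<lambda>n. x n /\<^sub>R real (k n) - x (t (k n)) /\<^sub>R real (k n) + x (t (k n)) /\<^sub>R real (k n)) \<longlonglongrightarrow> 0 + v"
    by (rule tendsto_add)
  then show ?thesis
    using filterlim_compose[OF filterlim_real_sequentially k_lim]
    by (intro exI[of _ "\<lambda>n. real (k n)"]) simp
qed

context cone_renewal
begin

lemma integrable_gap: "integrable Q (\<lambda>X. real_vec (gap X) $ i)"
proof (rule Bochner_Integration.integrable_bound)
  show "integrable Q (\<lambda>X. c * height (gap X))" using integrable_height_gap by simp
  show "AE X in Q. norm (real_vec (gap X) $ i) \<le> norm (c * height (gap X))"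
    using AE_Q_good
  proof eventually_elim
    case (elim X)
    then have "gap X \<in> C" by (auto simp: gap_def stay_def)
    then have "\<bar>real_vec (gap X) $ i\<bar> \<le> c * height (gap X)"
      using norm_C[of "gap X"] component_le_norm_cart[of "real_vec (gap X)" i] by (simp add: height_def)
    then show ?case by simp
  qed
qed measurable

definition drift :: "real ^ 'd" where
  "drift = (\<chi> i. \<integral>X. real_vec (gap X) $ i \<partial>Q)"

text \<open>A zero mean gap would have zero mean height, yet each regeneration is strictly higher
  than the one before.\<close>

lemma drift_nonzero: "drift \<noteq> 0"
proof
  assume "drift = 0"
  then have "(\<integral>X. real_vec (gap X) $ i \<partial>Q) = 0" for i by (simp add: drift_def vec_eq_iff)
  then have "(\<integral>X. height (gap X) \<partial>Q) = 0"
    unfolding height_def inner_vec_def using integrable_gap by simp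
  moreover have pos: "AE X in Q. 0 < height (gap X)"
    using AE_Q_good
  proof eventually_elim
    case (elim X)
    then show ?case
      using next_regen[of X] regen_height_less[of "next_regen X" X 0] by (simp add: gap_def good_def)
  qed
  moreover have "AE X in Q. 0 \<le> height (gap X)" using pos by eventually_elim simp
  ultimately have "AE X in Q. height (gap X) = 0"
    using integral_nonneg_eq_0_iff_AE[OF integrable_height_gap] by blast
  with pos have "AE X in Q. False" by eventually_elim simp
  then show False by (simp add: Q.AE_False)
qed

text \<open>Staying in \<open>C\<close> makes time 0 a regeneration. Iterating \<open>renew\<close>
  then means shifting the one path \<open>X\<close> at its successive regeneration times, so gaps
  are increments and their sums telescope.\<close>

lemma renewal_times:
  assumes "good X" "X \<in> stay C"
  obtains t where "strict_mono t" "t 0 = 0" "\<And>k. regen (t k) X"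
    "\<And>k. gap ((renew ^^ k) X) = X (t (Suc k)) - X (t k)"
proof -
  define t where "t = rec_nat 0 (\<lambda>k m. m + next_regen ((renew ^^ k) X))"
  have t: "t 0 = 0" "t (Suc k) = t k + next_regen ((renew ^^ k) X)" for k by (simp_all add: t_def)
  have renew_k: "regen (t k) X \<and> (renew ^^ k) X = path_shift (t k) X" for k
  proof (induction k)
    case 0
    then show ?case using assms by (simp add: t regen_0 path_shift_0 good_def)
  next
    case (Suc k)
    have g: "good ((renew ^^ k) X)" using good_path_shift[OF assms(1)] Suc.IH by metis
    have "regen (t (Suc k)) X"
      using next_regen(2)[OF g] regen_path_shift[of "t k" X] Suc.IH by (simp add: t)
    moreover have "(renew ^^ Suc k) X = path_shift (next_regen ((renew ^^ k) X)) ((renew ^^ k) X)"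
      by (simp only: funpow.simps o_def renew_def[of "(renew ^^ k) X"])
    then have "(renew ^^ Suc k) X = path_shift (t k + next_regen ((renew ^^ k) X)) X"
      using Suc.IH by (metis path_shift_path_shift)
    ultimately show ?case by (simp add: t)
  qed
  have g: "good ((renew ^^ k) X)" for k using good_path_shift[OF assms(1)] renew_k by metis
  show thesis
  proof (rule that[of t])
    show "strict_mono t" using next_regen(1)[OF g] by (auto simp: strict_mono_Suc_iff t)
    show "gap ((renew ^^ k) X) = X (t (Suc k)) - X (t k)" for k
      using renew_k[of k] by (simp add: gap_def t path_shift_def)
  qed (use renew_k t in auto)
qed

text \<open>The normalization is left open so that the property can be carried through a shift by an
  arbitrary regeneration time; a nonzero \<open>v\<close> still determines the direction.\<close>

definition scales_to :: "real ^ 'd \<Rightarrow> (nat \<Rightarrow> int ^ 'd) \<Rightarrow> bool" where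
  "scales_to v X \<longleftrightarrow> (\<exists>\<kappa>. filterlim \<kappa> at_top sequentially \<and> (\<lambda>n. real_vec (X n) /\<^sub>R \<kappa> n) \<longlonglongrightarrow> v)"

text \<open>The averages of the gaps converge coordinate by coordinate; the cone inequality is the
  block estimate that fills in the times between regenerations.\<close>

lemma AE_Q_scales_to: "AE X in Q. scales_to drift X"
proof -
  have "AE X in Q. (\<lambda>k. (\<Sum>j<k. real_vec (gap ((renew ^^ j) X)) $ i) / real k) \<longlonglongrightarrow> drift $ i" for i
  proof -
    interpret decoupled_shift Q renew "\<lambda>X. real_vec (gap X) $ i"
      by (rule decoupled_shift_gap[where \<phi>="\<lambda>x. real_vec x $ i"]) (rule integrable_gap)
    show ?thesis using AE_birkhoff_average_tendsto by (simp add: birkhoff_def drift_def)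
  qed
  then have "AE X in Q. \<forall>i. (\<lambda>k. (\<Sum>j<k. real_vec (gap ((renew ^^ j) X)) $ i) / real k) \<longlonglongrightarrow> drift $ i"
    by (simp add: AE_all_countable)
  with AE_Q_good show ?thesis
  proof eventually_elim
    case (elim X)
    then obtain t where t: "strict_mono t" "t 0 = 0" "\<And>k. regen (t k) X"
        "\<And>k. gap ((renew ^^ k) X) = X (t (Suc k)) - X (t k)"
      using renewal_times by blast
    have sum: "(\<Sum>j<k. real_vec (gap ((renew ^^ j) X)) $ i) = real_vec (X (t k)) $ i" for k i
    proof -
      have "(\<Sum>j<k. real_vec (gap ((renew ^^ j) X)) $ i)
          = (\<Sum>j<k. real_vec (X (t (Suc j))) $ i - real_vec (X (t j)) $ i)"
        by (simp add: t(4) real_vec_diff)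
      also have "\<dots> = real_vec (X (t k)) $ i - real_vec (X (t 0)) $ i" by (rule sum_lessThan_telescope)
      finally show ?thesis using elim(1) by (simp add: t(2) good_def real_vec_def)
    qed
    have "(\<lambda>k. real_vec (X (t k)) /\<^sub>R real k) \<longlonglongrightarrow> drift"
      using elim(2) by (intro vec_tendstoI) (simp add: sum divide_inverse mult.commute)
    moreover have "norm (real_vec (X n) - real_vec (X (t k))) \<le> c * ((real_vec (X (t (Suc k))) - real_vec (X (t k))) \<bullet> l)"
      if n: "t k \<le> n" "n \<le> t (Suc k)" for k n
    proof -
      have "norm (real_vec (X n) - real_vec (X (t k))) \<le> c * (height (X n) - height (X (t k)))"
        using norm_C[OF regen_C[OF t(3) n(1)]] by (simp add: real_vec_diff height_def inner_diff_left)
      also have "\<dots> \<le> c * (height (X (t (Suc k))) - height (X (t k)))"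
        using regen_height_less[OF t(3)[of "Suc k"], of n] n(2) c_pos
        by (cases "n = t (Suc k)") auto
      finally show ?thesis by (simp add: height_def inner_diff_left)
    qed
    ultimately show ?case
      unfolding scales_to_def using renewal_interpolation[OF t(1,2), of "\<lambda>n. real_vec (X n)" drift c l] by blast
  qed
qed

text \<open>A path under \<open>path_law\<close> need not stay in \<open>C\<close>, but almost
  surely it has a regeneration, after which it inherits every almost sure property of
  \<open>Q\<close>.\<close>

theorem AE_asymptotic_direction:
  "AE X in path_law. (\<lambda>n. real_vec (X n) /\<^sub>R norm (real_vec (X n))) \<longlonglongrightarrow> sgn drift"
proof -
  have "AE X in path_law. \<forall>n. regen n X \<longrightarrow> scales_to drift (path_shift n X)"
    by (rule AE_path_law_regen) (use AE_Q_scales_to AE_Q_iff in blast)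
  with AE_good show ?thesis
  proof eventually_elim
    case (elim X)
    then obtain n where "regen n X" by (auto simp: good_def)
    then obtain \<kappa> where \<kappa>: "filterlim \<kappa> at_top sequentially"
        and lim: "(\<lambda>m. real_vec (X (n + m) - X n) /\<^sub>R \<kappa> m) \<longlonglongrightarrow> drift"
      using elim(2) unfolding scales_to_def path_shift_def by blast
    have "(\<lambda>m. inverse (\<kappa> m)) \<longlonglongrightarrow> 0"
      using \<kappa> by (rule tendsto_inverse_0_at_top)
    \<comment> \<open>The starting point of the shifted path becomes negligible under the
      normalization.\<close>
    then have "(\<lambda>m. real_vec (X (n + m) - X n) /\<^sub>R \<kappa> m + inverse (\<kappa> m) *\<^sub>R real_vec (X n)) \<longlonglongrightarrow> drift + 0 *\<^sub>R real_vec (X n)"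
      using lim by (intro tendsto_intros)
    then have "(\<lambda>m. real_vec (X (n + m)) /\<^sub>R \<kappa> m) \<longlonglongrightarrow> drift"
      by (simp add: real_vec_diff scaleR_diff_right)
    \<comment> \<open>\<open>sgn\<close> is continuous away from 0 and ignores positive scalars, so
      the unknown normalization drops out.\<close>
    then have "(\<lambda>m. sgn (real_vec (X (n + m)) /\<^sub>R \<kappa> m)) \<longlonglongrightarrow> sgn drift"
      by (rule tendsto_sgn) (rule drift_nonzero)
    moreover have "eventually (\<lambda>m. sgn (real_vec (X (n + m)) /\<^sub>R \<kappa> m) = sgn (real_vec (X (m + n)))) sequentially"
      using filterlim_at_top_dense[THEN iffD1, OF \<kappa>, rule_format, of 0]
      by eventually_elim (simp add: sgn_scaleR add.commute)
    ultimately have "(\<lambda>m. sgn (real_vec (X (m + n)))) \<longlonglongrightarrow> sgn drift"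
      by (rule Lim_transform_eventually)
    then have "(\<lambda>m. sgn (real_vec (X m))) \<longlonglongrightarrow> sgn drift"
      by (rule LIMSEQ_offset)
    then show ?case by (simp add: sgn_div_norm)
  qed
qed

end

section \<open>A cone from an open set of directions\<close>

context elliptic_environment
begin

lemma asymptotic_direction_if_open:
  assumes U: "open U" "U \<noteq> {}" and trans: "\<And>l. l \<in> U \<Longrightarrow> AE X in path_law. transient_in l X"
  shows "\<exists>\<nu>. norm \<nu> = 1 \<and>
    (AE X in path_law. (\<lambda>n. real_vec (X n) /\<^sub>R norm (real_vec (X n))) \<longlonglongrightarrow> \<nu>)"
proof -
  obtain l where l: "l \<in> U" using U by blast
  have "l \<noteq> 0"
  proof
    assume "l = 0"
    then have "AE X in path_law. False" using trans[OF l] by (simp add: not_transient_in_0)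
    then show False by (simp add: path.AE_False)
  qed
  then obtain j where j: "l $ j \<noteq> 0" by (auto simp: vec_eq_iff)
  obtain r where r: "r > 0" "cball l r \<subseteq> U" using U(1) l open_contains_cball by blast
  \<comment> \<open>\<open>\<delta> \<le> r\<close> keeps the perturbed directions in
    \<open>U\<close>; being smaller than the absolute value of \<open>l $ j\<close>, it leaves a
    unit step along axis \<open>j\<close> with positive product with all of them.\<close>
  define \<delta> where "\<delta> = min r (\<bar>l $ j\<bar> / 2)"
  have \<delta>: "0 < \<delta>" "\<delta> \<le> r" "\<delta> < \<bar>l $ j\<bar>" using r(1) j by (auto simp: \<delta>_def)
  \<comment> \<open>Perturbing \<open>l\<close> both ways along every axis: if \<open>y\<close> has
    nonnegative product with both perturbations along axis \<open>i\<close>, then its coordinate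
    \<open>i\<close> is bounded by the product of \<open>y\<close> with \<open>l\<close>.\<close>
  define W where "W = (\<lambda>(i, s). l + (s * \<delta>) *\<^sub>R axis i 1) ` (UNIV \<times> {-1, 1 :: real})"
  let ?C = "{y :: int ^ 'd. \<forall>w\<in>W. 0 \<le> real_vec y \<bullet> w}"
  have W_transient: "AE X in path_law. transient_in w X" if "w \<in> W" for w
  proof (rule trans)
    have "dist l w = \<delta>" using that \<delta>(1) by (auto simp: W_def dist_norm norm_minus_commute)
    then show "w \<in> U" using r(2) \<delta>(2) by auto
  qed
  have inner_W: "real_vec y \<bullet> (l + (s * \<delta>) *\<^sub>R axis i 1) = real_vec y \<bullet> l + s * \<delta> * real_vec y $ i"
    for y :: "int ^ 'd" and s i
    by (simp add: inner_add_right inner_axis)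
  define e :: "int ^ 'd" where "e = axis j (if l $ j > 0 then 1 else -1)"
  have "real_vec e \<bullet> w > 0" if "w \<in> W" for w
  proof -
    obtain i s where s: "s \<in> {-1, 1}" and w: "w = l + (s * \<delta>) *\<^sub>R axis i 1"
      using \<open>w \<in> W\<close> by (auto simp: W_def)
    have "real_vec e \<bullet> l = \<bar>l $ j\<bar>"
      using j by (simp add: e_def real_vec_axis inner_axis' )
    moreover have "\<bar>real_vec e $ i\<bar> \<le> 1" by (simp add: real_vec_def e_def axis_def)
    then have "\<bar>s * \<delta> * real_vec e $ i\<bar> \<le> \<delta>"
      using s \<delta>(1) by (auto simp: abs_mult)
    ultimately show ?thesis using \<delta>(3) unfolding w inner_W by linarith
  qed
  moreover have "e \<in> unit_steps" by (simp add: e_def axis_unit_step)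
  ultimately have stay: "emeasure path_law (stay ?C) \<noteq> 0"
    using W_transient by (intro stay_pos_if_transient) (auto simp: W_def)
  have component: "\<delta> * \<bar>real_vec y $ i\<bar> \<le> real_vec y \<bullet> l" if "y \<in> ?C" for y i
  proof -
    have "0 \<le> real_vec y \<bullet> (l + (s * \<delta>) *\<^sub>R axis i 1)" if "s \<in> {-1, 1}" for s
      using \<open>y \<in> ?C\<close> that by (auto simp: W_def)
    from this[of 1] this[of "-1"] show ?thesis
      unfolding inner_W by (auto simp: abs_if)
  qed
  interpret cone_renewal \<mu> ?C l "real CARD('d) / \<delta>"
  proof
    fix x assume x: "x \<in> ?C"
    \<comment> \<open>The Euclidean norm is at most the l1 norm, and summing the coordinate bounds
      gives the constant \<open>CARD('d) / \<delta>\<close>.\<close>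
    have "\<delta> * norm (real_vec x) \<le> \<delta> * (\<Sum>i\<in>UNIV. \<bar>real_vec x $ i\<bar>)"
      using \<delta>(1) by (intro mult_left_mono norm_le_l1_cart) auto
    also have "\<dots> \<le> (\<Sum>i\<in>(UNIV :: 'd set). real_vec x \<bullet> l)"
      unfolding sum_distrib_left using component[OF x] by (intro sum_mono)
    finally show "norm (real_vec x) \<le> real CARD('d) / \<delta> * (real_vec x \<bullet> l)"
      using \<delta>(1) by (simp add: field_simps)
  qed (use stay trans[OF l] \<delta>(1) in
      \<open>auto simp: real_vec_add inner_add_left path.emeasure_eq_measure zero_less_measure_iff\<close>)
  show ?thesis
    using AE_asymptotic_direction drift_nonzero by (intro exI[of _ "sgn drift"]) (simp add: norm_sgn)
qed

end

section \<open>Equivalence of the three statements\<close>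

theorem theorem1:
  fixes \<mu> :: "(int ^ 'd::finite \<Rightarrow> real) measure"
  assumes law: "prob_space \<mu>" "sets \<mu> = sets prob_vector_space"
    and elliptic: "strictly_elliptic \<mu>"
  shows
    "((\<exists>U :: (real ^ 'd) set. open U \<and> U \<noteq> {} \<and>
          (\<forall>l\<in>U. \<P>((\<omega>, X) in annealed \<mu> 0. transient_in l X) = 1))
      \<longleftrightarrow>
      (\<exists>\<nu>\<in>sphere (0 :: real ^ 'd) 1. AE (\<omega>, X) in annealed \<mu> 0.
          (\<lambda>n. real_vec (X n) /\<^sub>R norm (real_vec (X n))) \<longlonglongrightarrow> \<nu>))
     \<and>
     ((\<exists>\<nu>\<in>sphere (0 :: real ^ 'd) 1. AE (\<omega>, X) in annealed \<mu> 0.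
          (\<lambda>n. real_vec (X n) /\<^sub>R norm (real_vec (X n))) \<longlonglongrightarrow> \<nu>)
      \<longleftrightarrow>
      (\<exists>\<nu> :: real ^ 'd. \<nu> \<noteq> 0 \<and>
          (\<forall>l. l \<bullet> \<nu> > 0 \<longrightarrow>
             \<P>((\<omega>, X) in annealed \<mu> 0. transient_in l X) = 1)))"
    (is "(?open \<longleftrightarrow> ?direction) \<and> (_ \<longleftrightarrow> ?halfspace)")
proof -
  interpret elliptic_environment \<mu>
    by (intro elliptic_environment.intro random_environment.intro
        elliptic_environment_axioms.intro law elliptic)
  interpret A: prob_space "annealed \<mu> 0" by (rule prob_space_annealed)
  have transient: "\<P>((\<omega>, X) in annealed \<mu> 0. transient_in l X) = 1 \<longleftrightarrow>
      (AE X in path_law. transient_in l X)" for l :: "real ^ 'd"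
  proof -
    have "{p \<in> space (annealed \<mu> 0). transient_in l (snd p)} \<in> A.events" by measurable
    from A.prob_Collect_eq_1[OF this] show ?thesis
      unfolding AE_path_law_iff[OF measurable_transient_in]
      by (simp add: case_prod_unfold)
  qed
  have direction: "?direction \<longleftrightarrow> (\<exists>\<nu>. norm \<nu> = 1 \<and>
      (AE X in path_law. (\<lambda>n. real_vec (X n) /\<^sub>R norm (real_vec (X n))) \<longlonglongrightarrow> \<nu>))"
    by (subst AE_path_law_iff) (measurable, auto)
  have "?open \<Longrightarrow> ?direction"
    unfolding transient direction using asymptotic_direction_if_open by blast
  moreover have "?direction \<Longrightarrow> ?halfspace"
  proof -
    assume ?direction
    then obtain \<nu> where \<nu>: "norm \<nu> = 1"
        "AE X in path_law. (\<lambda>n. real_vec (X n) /\<^sub>R norm (real_vec (X n))) \<longlonglongrightarrow> \<nu>"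
      unfolding direction by blast
    then show ?halfspace
      unfolding transient using AE_transient_if_direction[OF \<nu>(1) _ \<nu>(2)] by (intro exI[of _ \<nu>]) auto
  qed
  \<comment> \<open>The half space of directions is itself the open set; it contains
    \<open>\<nu>\<close>.\<close>
  moreover have "?halfspace \<Longrightarrow> ?open"
  proof -
    assume ?halfspace
    then obtain \<nu> :: "real ^ 'd" where \<nu>: "\<nu> \<noteq> 0"
        "\<And>l. l \<bullet> \<nu> > 0 \<Longrightarrow> \<P>((\<omega>, X) in annealed \<mu> 0. transient_in l X) = 1"
      by blast
    have "open {l. l \<bullet> \<nu> > 0}"
      by (intro open_Collect_less continuous_intros)
    moreover have "\<nu> \<in> {l. l \<bullet> \<nu> > 0}" using \<nu>(1) by simp
    ultimately show ?open using \<nu>(2) by (intro exI[of _ "{l. l \<bullet> \<nu> > 0}"]) blast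
  qed
  ultimately show ?thesis by blast
qed

end
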